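(* Let $\mathcal{X}\subset\mathbb{R}^{d_X}$ and $\mathcal{Y}\subset\mathbb{R}^{d_Y}$ be compact and convex. Let $\{f_t\}_{t=1}^T$ be a sequence of functions satisfying the strong convexity–concavity, Lipschitz function, Lipschitz gradient and Lipschitz partial gradient assumptions listed in the context, and let $\{f_t\}_{t=1}^T\in\mathcal{M}_T\cap\mathcal{D}_T$. Let $$C_0=1-\frac{\sqrt2}{\delta_\mu}\max\left\{\frac{D_{\mathcal{X}}L_{XY}}{\sqrt{\mu_Y}},\frac{D_{\mathcal{Y}}L_{YX}}{\sqrt{\mu_X}}\right\},\qquad \delta_\mu=\sqrt{\min\left(\mu_X\delta_{\mathcal{X}}^2,\mu_Y\delta_{\mathcal{Y}}^2\right)}.$$ If $0<C_0\le1$, then the Frank-Wolfe method with dynamic gradient estimators (described in the context) satisfies: (a) Under the availability of the stochastic zeroth-order oracle, with $$\gamma_t=\gamma=\sqrt{\frac{\max(2W_T,V_T)}{T}},\quad m_t^Z=T(d_Z+5),\quad \nu_Z=\frac1{\sqrt{T(d_Z+3)^3}}\qquad(Z\in\{X,Y\}),$$ we have $$\mathfrak{R}_{DSPM}\le\mathcal{O}\left(\sqrt{T\max(2W_T,V_T)}\left(1+\frac{\sigma^2}{\max(2W_T,V_T)}\right)\right).$$ Hence the total number of calls to the stochastic zeroth-order oracle is $\mathcal{O}((d_X+d_Y)T^2)$. (b) Under the availability of the stochastic first-order oracle, with $\gamma_t=\gamma=\sqrt{\max(2W_T,V_T)/T}$ and $m_t=T$, we have $$\mathfrak{R}_{D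SPM}\le\mathcal{O}\left(\sqrt{T\max(2W_T,V_T)}\left(1+\frac{\sigma^2}{\max(2W_T,V_T)}\right)\right).$$
   Context: For $t=1,\dots,T$, $f_t(x,y)=\mathbf{E}_\xi[F_t(x,y,\xi)]$ with saddle point $(x_t^*,y_t^* )=\arg\min_{x\in\mathcal{X}}\arg\max_{y\in\mathcal{Y}}f_t(x,y)$; $\|\cdot\|$ is Euclidean. Assumptions on $F_t$ (almost surely in $\xi$). Strong convexity–concavity: $F_t$ is continuously differentiable, $\mu_X$-strongly convex in $x$, $\mu_Y$-strongly concave in $y$; $\mu=\min(\mu_X,\mu_Y)$. Lipschitz function: $F_t$ is $L_X$-Lipschitz in $x$ and $L_Y$-Lipschitz in $y$; $L=\max(L_X,L_Y)$. Lipschitz gradient: $\nabla_xF_t$ is $L_{GX}$-Lipschitz in $x$ for all $y$, $\nabla_yF_t$ is $L_{GY}$-Lipschitz in $y$ for all $x$; $L_G=\max(L_{GX},L_{GY})$. Lipschitz partial gradient: $\nabla_xF_t$ is $L_{XY}$-Lipschitz in $y$ for all $x$ and $\nabla_yF_t$ is $L_{YX}$-Lipschitz in $x$ for all $y$. $D_{\mathcal{X}},D_{\mathcal{Y}}$ bound the diameters of $\mathcal{X},\mathcal{Y}$. The saddle points $(x_t^*,y_t^* )$ are assumed to lie in the interior of $\mathcal{X}\times\mathcal{Y}$, and $\delta_{\mathcal{X}},\delta_{\mathcal{Y}}>0$ are the border distances $\delta_{\mathcal{X}}=\min_t\min_{s\in\partial\mathcal{X}}\|x_t^*-s\|$, $\delta_{\mathcal{Y}}=\min_t\min_{s\in\partial\mathcal{Y}}\|y_t^*-s\|$.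 Uncertainty sets: for given $V_T,W_T\ge0$, $\{f_t\}\in\mathcal{M}_T$ means $\sum_{t=1}^T\left(\|x_{t+1}^*-x_t^*\|^2+\|y_{t+1}^*-y_t^*\|^2\right)\le V_T$, and $\{f_t\}\in\mathcal{D}_T$ means $\sum_{t=1}^T\sup_{(x,y)\in\mathcal{X}\times\mathcal{Y}}|f_t(x,y)-f_{t+1}(x,y)|\le W_T$, with the convention $f_{T+1}=f_T$. Oracles. Zeroth-order: returns $F_t(x,y,\xi)$ with mean $f_t(x,y)$, with $\mathbf{E}[\nabla_zF_t]=\nabla_zf_t$ and $\mathbf{E}\|\nabla_zF_t-\nabla_zf_t\|^2\le\sigma^2$ for $z\in\{x,y\}$. First-order: returns $\nabla_zF_t(x,y,\xi)$ with mean $\nabla_zf_t(x,y)$ and $\mathbf{E}\|\nabla_zF_t-\nabla_zf_t\|^2\le\sigma^2$ for $z\in\{x,y\}$. Dynamic gradient estimators at round $t$ (fresh independent noise). Zeroth-order, with independent $u_{j,x}\sim N(0,I_{d_X})$, $u_{j,y}\sim N(0,I_{d_Y})$: $$\bar G_t^x(x,y)=\frac1{m_t^X}\sum_{j=1}^{m_t^X}\frac{F_t(x+\nu_Xu_{j,x},y,\xi_{j,x})-F_t(x,y,\xi_{j,x})}{\nu_X}u_{j,x},\quad \bar G_t^y(x,y)=\frac1{m_t^Y}\sum_{j=1}^{m_t^Y}\frac{F_t(x,y+\nu_Yu_{j,y},\xi_{j,y})-F_t(x,y,\xi_{j,y})}{\nu_Y}u_{j,y}.$$ First-order: $\bar G_t^z(x,y)=\frac1{m_t}\sum_{j=1}^{m_t}\nabla_zF_t(x,y,\xi_j)$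 for $z\in\{x,y\}$. Frank-Wolfe method: from $z_1=(x_1,y_1)\in\mathcal{X}\times\mathcal{Y}$, for $t=1,2,\dots$ set $r_t=(\bar G_t^x(x_t,y_t),-\bar G_t^y(x_t,y_t))$, $s_t\in\arg\min_{z\in\mathcal{X}\times\mathcal{Y}}\langle z,r_t\rangle$, $z_{t+1}=(1-\gamma_t)z_t+\gamma_ts_t$, $z_t=(x_t,y_t)$. Dynamic saddle-point merit regret: $\mathfrak{R}_{DSPM}=\mathbf{E}\left[\sum_{t=1}^T\left(f_t(x_t,y_t)-f_t(x_t^*,y_t^* )\right)^2\right]$. $\mathcal{O}(\cdot)$ hides constants depending only on the problem constants ($\mu,L$, gradient-Lipschitz constants, $D_{\mathcal{X}},D_{\mathcal{Y}},C_0$), not on $T,V_T,W_T,\sigma,d_X,d_Y$.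
   Formalization: Assumes 0 < max(2W_T,V_T) ≤ T (so γ lies in (0,1]) and max(2W_T,V_T)+σ² ≥ c for some fixed c>0 on which the O-constant may depend; with σ=0 and max(2W_T,V_T)→0 the bound is false for constants independent of V_T, W_T, σ. *)

theory Defs
  imports "HOL-Probability.Probability"
begin

text \<open>
  \<open>\<real>\<^sup>d\<close> is the carrier of the library's \<^const>\<open>Euclidean_space\<close> \<open>d\<close>, i.e. the sequences
  vanishing from index \<open>d\<close> on. Dimensions are thus ordinary natural numbers, so that one constant
  can be asserted to work for all dimensions at once. On each \<open>\<real>\<^sup>d\<close> the topology of
  \<^typ>\<open>nat \<Rightarrow> real\<close> is the usual one.
\<close>

type_synonym vec = "nat \<Rightarrow> real"

abbreviation Rn :: "nat \<Rightarrow> vec set" where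
  "Rn d \<equiv> topspace (Euclidean_space d)"

definition einner :: "nat \<Rightarrow> vec \<Rightarrow> vec \<Rightarrow> real" where
  "einner d u v = (\<Sum>i<d. u i * v i)"

definition enorm :: "nat \<Rightarrow> vec \<Rightarrow> real" where
  "enorm d v = L2_set v {..<d}"

definition conv_comb :: "real \<Rightarrow> vec \<Rightarrow> vec \<Rightarrow> vec" where
  "conv_comb l a b = (\<lambda>i. (1 - l) * a i + l * b i)"

definition convex_set :: "vec set \<Rightarrow> bool" where
  "convex_set S \<longleftrightarrow> (\<forall>a\<in>S. \<forall>b\<in>S. \<forall>l\<in>{0..1}. conv_comb l a b \<in> S)"

definition strongly_convex_on :: "nat \<Rightarrow> real \<Rightarrow> vec set \<Rightarrow> (vec \<Rightarrow> real) \<Rightarrow> bool" where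
  "strongly_convex_on d \<mu> S h \<longleftrightarrow>
     (\<forall>a\<in>S. \<forall>b\<in>S. \<forall>l\<in>{0..1}.
        h (conv_comb l a b) \<le> (1 - l) * h a + l * h b - \<mu> / 2 * l * (1 - l) * (enorm d (a - b))\<^sup>2)"

definition lipschitz_fun_on :: "nat \<Rightarrow> real \<Rightarrow> vec set \<Rightarrow> (vec \<Rightarrow> real) \<Rightarrow> bool" where
  "lipschitz_fun_on d c S h \<longleftrightarrow> (\<forall>a\<in>S. \<forall>b\<in>S. \<bar>h a - h b\<bar> \<le> c * enorm d (a - b))"

text \<open>A map from \<open>\<real>\<^sup>d\<close> to \<open>\<real>\<^sup>e\<close>.\<close>

definition lipschitz_map_on :: "nat \<Rightarrow> nat \<Rightarrow> real \<Rightarrow> vec set \<Rightarrow> (vec \<Rightarrow> vec) \<Rightarrow> bool" where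
  "lipschitz_map_on d e c S G \<longleftrightarrow> (\<forall>a\<in>S. \<forall>b\<in>S. enorm e (G a - G b) \<le> c * enorm d (a - b))"

text \<open>Frechet gradient, relative to a subset \<open>A\<close> of \<open>\<real>\<^sup>d\<close>.\<close>

definition has_gradient :: "nat \<Rightarrow> vec set \<Rightarrow> (vec \<Rightarrow> real) \<Rightarrow> vec \<Rightarrow> vec \<Rightarrow> bool" where
  "has_gradient d A h g x \<longleftrightarrow> g \<in> Rn d \<and>
     ((\<lambda>x'. (h x' - h x - einner d g (x' - x)) / enorm d (x' - x)) \<longlongrightarrow> 0) (at x within A)"

definition std_gauss :: "nat \<Rightarrow> vec measure" where
  "std_gauss d = distr (PiM {..<d} (\<lambda>_. density lborel std_normal_density)) borel
                   (\<lambda>u i. if i < d then u i else 0)"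


section \<open>Stochastic saddle-point problems\<close>

text \<open>
  \<open>sp_noise p t\<close> is the law of \<open>\<xi>\<close> at round \<open>t\<close>; \<open>sp_gradX\<close>, \<open>sp_gradY\<close> are the partial gradients
  of \<open>sp_F\<close> (see \<open>continuously_differentiable\<close>), and \<open>sp_DX\<close>, \<open>sp_DY\<close> bound the diameters.
\<close>

record 'k sp_problem =
  sp_dX :: nat
  sp_dY :: nat
  sp_X :: "vec set"
  sp_Y :: "vec set"
  sp_T :: nat
  sp_noise :: "nat \<Rightarrow> 'k measure"
  sp_F :: "nat \<Rightarrow> vec \<Rightarrow> vec \<Rightarrow> 'k \<Rightarrow> real"
  sp_gradX :: "nat \<Rightarrow> vec \<Rightarrow> vec \<Rightarrow> 'k \<Rightarrow> vec"
  sp_gradY :: "nat \<Rightarrow> vec \<Rightarrow> vec \<Rightarrow> 'k \<Rightarrow> vec"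
  sp_xstar :: "nat \<Rightarrow> vec"
  sp_ystar :: "nat \<Rightarrow> vec"
  sp_muX :: real
  sp_muY :: real
  sp_LX :: real
  sp_LY :: real
  sp_LGX :: real
  sp_LGY :: real
  sp_LXY :: real
  sp_LYX :: real
  sp_DX :: real
  sp_DY :: real

definition sp_f :: "'k sp_problem \<Rightarrow> nat \<Rightarrow> vec \<Rightarrow> vec \<Rightarrow> real" where
  "sp_f p t x y = (\<integral>\<xi>. sp_F p t x y \<xi> \<partial>sp_noise p t)"

definition sp_feasible_sets :: "'k sp_problem \<Rightarrow> bool" where
  "sp_feasible_sets p \<longleftrightarrow>
     1 \<le> sp_dX p \<and> compactin (Euclidean_space (sp_dX p)) (sp_X p) \<and> convex_set (sp_X p) \<and>
     (\<forall>a\<in>sp_X p. \<forall>b\<in>sp_X p. enorm (sp_dX p) (a - b) \<le> sp_DX p) \<and>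
     1 \<le> sp_dY p \<and> compactin (Euclidean_space (sp_dY p)) (sp_Y p) \<and> convex_set (sp_Y p) \<and>
     (\<forall>a\<in>sp_Y p. \<forall>b\<in>sp_Y p. enorm (sp_dY p) (a - b) \<le> sp_DY p)"

definition is_saddle_point :: "vec set \<Rightarrow> vec set \<Rightarrow> (vec \<Rightarrow> vec \<Rightarrow> real) \<Rightarrow> vec \<Rightarrow> vec \<Rightarrow> bool" where
  "is_saddle_point X Y g xs ys \<longleftrightarrow> xs \<in> X \<and> ys \<in> Y \<and>
     (\<forall>x\<in>X. \<forall>y\<in>Y. g xs y \<le> g xs ys \<and> g xs ys \<le> g x ys)"

definition interior_saddle_points :: "'k sp_problem \<Rightarrow> bool" where
  "interior_saddle_points p \<longleftrightarrow> (\<forall>t\<in>{1..sp_T p}.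
     is_saddle_point (sp_X p) (sp_Y p) (sp_f p t) (sp_xstar p t) (sp_ystar p t) \<and>
     sp_xstar p t \<in> Euclidean_space (sp_dX p) interior_of sp_X p \<and>
     sp_ystar p t \<in> Euclidean_space (sp_dY p) interior_of sp_Y p)"

text \<open>
  Assumptions on a realization \<open>F\<^sub>t(\<cdot>, \<cdot>, \<xi>)\<close>. A strongly convex function is not globally Lipschitz,
  so strong convexity-concavity and the Lipschitz assumption refer to the feasible sets. Gaussian
  smoothing evaluates \<open>F\<^sub>t\<close> outside of them, in one block at a time; the sets \<open>A \<supseteq> X\<close> and \<open>B \<supseteq> Y\<close>
  on which each block has a Lipschitz gradient are therefore parameters.
\<close>

definition strongly_convex_concave :: "'k sp_problem \<Rightarrow> nat \<Rightarrow> 'k \<Rightarrow> bool" where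
  "strongly_convex_concave p t \<xi> \<longleftrightarrow>
     (\<forall>y\<in>sp_Y p. strongly_convex_on (sp_dX p) (sp_muX p) (sp_X p) (\<lambda>x. sp_F p t x y \<xi>)) \<and>
     (\<forall>x\<in>sp_X p. strongly_convex_on (sp_dY p) (sp_muY p) (sp_Y p) (\<lambda>y. - sp_F p t x y \<xi>))"

definition lipschitz_function :: "'k sp_problem \<Rightarrow> nat \<Rightarrow> 'k \<Rightarrow> bool" where
  "lipschitz_function p t \<xi> \<longleftrightarrow>
     (\<forall>y\<in>sp_Y p. lipschitz_fun_on (sp_dX p) (sp_LX p) (sp_X p) (\<lambda>x. sp_F p t x y \<xi>)) \<and>
     (\<forall>x\<in>sp_X p. lipschitz_fun_on (sp_dY p) (sp_LY p) (sp_Y p) (\<lambda>y. sp_F p t x y \<xi>))"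

definition continuously_differentiable ::
    "'k sp_problem \<Rightarrow> vec set \<Rightarrow> vec set \<Rightarrow> nat \<Rightarrow> 'k \<Rightarrow> bool" where
  "continuously_differentiable p A B t \<xi> \<longleftrightarrow>
     (\<forall>x\<in>A. \<forall>y\<in>sp_Y p. has_gradient (sp_dX p) A (\<lambda>x'. sp_F p t x' y \<xi>) (sp_gradX p t x y \<xi>) x) \<and>
     (\<forall>x\<in>sp_X p. \<forall>y\<in>B. has_gradient (sp_dY p) B (\<lambda>y'. sp_F p t x y' \<xi>) (sp_gradY p t x y \<xi>) y) \<and>
     continuous_on (sp_X p \<times> sp_Y p) (\<lambda>(x, y). sp_gradX p t x y \<xi>) \<and>
     continuous_on (sp_X p \<times> sp_Y p) (\<lambda>(x, y). sp_gradY p t x y \<xi>)"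

definition lipschitz_gradient ::
    "'k sp_problem \<Rightarrow> vec set \<Rightarrow> vec set \<Rightarrow> nat \<Rightarrow> 'k \<Rightarrow> bool" where
  "lipschitz_gradient p A B t \<xi> \<longleftrightarrow>
     (\<forall>y\<in>sp_Y p. lipschitz_map_on (sp_dX p) (sp_dX p) (sp_LGX p) A (\<lambda>x. sp_gradX p t x y \<xi>)) \<and>
     (\<forall>x\<in>sp_X p. lipschitz_map_on (sp_dY p) (sp_dY p) (sp_LGY p) B (\<lambda>y. sp_gradY p t x y \<xi>))"

definition lipschitz_partial_gradient :: "'k sp_problem \<Rightarrow> nat \<Rightarrow> 'k \<Rightarrow> bool" where
  "lipschitz_partial_gradient p t \<xi> \<longleftrightarrow>
     (\<forall>x\<in>sp_X p. lipschitz_map_on (sp_dY p) (sp_dX p) (sp_LXY p) (sp_Y p) (\<lambda>y. sp_gradX p t x y \<xi>)) \<and>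
     (\<forall>y\<in>sp_Y p. lipschitz_map_on (sp_dX p) (sp_dY p) (sp_LYX p) (sp_X p) (\<lambda>x. sp_gradY p t x y \<xi>))"

text \<open>
  Joint measurability on the whole space is no restriction: outside of the relevant closed sets the
  functions may be set to 0.
\<close>

definition well_posed_noise :: "'k sp_problem \<Rightarrow> vec set \<Rightarrow> vec set \<Rightarrow> nat \<Rightarrow> bool" where
  "well_posed_noise p A B t \<longleftrightarrow> prob_space (sp_noise p t) \<and>
     (\<lambda>((x, y), \<xi>). sp_F p t x y \<xi>) \<in> borel_measurable ((borel \<Otimes>\<^sub>M borel) \<Otimes>\<^sub>M sp_noise p t) \<and>
     (\<lambda>((x, y), \<xi>). sp_gradX p t x y \<xi>) \<in> borel_measurable ((borel \<Otimes>\<^sub>M borel) \<Otimes>\<^sub>M sp_noise p t) \<and>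
     (\<lambda>((x, y), \<xi>). sp_gradY p t x y \<xi>) \<in> borel_measurable ((borel \<Otimes>\<^sub>M borel) \<Otimes>\<^sub>M sp_noise p t) \<and>
     (\<forall>(x, y)\<in>A \<times> sp_Y p \<union> sp_X p \<times> B. integrable (sp_noise p t) (sp_F p t x y))"

definition sp_assumptions :: "'k sp_problem \<Rightarrow> vec set \<Rightarrow> vec set \<Rightarrow> bool" where
  "sp_assumptions p A B \<longleftrightarrow>
     1 \<le> sp_T p \<and> sp_feasible_sets p \<and> interior_saddle_points p \<and> 0 < sp_muX p \<and> 0 < sp_muY p \<and>
     (\<forall>t\<in>{1..sp_T p}. well_posed_noise p A B t \<and>
        (AE \<xi> in sp_noise p t. strongly_convex_concave p t \<xi> \<and> lipschitz_function p t \<xi> \<and>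
           continuously_differentiable p A B t \<xi> \<and> lipschitz_gradient p A B t \<xi> \<and>
           lipschitz_partial_gradient p t \<xi>))"

text \<open>
  \<open>\<bold>E \<nabla>\<^sub>zF\<^sub>t = \<nabla>\<^sub>zf\<^sub>t\<close> is stated as: the coordinatewise mean of \<open>\<nabla>\<^sub>zF\<^sub>t\<close> is a gradient of \<open>f\<^sub>t\<close>. That the
  value oracle has mean \<open>f\<^sub>t\<close> is the definition of \<open>sp_f\<close>.
\<close>

definition mean_gradX :: "'k sp_problem \<Rightarrow> nat \<Rightarrow> vec \<Rightarrow> vec \<Rightarrow> vec" where
  "mean_gradX p t x y = (\<lambda>i. \<integral>\<xi>. sp_gradX p t x y \<xi> i \<partial>sp_noise p t)"

definition mean_gradY :: "'k sp_problem \<Rightarrow> nat \<Rightarrow> vec \<Rightarrow> vec \<Rightarrow> vec" where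
  "mean_gradY p t x y = (\<lambda>i. \<integral>\<xi>. sp_gradY p t x y \<xi> i \<partial>sp_noise p t)"

definition stochastic_oracle :: "'k sp_problem \<Rightarrow> real \<Rightarrow> bool" where
  "stochastic_oracle p \<sigma> \<longleftrightarrow> (\<forall>t\<in>{1..sp_T p}. \<forall>x\<in>sp_X p. \<forall>y\<in>sp_Y p.
     (\<forall>i<sp_dX p. integrable (sp_noise p t) (\<lambda>\<xi>. sp_gradX p t x y \<xi> i)) \<and>
     (\<forall>i<sp_dY p. integrable (sp_noise p t) (\<lambda>\<xi>. sp_gradY p t x y \<xi> i)) \<and>
     has_gradient (sp_dX p) (sp_X p) (\<lambda>x'. sp_f p t x' y) (mean_gradX p t x y) x \<and>
     has_gradient (sp_dY p) (sp_Y p) (\<lambda>y'. sp_f p t x y') (mean_gradY p t x y) y \<and>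
     (\<integral>\<^sup>+\<xi>. ennreal ((enorm (sp_dX p) (sp_gradX p t x y \<xi> - mean_gradX p t x y))\<^sup>2) \<partial>sp_noise p t)
       \<le> ennreal (\<sigma>\<^sup>2) \<and>
     (\<integral>\<^sup>+\<xi>. ennreal ((enorm (sp_dY p) (sp_gradY p t x y \<xi> - mean_gradY p t x y))\<^sup>2) \<partial>sp_noise p t)
       \<le> ennreal (\<sigma>\<^sup>2))"

text \<open>The convention \<open>f\<^bsub>T+1\<^esub> = f\<^sub>T\<close> (hence also for the saddle points).\<close>

definition next_round :: "'k sp_problem \<Rightarrow> nat \<Rightarrow> nat" where
  "next_round p t = min (t + 1) (sp_T p)"

definition in_uncertainty_M :: "'k sp_problem \<Rightarrow> real \<Rightarrow> bool" where
  "in_uncertainty_M p V \<longleftrightarrow>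
     (\<Sum>t=1..sp_T p. (enorm (sp_dX p) (sp_xstar p (next_round p t) - sp_xstar p t))\<^sup>2 +
                    (enorm (sp_dY p) (sp_ystar p (next_round p t) - sp_ystar p t))\<^sup>2) \<le> V"

definition in_uncertainty_D :: "'k sp_problem \<Rightarrow> real \<Rightarrow> bool" where
  "in_uncertainty_D p W \<longleftrightarrow>
     (\<Sum>t=1..sp_T p. SUP (x, y)\<in>sp_X p \<times> sp_Y p. \<bar>sp_f p t x y - sp_f p (next_round p t) x y\<bar>) \<le> W"

definition border_distance :: "nat \<Rightarrow> vec set \<Rightarrow> nat \<Rightarrow> (nat \<Rightarrow> vec) \<Rightarrow> real" where
  "border_distance d S T zs =
     (INF t\<in>{1..T}. INF s\<in>Euclidean_space d frontier_of S. enorm d (zs t - s))"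

definition sp_delta_mu :: "'k sp_problem \<Rightarrow> real" where
  "sp_delta_mu p = sqrt (min
     (sp_muX p * (border_distance (sp_dX p) (sp_X p) (sp_T p) (sp_xstar p))\<^sup>2)
     (sp_muY p * (border_distance (sp_dY p) (sp_Y p) (sp_T p) (sp_ystar p))\<^sup>2))"

definition sp_C0 :: "'k sp_problem \<Rightarrow> real" where
  "sp_C0 p = 1 - sqrt 2 / sp_delta_mu p *
     max (sp_DX p * sp_LXY p / sqrt (sp_muY p)) (sp_DY p * sp_LYX p / sqrt (sp_muX p))"


section \<open>Frank-Wolfe method with dynamic gradient estimators\<close>

text \<open>
  \<open>h\<close> is \<open>F\<^sub>t\<close> as a function of the estimated block, \<open>z\<close> the base point, and
  \<open>w j = (\<xi>\<^sub>j, u\<^sub>j)\<close> the \<open>j\<close>-th sample.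
\<close>

definition zo_estimator ::
    "nat \<Rightarrow> real \<Rightarrow> (vec \<Rightarrow> 'k \<Rightarrow> real) \<Rightarrow> vec \<Rightarrow> (nat \<Rightarrow> 'k \<times> vec) \<Rightarrow> vec" where
  "zo_estimator m \<nu> h z w = (\<lambda>i. 1 / real m *
     (\<Sum>j=1..m. (h (\<lambda>k. z k + \<nu> * snd (w j) k) (fst (w j)) - h z (fst (w j))) / \<nu> * snd (w j) i))"

definition fo_estimator :: "nat \<Rightarrow> ('k \<Rightarrow> vec) \<Rightarrow> (nat \<Rightarrow> 'k) \<Rightarrow> vec" where
  "fo_estimator m g w = (\<lambda>i. 1 / real m * (\<Sum>j=1..m. g (w j) i))"

definition fw_path ::
    "'k sp_problem \<Rightarrow> (nat \<Rightarrow> real) \<Rightarrow> vec \<Rightarrow> vec \<Rightarrow> (nat \<Rightarrow> vec) \<Rightarrow> (nat \<Rightarrow> vec) \<Rightarrow>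
     (nat \<Rightarrow> vec) \<Rightarrow> (nat \<Rightarrow> vec) \<Rightarrow> bool" where
  "fw_path p \<gamma> x1 y1 GX GY x y \<longleftrightarrow> x 1 = x1 \<and> y 1 = y1 \<and>
     (\<forall>t\<in>{1..sp_T p}. \<exists>sx sy.
        is_arg_min (\<lambda>(a, b). einner (sp_dX p) a (GX t) + einner (sp_dY p) b (- GY t))
                   (\<lambda>z. z \<in> sp_X p \<times> sp_Y p) (sx, sy) \<and>
        x (t + 1) = conv_comb (\<gamma> t) (x t) sx \<and>
        y (t + 1) = conv_comb (\<gamma> t) (y t) sy)"

text \<open>
  \<open>N\<close> has law \<open>S\<close> and is independent of \<open>z\<close>. Below, \<open>z\<close> is the current iterate and \<open>N\<close> the batch of
  samples drawn in the current round. Ties in the linear minimization may thus be broken in any way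
  that does not look at future samples.
\<close>

definition fresh_noise ::
    "'w measure \<Rightarrow> ('w \<Rightarrow> 'z::topological_space) \<Rightarrow> 'n measure \<Rightarrow> ('w \<Rightarrow> 'n) \<Rightarrow> bool" where
  "fresh_noise M z S N \<longleftrightarrow>
     z \<in> borel_measurable M \<and> N \<in> measurable M S \<and> distr M S N = S \<and>
     prob_space.indep_set M {z -` A \<inter> space M |A. A \<in> sets borel} {N -` C \<inter> space M |C. C \<in> sets S}"

text \<open>
  \<open>NX t \<omega> j = (\<xi>\<^bsub>j,x\<^esub>, u\<^bsub>j,x\<^esub>)\<close> and \<open>NY t \<omega> j = (\<xi>\<^bsub>j,y\<^esub>, u\<^bsub>j,y\<^esub>)\<close> at round \<open>t\<close>.
\<close>

definition zo_frank_wolfe ::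
    "'k sp_problem \<Rightarrow> 'w measure \<Rightarrow> (nat \<Rightarrow> real) \<Rightarrow> (nat \<Rightarrow> nat) \<Rightarrow> (nat \<Rightarrow> nat) \<Rightarrow> real \<Rightarrow> real \<Rightarrow>
     vec \<Rightarrow> vec \<Rightarrow> (nat \<Rightarrow> 'w \<Rightarrow> nat \<Rightarrow> 'k \<times> vec) \<Rightarrow> (nat \<Rightarrow> 'w \<Rightarrow> nat \<Rightarrow> 'k \<times> vec) \<Rightarrow>
     (nat \<Rightarrow> 'w \<Rightarrow> vec) \<Rightarrow> (nat \<Rightarrow> 'w \<Rightarrow> vec) \<Rightarrow> bool" where
  "zo_frank_wolfe p M \<gamma> mX mY \<nu>X \<nu>Y x1 y1 NX NY x y \<longleftrightarrow> prob_space M \<and>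
     (\<forall>t\<in>{1..sp_T p}. fresh_noise M (\<lambda>\<omega>. (x t \<omega>, y t \<omega>))
        (PiM {1..mX t} (\<lambda>_. sp_noise p t \<Otimes>\<^sub>M std_gauss (sp_dX p)) \<Otimes>\<^sub>M
         PiM {1..mY t} (\<lambda>_. sp_noise p t \<Otimes>\<^sub>M std_gauss (sp_dY p)))
        (\<lambda>\<omega>. (NX t \<omega>, NY t \<omega>))) \<and>
     (\<forall>\<omega>\<in>space M. fw_path p \<gamma> x1 y1
        (\<lambda>t. zo_estimator (mX t) \<nu>X (\<lambda>a. sp_F p t a (y t \<omega>)) (x t \<omega>) (NX t \<omega>))
        (\<lambda>t. zo_estimator (mY t) \<nu>Y (\<lambda>b. sp_F p t (x t \<omega>) b) (y t \<omega>) (NY t \<omega>))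
        (\<lambda>t. x t \<omega>) (\<lambda>t. y t \<omega>))"

text \<open>Each summand of each of the two estimators takes two function evaluations.\<close>

definition zo_calls :: "nat \<Rightarrow> (nat \<Rightarrow> nat) \<Rightarrow> (nat \<Rightarrow> nat) \<Rightarrow> nat" where
  "zo_calls T mX mY = (\<Sum>t=1..T. 2 * mX t + 2 * mY t)"

text \<open>The two partial gradients are evaluated at the same samples \<open>\<xi>\<^sub>j = N t \<omega> j\<close>.\<close>

definition fo_frank_wolfe ::
    "'k sp_problem \<Rightarrow> 'w measure \<Rightarrow> (nat \<Rightarrow> real) \<Rightarrow> (nat \<Rightarrow> nat) \<Rightarrow>
     vec \<Rightarrow> vec \<Rightarrow> (nat \<Rightarrow> 'w \<Rightarrow> nat \<Rightarrow> 'k) \<Rightarrow> (nat \<Rightarrow> 'w \<Rightarrow> vec) \<Rightarrow> (nat \<Rightarrow> 'w \<Rightarrow> vec) \<Rightarrow> bool" where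
  "fo_frank_wolfe p M \<gamma> m x1 y1 N x y \<longleftrightarrow> prob_space M \<and>
     (\<forall>t\<in>{1..sp_T p}. fresh_noise M (\<lambda>\<omega>. (x t \<omega>, y t \<omega>)) (PiM {1..m t} (\<lambda>_. sp_noise p t)) (N t)) \<and>
     (\<forall>\<omega>\<in>space M. fw_path p \<gamma> x1 y1
        (\<lambda>t. fo_estimator (m t) (sp_gradX p t (x t \<omega>) (y t \<omega>)) (N t \<omega>))
        (\<lambda>t. fo_estimator (m t) (sp_gradY p t (x t \<omega>) (y t \<omega>)) (N t \<omega>))
        (\<lambda>t. x t \<omega>) (\<lambda>t. y t \<omega>))"

definition regret_DSPM ::
    "'k sp_problem \<Rightarrow> 'w measure \<Rightarrow> (nat \<Rightarrow> 'w \<Rightarrow> vec) \<Rightarrow> (nat \<Rightarrow> 'w \<Rightarrow> vec) \<Rightarrow> real" where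
  "regret_DSPM p M x y = (\<integral>\<omega>. (\<Sum>t=1..sp_T p.
     (sp_f p t (x t \<omega>) (y t \<omega>) - sp_f p t (sp_xstar p t) (sp_ystar p t))\<^sup>2) \<partial>M)"

text \<open>
  The range of \<open>T, V\<^sub>T, W\<^sub>T, \<sigma>\<close> in which the asymptotic bounds are claimed, with \<open>b = max (2W\<^sub>T) V\<^sub>T\<close>.
  The condition \<open>0 < b \<le> T\<close> says that the step size \<open>\<surd>(b/T)\<close> lies in \<open>(0,1]\<close>; otherwise the Frank-Wolfe
  iterates leave the feasible sets or never move. The last condition excludes \<open>b\<close> and \<open>\<sigma>\<close> from
  vanishing simultaneously: the regret is at least the squared initial error, whereas
  \<open>\<surd>(T b) (1 + \<sigma>\<^sup>2/b) = \<surd>T (b + \<sigma>\<^sup>2)/\<surd>b\<close> tends to 0 for \<open>\<sigma> = 0\<close> and \<open>b \<rightarrow> 0\<close>.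
\<close>

definition bound_regime :: "real \<Rightarrow> nat \<Rightarrow> real \<Rightarrow> real \<Rightarrow> real \<Rightarrow> bool" where
  "bound_regime c T V W \<sigma> \<longleftrightarrow> 0 \<le> V \<and> 0 \<le> W \<and> 0 \<le> \<sigma> \<and>
     0 < max (2 * W) V \<and> max (2 * W) V \<le> real T \<and> c \<le> max (2 * W) V + \<sigma>\<^sup>2"

definition regret_rate :: "nat \<Rightarrow> real \<Rightarrow> real \<Rightarrow> real \<Rightarrow> real" where
  "regret_rate T V W \<sigma> = sqrt (real T * max (2 * W) V) * (1 + \<sigma>\<^sup>2 / max (2 * W) V)"

end

(*
  Idea. Track the duality gap w_t(x, y) = max_Y f_t(x, .) - min_X f_t(., y) at the iterates. Strong
  convexity-concavity bounds the squared merit by a multiple of w_t, and w_t changes by at most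
  2 sup |f_t - f_{t+1}| between rounds, so only W_T enters and no path length of the saddle points.

  In one step the Frank-Wolfe gap q at the exact gradients decreases w_t by gamma q, up to the
  smoothness term O(gamma^2), the estimator errors, and the coupling of the two blocks,
    gamma (D_X L_XY |y_hat - y| + D_Y L_YX |x_hat - x|)
  with best responses x_hat, y_hat. Since the saddle point has distance delta from the border, q
  dominates delta times the gradient norms, hence also sqrt 2 delta_mu sqrt w_t; the coupling is thus
  at most (1 - C_0) gamma q, and the remaining C_0 q is at least C_0 w_t.

  The expected estimator errors are O(1 / sqrt T) independently of the dimension, because the second
  moment of <g, u> u for a Gaussian u is at most 3 d |g|^2, which the batch size T (d + 5) compensates.
*)
theory Submission
  imports Defs
begin

section \<open>Euclidean geometry in coordinates\<close>

text \<open>The error bounds must not depend on the horizon or the dimensions, so the stochastic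
  gradients need an almost sure bound by problem constants. The Lipschitz assumption yields such a
  bound at interior points of the feasible set, where one can move in the direction of the gradient.
  The saddle point is one of them, and the Lipschitz gradient carries the bound from there over the
  diameter. The distance to the border thus serves twice, for this bound and for the lower bound on
  the Frank-Wolfe gap.

  Summing over the rounds and dividing by \<open>\<gamma>\<close> leaves the initial gap and a
  multiple of \<open>sqrt b\<close>, with \<open>b = max (2 * W) V\<close>. Neither is a multiple of
  \<open>b\<close>; the condition \<open>c \<le> b + \<sigma>\<^sup>2\<close> turns both into
  multiples of \<open>b + \<sigma>\<^sup>2\<close>, which is how \<sigma> enters the rate.

  The two blocks are treated once: one-block facts are proved for \<open>x\<close> and read for
  \<open>y\<close> in the problem with payoff \<open>- f\<close> and exchanged roles. Both oracles
  likewise share one argument in which the sets \<open>A\<close>, \<open>B\<close> of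
  differentiability stay open.\<close>

lemma mem_Rn: "v \<in> Rn d \<longleftrightarrow> (\<forall>i\<ge>d. v i = 0)"
  by (simp add: topspace_Euclidean_space)

lemma enorm_nonneg [simp]: "0 \<le> enorm d v"
  by (simp add: enorm_def)

lemma enorm_zero [simp]: "enorm d (\<lambda>i. 0) = 0"
  by (simp add: enorm_def L2_set_def)

lemma enorm_diff_self [simp]: "enorm d (a - a) = 0"
  by (simp add: enorm_def L2_set_def)

lemma enorm_sq: "(enorm d v)\<^sup>2 = (\<Sum>i<d. (v i)\<^sup>2)"
  by (simp add: enorm_def L2_set_def sum_nonneg)

lemma enorm_sq_einner: "(enorm d v)\<^sup>2 = einner d v v"
  unfolding enorm_sq einner_def by (simp add: power2_eq_square)

lemma enorm_cong: "(\<And>i. i < d \<Longrightarrow> u i = v i) \<Longrightarrow> enorm d u = enorm d v"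
  by (simp add: enorm_def cong: L2_set_cong_simp)

lemma enorm_minus_commute: "enorm d (a - b) = enorm d (b - a)"
  by (simp add: enorm_def L2_set_def power2_commute)

lemma enorm_scale: "enorm d (\<lambda>i. c * v i) = \<bar>c\<bar> * enorm d v"
  by (simp add: enorm_def L2_set_def power_mult_distrib sum_distrib_left[symmetric] real_sqrt_mult)

lemma enorm_triangle: "enorm d (\<lambda>i. u i + v i) \<le> enorm d u + enorm d v"
  unfolding enorm_def by (rule L2_set_triangle_ineq)

lemma enorm_triangle_diff: "enorm d (a - c) \<le> enorm d (a - b) + enorm d (b - c)"
  using enorm_triangle[of d "a - b" "b - c"] by (simp add: fun_diff_def)

lemma component_le_enorm: "i < d \<Longrightarrow> \<bar>v i\<bar> \<le> enorm d v"
  using member_le_L2_set[of "{..<d}" i "\<lambda>i. \<bar>v i\<bar>"] by (simp add: enorm_def L2_set_def)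

lemma enorm_le_sum: "enorm d v \<le> (\<Sum>i<d. \<bar>v i\<bar>)"
  unfolding enorm_def by (rule L2_set_le_sum_abs)

text \<open>\<open>enorm d\<close> sees only the first \<open>d\<close> coordinates of a sequence;
  it is definite on \<open>Rn d\<close>, where all other coordinates vanish.\<close>

lemma enorm_pos: "a \<in> Rn d \<Longrightarrow> b \<in> Rn d \<Longrightarrow> a \<noteq> b \<Longrightarrow> 0 < enorm d (a - b)"
proof -
  assume a: "a \<in> Rn d" "b \<in> Rn d" "a \<noteq> b"
  then obtain i where i: "a i \<noteq> b i"
    by blast
  with a have "i < d"
    by (metis mem_Rn not_less)
  then show ?thesis
    using component_le_enorm[of i d "a - b"] i by simp
qed

lemma einner_commute: "einner d u v = einner d v u"
  by (simp add: einner_def mult.commute)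

lemma einner_diff_right: "einner d u (a - b) = einner d u a - einner d u b"
  by (simp add: einner_def right_diff_distrib sum_subtractf)

lemma einner_diff_left: "einner d (a - b) u = einner d a u - einner d b u"
  by (simp add: einner_def left_diff_distrib sum_subtractf)

lemma einner_minus_left: "einner d (- a) u = - einner d a u"
  by (simp add: einner_def sum_negf)

lemma einner_scale_right: "einner d u (\<lambda>i. c * v i) = c * einner d u v"
  by (simp add: einner_def sum_distrib_left mult.left_commute)

lemma einner_le_enorm: "\<bar>einner d u v\<bar> \<le> enorm d u * enorm d v"
proof -
  have "\<bar>einner d u v\<bar> \<le> (\<Sum>i<d. \<bar>u i\<bar> * \<bar>v i\<bar>)"
    unfolding einner_def by (rule order_trans[OF sum_abs]) (simp add: abs_mult)
  also have "\<dots> \<le> enorm d u * enorm d v"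
    unfolding enorm_def by (rule L2_set_mult_ineq)
  finally show ?thesis .
qed

lemma conv_comb_0 [simp]: "conv_comb 0 a b = a"
  by (simp add: conv_comb_def)

lemma conv_comb_1 [simp]: "conv_comb 1 a b = b"
  by (simp add: conv_comb_def)

lemma conv_comb_diff: "conv_comb l a b - conv_comb k a b = (\<lambda>i. (l - k) * (b - a) i)"
  by (auto simp: conv_comb_def fun_eq_iff algebra_simps)

lemma conv_comb_diff_left: "conv_comb l a b - a = (\<lambda>i. l * (b - a) i)"
  using conv_comb_diff[of l a b 0] by simp

lemma enorm_conv_comb_diff: "enorm d (conv_comb l a b - conv_comb k a b) = \<bar>l - k\<bar> * enorm d (b - a)"
  unfolding conv_comb_diff by (rule enorm_scale)

lemma conv_comb_mem: "convex_set S \<Longrightarrow> a \<in> S \<Longrightarrow> b \<in> S \<Longrightarrow> 0 \<le> l \<Longrightarrow> l \<le> 1 \<Longrightarrow> conv_comb l a b \<in> S"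
  by (auto simp: convex_set_def)

lemma convex_set_Rn: "convex_set (Rn d)"
  by (auto simp: convex_set_def mem_Rn conv_comb_def)

lemma continuous_on_conv_comb: "continuous_on S (\<lambda>l. conv_comb l a b)"
  unfolding conv_comb_def by (intro continuous_intros)


section \<open>Gradients along segments\<close>

lemma has_gradient_uminus:
  assumes "has_gradient d A h g x"
  shows "has_gradient d A (\<lambda>x. - h x) (- g) x"
proof -
  have "((\<lambda>x'. - ((h x' - h x - einner d g (x' - x)) / enorm d (x' - x))) \<longlongrightarrow> - 0) (at x within A)"
    using assms unfolding has_gradient_def by (intro tendsto_minus) auto
  moreover have "(\<lambda>x'. - ((h x' - h x - einner d g (x' - x)) / enorm d (x' - x))) =
      (\<lambda>x'. (- h x' - - h x - einner d (- g) (x' - x)) / enorm d (x' - x))"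
    by (rule ext) (simp add: einner_minus_left minus_divide_left)
  ultimately show ?thesis
    using assms by (auto simp: has_gradient_def mem_Rn)
qed

text \<open>Chain rule along a segment that stays in \<open>A\<close>, so a gradient relative to
  \<open>A\<close> suffices. With a closed interval for \<open>S\<close> the derivative at an
  endpoint is one-sided.\<close>

lemma has_gradient_derivative:
  assumes g: "has_gradient d A h g (conv_comb l a b)"
    and A: "\<And>k. k \<in> S \<Longrightarrow> conv_comb k a b \<in> A" and ARn: "A \<subseteq> Rn d" and ab: "a \<in> Rn d" "b \<in> Rn d"
  shows "((\<lambda>k. h (conv_comb k a b)) has_real_derivative einner d g (b - a)) (at l within S)"
\<comment> \<open>The limit is composed with the path, which must avoid its base point at nearby
  parameters; a degenerate segment never does.\<close>
proof (cases "a = b")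
  case True
  then have "conv_comb k a b = b" for k
    by (auto simp: conv_comb_def fun_eq_iff algebra_simps)
  then show ?thesis
    using True by (simp add: einner_def)
next
  case False
  define N where "N = enorm d (b - a)"
  have N: "0 < N"
    using False ab enorm_pos[of b d a] by (auto simp: N_def)
  let ?c = "\<lambda>k. conv_comb k a b"
  have inj: "?c k \<noteq> ?c l" if "k \<noteq> l" for k
    using enorm_conv_comb_diff[of d k a b l] N that by (auto simp: N_def)
  have tc: "filterlim ?c (at (?c l) within A) (at l within S)"
    unfolding filterlim_at
  proof
    have "continuous_on UNIV ?c"
      by (rule continuous_on_conv_comb)
    then show "(?c \<longlongrightarrow> ?c l) (at l within S)"
      by (metis UNIV_I continuous_on_def tendsto_within_subset subset_UNIV)
    show "\<forall>\<^sub>F k in at l within S. ?c k \<in> A \<and> ?c k \<noteq> ?c l"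
      using A inj by (auto simp: eventually_at_filter)
  qed
  have "((\<lambda>k. (h (?c k) - h (?c l) - einner d g (?c k - ?c l)) / enorm d (?c k - ?c l)) \<longlongrightarrow> 0) (at l within S)"
    using filterlim_compose[OF conjunct2[OF g[unfolded has_gradient_def]] tc] .
  \<comment> \<open>The defining quotient divides by a norm and so loses the sign of
    \<open>k - l\<close>; absolute values make it agree with the difference quotient.\<close>
  then have "((\<lambda>k. \<bar>(h (?c k) - h (?c l) - (k - l) * einner d g (b - a)) / (\<bar>k - l\<bar> * N)\<bar> * N) \<longlongrightarrow> \<bar>0\<bar> * N) (at l within S)"
    unfolding enorm_conv_comb_diff
    unfolding conv_comb_diff einner_scale_right N_def
    by (intro tendsto_intros)
  moreover have "\<bar>(h (?c k) - h (?c l) - (k - l) * einner d g (b - a)) / (\<bar>k - l\<bar> * N)\<bar> * N =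
      \<bar>(h (?c k) - h (?c l)) / (k - l) - einner d g (b - a)\<bar>" if "k \<noteq> l" for k
  proof -
    have "(h (?c k) - h (?c l)) / (k - l) - einner d g (b - a) =
        (h (?c k) - h (?c l) - (k - l) * einner d g (b - a)) / (k - l)"
      using that by (simp add: diff_divide_distrib)
    then show ?thesis
      using N by (simp add: abs_divide abs_mult)
  qed
  then have "\<forall>\<^sub>F k in at l within S.
      \<bar>(h (?c k) - h (?c l) - (k - l) * einner d g (b - a)) / (\<bar>k - l\<bar> * N)\<bar> * N =
      \<bar>(h (?c k) - h (?c l)) / (k - l) - einner d g (b - a)\<bar>"
    unfolding eventually_at_filter by (intro always_eventually) blast
  ultimately have "((\<lambda>k. \<bar>(h (?c k) - h (?c l)) / (k - l) - einner d g (b - a)\<bar>) \<longlongrightarrow> \<bar>0\<bar> * N) (at l within S)"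
    by (rule Lim_transform_eventually)
  then have "((\<lambda>k. \<bar>(h (?c k) - h (?c l)) / (k - l) - einner d g (b - a)\<bar>) \<longlongrightarrow> 0) (at l within S)"
    by simp
  then show ?thesis
    unfolding has_field_derivative_iff by (simp add: tendsto_rabs_zero_iff LIM_zero_iff)
qed

text \<open>\<open>\<phi>\<close> and \<open>- \<phi>\<close> are compared with the antiderivative
  \<open>c * k + e / 2 * k\<^sup>2\<close> of the bound. The case \<open>c = 0\<close> gives
  second-order remainders, the case \<open>e = 0\<close> first-order increments.\<close>

lemma abs_growth_le:
  fixes \<phi> \<phi>' :: "real \<Rightarrow> real"
  assumes d: "\<And>k. 0 \<le> k \<Longrightarrow> k \<le> 1 \<Longrightarrow> (\<phi> has_real_derivative \<phi>' k) (at k within {0..1})"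
    and b: "\<And>k. 0 \<le> k \<Longrightarrow> k \<le> 1 \<Longrightarrow> \<bar>\<phi>' k\<bar> \<le> c + e * k"
  shows "\<bar>\<phi> 1 - \<phi> 0\<bar> \<le> c + e / 2"
proof -
  have *: "s * (\<phi> 1 - \<phi> 0) \<le> c + e / 2" if s: "\<bar>s\<bar> = 1" for s
  proof -
    define \<psi> where "\<psi> k = s * \<phi> k - c * k - e / 2 * k\<^sup>2" for k
    have D: "(\<psi> has_real_derivative (s * \<phi>' k - c - e * k)) (at k within {0..1})" if "0 \<le> k" "k \<le> 1" for k
      unfolding \<psi>_def using d[OF that] by (auto intro!: derivative_eq_intros)
    have "\<psi> 1 \<le> \<psi> 0"
    proof (rule DERIV_nonpos_imp_decreasing_open[where f = \<psi>])
      fix k :: real assume k: "0 < k" "k < 1"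
      have "s * \<phi>' k \<le> \<bar>\<phi>' k\<bar>"
        by (metis abs_ge_self abs_mult mult_1 s)
      then have "s * \<phi>' k - c - e * k \<le> 0"
        using b[of k] k by simp
      moreover have "DERIV \<psi> k :> s * \<phi>' k - c - e * k"
        using D[of k] k by (simp add: at_within_Icc_at)
      ultimately show "\<exists>y. DERIV \<psi> k :> y \<and> y \<le> 0"
        by blast
    next
      show "continuous_on {0..1} \<psi>"
        using D by (intro DERIV_continuous_on) auto
    qed simp
    then show ?thesis
      by (simp add: \<psi>_def algebra_simps)
  qed
  show ?thesis
    using *[of 1] *[of "-1"] by (simp add: abs_le_iff)
qed

text \<open>Two-sided because it rests on the Lipschitz gradient alone: it serves the smoothness
  term of a Frank-Wolfe step as well as the remainder of Gaussian smoothing.\<close>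

lemma gradient_remainder:
  assumes A: "convex_set A" "A \<subseteq> Rn d" and h: "\<And>x. x \<in> A \<Longrightarrow> has_gradient d A h (g x) x"
    and L: "lipschitz_map_on d d L A g" and ab: "a \<in> A" "b \<in> A"
  shows "\<bar>h b - h a - einner d (g a) (b - a)\<bar> \<le> L / 2 * (enorm d (b - a))\<^sup>2"
proof -
  let ?c = "\<lambda>k. conv_comb k a b"
  have c: "?c k \<in> A" if "k \<in> {0..1}" for k
    using conv_comb_mem[OF A(1) ab] that by auto
  have "\<bar>(h (?c 1) - 1 * einner d (g a) (b - a)) - (h (?c 0) - 0 * einner d (g a) (b - a))\<bar> \<le>
      0 + L * (enorm d (b - a))\<^sup>2 / 2"
  proof (rule abs_growth_le)
    fix k :: real assume k: "0 \<le> k" "k \<le> 1"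
    have "((\<lambda>k. h (?c k)) has_real_derivative einner d (g (?c k)) (b - a)) (at k within {0..1})"
      using c k A ab by (intro has_gradient_derivative[OF h]) auto
    then show "((\<lambda>k. h (?c k) - k * einner d (g a) (b - a)) has_real_derivative
        einner d (g (?c k) - g a) (b - a)) (at k within {0..1})"
      unfolding einner_diff_left by (auto intro!: derivative_eq_intros)
    have "\<bar>einner d (g (?c k) - g a) (b - a)\<bar> \<le> enorm d (g (?c k) - g a) * enorm d (b - a)"
      by (rule einner_le_enorm)
    also have "\<dots> \<le> (L * enorm d (?c k - a)) * enorm d (b - a)"
      using L c[of k] ab k by (intro mult_right_mono) (auto simp: lipschitz_map_on_def)
    also have "\<dots> = 0 + (L * (enorm d (b - a))\<^sup>2) * k"
      using enorm_conv_comb_diff[of d k a b 0] k by (simp add: power2_eq_square)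
    finally show "\<bar>einner d (g (?c k) - g a) (b - a)\<bar> \<le> 0 + (L * (enorm d (b - a))\<^sup>2) * k" .
  qed
  then show ?thesis
    by (simp add: algebra_simps)
qed

text \<open>With the payoff at two different points of the other block as \<open>h\<close> and
  \<open>h'\<close>, the left side is a mixed second difference, and \<open>K\<close> comes from the
  cross-Lipschitz constant of the gradient.\<close>

lemma increment_diff_le:
  assumes A: "convex_set A" "A \<subseteq> Rn d"
    and h: "\<And>x. x \<in> A \<Longrightarrow> has_gradient d A h (g x) x" "\<And>x. x \<in> A \<Longrightarrow> has_gradient d A h' (g' x) x"
    and K: "\<And>x. x \<in> A \<Longrightarrow> enorm d (g x - g' x) \<le> K" and ab: "a \<in> A" "b \<in> A"
  shows "\<bar>(h b - h' b) - (h a - h' a)\<bar> \<le> K * enorm d (b - a)"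
proof -
  let ?c = "\<lambda>k. conv_comb k a b"
  have c: "?c k \<in> A" if "k \<in> {0..1}" for k
    using conv_comb_mem[OF A(1) ab] that by auto
  have "\<bar>(h (?c 1) - h' (?c 1)) - (h (?c 0) - h' (?c 0))\<bar> \<le> K * enorm d (b - a) + 0 / 2"
  proof (rule abs_growth_le)
    fix k :: real assume k: "0 \<le> k" "k \<le> 1"
    have "((\<lambda>k. h (?c k)) has_real_derivative einner d (g (?c k)) (b - a)) (at k within {0..1})"
      "((\<lambda>k. h' (?c k)) has_real_derivative einner d (g' (?c k)) (b - a)) (at k within {0..1})"
      using c k A ab by (intro has_gradient_derivative[OF h(1)] has_gradient_derivative[OF h(2)]; auto)+
    then show "((\<lambda>k. h (?c k) - h' (?c k)) has_real_derivative
        einner d (g (?c k) - g' (?c k)) (b - a)) (at k within {0..1})"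
      unfolding einner_diff_left by (auto intro!: derivative_eq_intros)
    have "\<bar>einner d (g (?c k) - g' (?c k)) (b - a)\<bar> \<le> enorm d (g (?c k) - g' (?c k)) * enorm d (b - a)"
      by (rule einner_le_enorm)
    also have "\<dots> \<le> K * enorm d (b - a)"
      using K c[of k] k by (intro mult_right_mono) auto
    finally show "\<bar>einner d (g (?c k) - g' (?c k)) (b - a)\<bar> \<le> K * enorm d (b - a) + 0 * k"
      by simp
  qed
  then show ?thesis
    by simp
qed

text \<open>The limit of the strong convexity inequality at the parameter \<open>k\<close>, divided
  by \<open>k\<close>, as \<open>k\<close> tends to 0 from the right.\<close>

lemma strongly_convex_tangent:
  assumes sc: "strongly_convex_on d \<mu> S h" and S: "convex_set S" "S \<subseteq> Rn d"
    and g: "has_gradient d S h g a" and ab: "a \<in> S" "b \<in> S"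
  shows "h a + einner d g (b - a) + \<mu> / 2 * (enorm d (a - b))\<^sup>2 \<le> h b"
proof -
  let ?c = "\<lambda>k. conv_comb k a b" and ?N = "(enorm d (a - b))\<^sup>2"
  have "((\<lambda>k. h (?c k)) has_real_derivative einner d g (b - a)) (at 0 within {0..1})"
    using g S ab conv_comb_mem[OF S(1) ab] by (intro has_gradient_derivative[where A = S]) auto
  then have 1: "((\<lambda>k. (h (?c k) - h a) / k) \<longlongrightarrow> einner d g (b - a)) (at_right 0)"
    by (simp add: has_field_derivative_iff at_within_Icc_at_right)
  have 2: "((\<lambda>k. h b - h a - \<mu> / 2 * (1 - k) * ?N) \<longlongrightarrow> h b - h a - \<mu> / 2 * (1 - 0) * ?N) (at_right 0)"
    by (intro tendsto_intros)
  have "\<forall>\<^sub>F k in at_right 0. (h (?c k) - h a) / k \<le> h b - h a - \<mu> / 2 * (1 - k) * ?N"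
    using eventually_at_right_less[of 0] eventually_at_right_real[of 0 1, simplified]
  proof eventually_elim
    case (elim k)
    then have "h (?c k) \<le> (1 - k) * h a + k * h b - \<mu> / 2 * k * (1 - k) * ?N"
      using sc ab by (auto simp: strongly_convex_on_def)
    then have "h (?c k) - h a \<le> (h b - h a - \<mu> / 2 * (1 - k) * ?N) * k"
      by (simp add: algebra_simps)
    then show ?case
      using elim by (simp add: divide_le_eq)
  qed
  from tendsto_le[OF _ 2 1 this] show ?thesis
    by simp
qed

text \<open>The same limit with minimality in place of a tangent. It covers minimizers on the border
  of \<open>S\<close>, where best responses may lie.\<close>

lemma strongly_convex_minimizer:
  assumes sc: "strongly_convex_on d \<mu> S h" and S: "convex_set S"
    and ab: "a \<in> S" "b \<in> S" and min: "\<And>x. x \<in> S \<Longrightarrow> h a \<le> h x"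
  shows "h a + \<mu> / 2 * (enorm d (a - b))\<^sup>2 \<le> h b"
proof -
  let ?N = "(enorm d (a - b))\<^sup>2"
  have 2: "((\<lambda>k. h b - h a - \<mu> / 2 * (1 - k) * ?N) \<longlongrightarrow> h b - h a - \<mu> / 2 * (1 - 0) * ?N) (at_right 0)"
    by (intro tendsto_intros)
  have "\<forall>\<^sub>F k in at_right 0. 0 \<le> h b - h a - \<mu> / 2 * (1 - k) * ?N"
    using eventually_at_right_less[of 0] eventually_at_right_real[of 0 1, simplified]
  proof eventually_elim
    case (elim k)
    then have "h a \<le> (1 - k) * h a + k * h b - \<mu> / 2 * k * (1 - k) * ?N"
      using sc ab min[OF conv_comb_mem[OF S ab, of k]]
      unfolding strongly_convex_on_def by (smt (verit) atLeastAtMost_iff)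
    then have "0 \<le> (h b - h a - \<mu> / 2 * (1 - k) * ?N) * k"
      by (simp add: algebra_simps)
    then show ?case
      using elim by (simp add: zero_le_mult_iff)
  qed
  from tendsto_lowerbound[OF 2 this] show ?thesis
    by simp
qed


section \<open>Distance to the border\<close>

lemma compactin_Euclidean_closedin:
  "compactin (Euclidean_space d) S \<Longrightarrow> closedin (Euclidean_space d) S"
  by (rule compactin_imp_closedin[OF Hausdorff_Euclidean_space])

lemma connectedin_segment:
  assumes "a \<in> Rn d" "b \<in> Rn d"
  shows "connectedin (Euclidean_space d) ((\<lambda>l. conv_comb l a b) ` {0..1})"
proof (rule connectedin_continuous_map_image)
  show "continuous_map euclideanreal (Euclidean_space d) (\<lambda>l. conv_comb l a b)"
    unfolding Euclidean_space_def continuous_map_in_subtopology euclidean_product_topology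
    using assms continuous_on_conv_comb[of UNIV a b] by (auto simp: mem_Rn conv_comb_def)
qed simp

text \<open>The segment from \<open>z\<close> to \<open>q\<close> meets the frontier by
  connectedness. As \<open>S\<close> is closed, the meeting point lies in \<open>S\<close>, so it
  differs from \<open>q\<close> and is strictly closer to \<open>z\<close>.\<close>

lemma frontier_closer_than_outside:
  assumes S: "compactin (Euclidean_space d) S" and z: "z \<in> S" and q: "q \<in> Rn d" "q \<notin> S"
  shows "\<exists>s\<in>Euclidean_space d frontier_of S. enorm d (z - s) < enorm d (z - q)"
proof -
  let ?c = "\<lambda>l. conv_comb l z q"
  have SR: "S \<subseteq> Rn d"
    using S by (rule compactin_subset_topspace)
  have "?c 0 \<in> ?c ` {0..1}" "?c 1 \<in> ?c ` {0..1}"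
    by (auto simp del: conv_comb_0 conv_comb_1)
  then have "?c ` {0..1} \<inter> Euclidean_space d frontier_of S \<noteq> {}"
    using z q SR by (intro connectedin_Int_frontier_of connectedin_segment) auto
  then obtain l where l: "0 \<le> l" "l \<le> 1" "?c l \<in> Euclidean_space d frontier_of S"
    by auto
  then have "?c l \<in> S"
    using frontier_of_subset_closedin[OF compactin_Euclidean_closedin[OF S]] by auto
  then have "l < 1"
    using l(2) q(2) by (cases "l = 1") auto
  moreover have "0 < enorm d (z - q)"
    using z q SR by (intro enorm_pos) auto
  moreover have "enorm d (z - ?c l) = l * enorm d (z - q)"
    using enorm_conv_comb_diff[of d l z q 0] l by (simp add: enorm_minus_commute)
  ultimately have "enorm d (z - ?c l) < enorm d (z - q)"
    by simp
  with l(3) show ?thesis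
    by blast
qed

lemma border_distance_le:
  assumes "t \<in> {1..T}" "s \<in> Euclidean_space d frontier_of S"
  shows "border_distance d S T zs \<le> enorm d (zs t - s)"
proof -
  have "border_distance d S T zs \<le> (INF s\<in>Euclidean_space d frontier_of S. enorm d (zs t - s))"
    unfolding border_distance_def using assms by (intro cINF_lower bdd_below_finite) auto
  also have "\<dots> \<le> enorm d (zs t - s)"
    using assms by (intro cINF_lower bdd_belowI[where m = 0]) auto
  finally show ?thesis .
qed

text \<open>The strict inequality of \<open>frontier_closer_than_outside\<close> makes the closed
  ball fit into \<open>S\<close>, so the full border distance occurring in \<open>sp_C0\<close> is
  available later.\<close>

lemma border_distance_ball:
  assumes "compactin (Euclidean_space d) S" "t \<in> {1..T}" "zs t \<in> S" "q \<in> Rn d"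
    and "enorm d (zs t - q) \<le> border_distance d S T zs"
  shows "q \<in> S"
proof (rule ccontr)
  assume "q \<notin> S"
  then obtain s where "s \<in> Euclidean_space d frontier_of S" "enorm d (zs t - s) < enorm d (zs t - q)"
    using frontier_closer_than_outside[OF assms(1,3,4)] by blast
  then show False
    using border_distance_le[OF assms(2), of s d S zs] assms(5) by simp
qed

lemma openin_Euclidean_space_open:
  assumes "openin (Euclidean_space d) I"
  shows "\<exists>U. open U \<and> I = Rn d \<inter> U"
proof -
  have "openin (top_of_set {x. \<forall>i\<ge>d. x i = 0}) I"
    using assms by (simp add: Euclidean_space_def euclidean_product_topology)
  then show ?thesis
    by (simp add: openin_open topspace_Euclidean_space)
qed

text \<open>\<open>vec\<close> carries the product topology, which is not given by
  \<open>enorm\<close>. Points of \<open>Rn d\<close> ever closer to \<open>z\<close> in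
  \<open>enorm d\<close> converge to it in every coordinate, those from \<open>d\<close> on being
  constantly 0.\<close>

lemma interior_contains_ball:
  assumes z: "z \<in> Euclidean_space d interior_of S"
  shows "\<exists>r>0. \<forall>q\<in>Rn d. enorm d (z - q) < r \<longrightarrow> q \<in> Euclidean_space d interior_of S"
proof (rule ccontr)
  let ?I = "Euclidean_space d interior_of S"
  assume "\<not> ?thesis"
  then have "\<exists>q\<in>Rn d. enorm d (z - q) < 1 / real (Suc n) \<and> q \<notin> ?I" for n
    by (meson of_nat_0_less_iff zero_less_Suc zero_less_divide_1_iff)
  then obtain q where q: "q n \<in> Rn d" "enorm d (z - q n) < 1 / real (Suc n)" "q n \<notin> ?I" for n
    by metis
  have zR: "z \<in> Rn d"
    using z interior_of_subset_topspace[of "Euclidean_space d" S] by blast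
  obtain U where U: "open U" "?I = Rn d \<inter> U"
    using openin_Euclidean_space_open[OF openin_interior_of] by blast
  have "(\<lambda>n. q n i) \<longlonglongrightarrow> z i" for i
  proof (cases "i < d")
    case True
    have "\<bar>z i - q n i\<bar> \<le> 1 / real (Suc n)" for n
      using component_le_enorm[OF True, of "z - q n"] q(2)[of n] by simp
    then have "(\<lambda>n. z i - q n i) \<longlonglongrightarrow> 0"
      by (intro Lim_null_comparison[OF _ LIMSEQ_inverse_real_of_nat]) (simp add: inverse_eq_divide)
    from tendsto_diff[OF tendsto_const[of "z i"] this] show ?thesis
      by simp
  next
    case False
    then show ?thesis
      using q(1) zR by (simp add: mem_Rn)
  qed
  then have "limitin (product_topology (\<lambda>_. euclideanreal) UNIV) q z sequentially"
    by (simp add: limitin_componentwise)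
  then have "q \<longlonglongrightarrow> z"
    by (simp add: euclidean_product_topology)
  moreover have "z \<in> U"
    using z U by auto
  ultimately have "\<forall>\<^sub>F n in sequentially. q n \<in> U"
    using U(1) topological_tendstoD by blast
  then show False
    using q U by (auto dest: eventually_happens)
qed

text \<open>There are finitely many rounds, so the infimum over them is a minimum of positive
  numbers.\<close>

lemma border_distance_pos:
  assumes d: "1 \<le> d" and S: "compactin (Euclidean_space d) S" and T: "1 \<le> T"
    and D: "\<And>a b. a \<in> S \<Longrightarrow> b \<in> S \<Longrightarrow> enorm d (a - b) \<le> D"
    and z: "\<And>t. t \<in> {1..T} \<Longrightarrow> zs t \<in> Euclidean_space d interior_of S"
  shows "0 < border_distance d S T zs"
proof -
  let ?F = "Euclidean_space d frontier_of S"
  have "0 < (INF s\<in>?F. enorm d (zs t - s))" if t: "t \<in> {1..T}" for t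
  proof -
    obtain r where r: "0 < r" "\<And>q. q \<in> Rn d \<Longrightarrow> enorm d (zs t - q) < r \<Longrightarrow> q \<in> Euclidean_space d interior_of S"
      using interior_contains_ball[OF z[OF t]] by blast
    have zS: "zs t \<in> S"
      using z[OF t] interior_of_subset[of _ S] by auto
    then have zR: "zs t \<in> Rn d"
      using compactin_subset_topspace[OF S] by auto
    have D0: "0 \<le> D"
      using D[OF zS zS] by simp
    \<comment> \<open>Shifting one coordinate beyond the diameter leaves \<open>S\<close>. So the
      frontier is nonempty, without which the infimum over it would say nothing.\<close>
    define q where "q = (\<lambda>i. if i = 0 then zs t 0 + (D + 1) else zs t i)"
    have q: "q \<in> Rn d"
      using zR d by (auto simp: q_def mem_Rn)
    have "D + 1 \<le> enorm d (q - zs t)"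
      using component_le_enorm[of 0 d "q - zs t"] d D0 by (simp add: q_def)
    then have "q \<notin> S"
      using D[of q "zs t"] zS by auto
    then have ne: "?F \<noteq> {}"
      using frontier_closer_than_outside[OF S zS q] by auto
    \<comment> \<open>The ball lies in the interior, not merely in \<open>S\<close>, and the
      frontier excludes the interior.\<close>
    have "r \<le> enorm d (zs t - s)" if "s \<in> ?F" for s
      using r(2)[of s] that by (force simp: frontier_of_def in_closure_of)
    then have "r \<le> (INF s\<in>?F. enorm d (zs t - s))"
      using ne by (intro cINF_greatest) auto
    with r(1) show ?thesis
      by simp
  qed
  then show ?thesis
    unfolding border_distance_def using T by (subst cInf_eq_Min) auto
qed

section \<open>One Frank-Wolfe step decreases the duality gap\<close>

lemma compactin_Euclidean_compact: "compactin (Euclidean_space d) S \<Longrightarrow> compact S"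
  by (simp add: Euclidean_space_def compactin_subtopology euclidean_product_topology)

lemma uminus_diff_uminus_vec: "- a - - b = b - (a :: vec)"
  by (rule ext) simp

lemma enorm_uminus [simp]: "enorm d (- v) = enorm d v"
  by (simp add: enorm_def L2_set_def)

text \<open>In the product topology continuity is controlled by coordinates, so the norm is passed
  on to a sum over them. The absolute value of \<open>c\<close> appears because its sign is not
  known here.\<close>

lemma lipschitz_fun_continuous:
  assumes "lipschitz_fun_on d c S h"
  shows "continuous_on S h"
  unfolding continuous_on_def
proof
  fix x assume x: "x \<in> S"
  have c: "((\<lambda>y. y i) \<longlongrightarrow> x i) (at x within S)" for i
    using continuous_on_product_coordinates[of i] unfolding continuous_on_def
    by (metis UNIV_I tendsto_within_subset top_greatest)
  have "((\<lambda>y. \<bar>c\<bar> * (\<Sum>i<d. \<bar>y i - x i\<bar>)) \<longlongrightarrow> \<bar>c\<bar> * (\<Sum>i<d. \<bar>x i - x i\<bar>)) (at x within S)"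
    by (intro tendsto_intros c)
  then have lim: "((\<lambda>y. \<bar>c\<bar> * (\<Sum>i<d. \<bar>y i - x i\<bar>)) \<longlongrightarrow> 0) (at x within S)"
    by simp
  have "\<bar>h y - h x\<bar> \<le> \<bar>c\<bar> * (\<Sum>i<d. \<bar>y i - x i\<bar>)" if "y \<in> S" for y
  proof -
    have "\<bar>h y - h x\<bar> \<le> c * enorm d (y - x)"
      using assms x that by (auto simp: lipschitz_fun_on_def)
    also have "\<dots> \<le> \<bar>c\<bar> * enorm d (y - x)"
      by (intro mult_right_mono) auto
    also have "\<dots> \<le> \<bar>c\<bar> * (\<Sum>i<d. \<bar>y i - x i\<bar>)"
      using enorm_le_sum[of d "y - x"] by (intro mult_left_mono) auto
    finally show ?thesis .
  qed
  then have "\<forall>\<^sub>F y in at x within S. norm (h y - h x) \<le> \<bar>c\<bar> * (\<Sum>i<d. \<bar>y i - x i\<bar>)"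
    by (auto simp: eventually_at_filter)
  from Lim_null_comparison[OF this lim] show "(h \<longlongrightarrow> h x) (at x within S)"
    by (rule LIM_zero_cancel)
qed

text \<open>The second term is a \<open>SUP\<close> of \<open>- f\<close> rather than minus an
  \<open>INF\<close>, so that it is literally the first term for the problem with payoff
  \<open>- f\<close> and exchanged blocks.\<close>

definition duality_gap :: "vec set \<Rightarrow> vec set \<Rightarrow> (vec \<Rightarrow> vec \<Rightarrow> real) \<Rightarrow> vec \<Rightarrow> vec \<Rightarrow> real" where
  "duality_gap X Y f x y = (SUP y'\<in>Y. f x y') + (SUP x'\<in>X. - f x' y)"

text \<open>One round after the noise is integrated out: mean payoff \<open>f\<close> with mean
  gradients \<open>gx\<close>, \<open>gy\<close>. The parameters come in pairs so that exchanging
  the blocks gives an instance again.\<close>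

locale saddle_problem =
  fixes dX dY :: nat and X Y :: "vec set" and f :: "vec \<Rightarrow> vec \<Rightarrow> real"
    and gx gy :: "vec \<Rightarrow> vec \<Rightarrow> vec" and muX muY LX LY LGX LGY LXY LYX DX DY :: real
  assumes compact_X: "compactin (Euclidean_space dX) X" and compact_Y: "compactin (Euclidean_space dY) Y"
    and convex_X: "convex_set X" and convex_Y: "convex_set Y"
    and nonempty_X: "X \<noteq> {}" and nonempty_Y: "Y \<noteq> {}"
    and diam_X: "\<And>a b. a \<in> X \<Longrightarrow> b \<in> X \<Longrightarrow> enorm dX (a - b) \<le> DX"
    and diam_Y: "\<And>a b. a \<in> Y \<Longrightarrow> b \<in> Y \<Longrightarrow> enorm dY (a - b) \<le> DY"
    and muX: "0 < muX" and muY: "0 < muY"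
    and nonneg: "0 \<le> LGX" "0 \<le> LGY" "0 \<le> LXY" "0 \<le> LYX"
    and sconvex_x: "\<And>y. y \<in> Y \<Longrightarrow> strongly_convex_on dX muX X (\<lambda>x. f x y)"
    and sconvex_y: "\<And>x. x \<in> X \<Longrightarrow> strongly_convex_on dY muY Y (\<lambda>y. - f x y)"
    and lipschitz_x: "\<And>y. y \<in> Y \<Longrightarrow> lipschitz_fun_on dX LX X (\<lambda>x. f x y)"
    and lipschitz_y: "\<And>x. x \<in> X \<Longrightarrow> lipschitz_fun_on dY LY Y (\<lambda>y. f x y)"
    and grad_x: "\<And>x y. x \<in> X \<Longrightarrow> y \<in> Y \<Longrightarrow> has_gradient dX X (\<lambda>x. f x y) (gx x y) x"
    and grad_y: "\<And>x y. x \<in> X \<Longrightarrow> y \<in> Y \<Longrightarrow> has_gradient dY Y (\<lambda>y. f x y) (gy x y) y"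
    and lipschitz_gx: "\<And>y. y \<in> Y \<Longrightarrow> lipschitz_map_on dX dX LGX X (\<lambda>x. gx x y)"
    and lipschitz_gy: "\<And>x. x \<in> X \<Longrightarrow> lipschitz_map_on dY dY LGY Y (\<lambda>y. gy x y)"
    and lipschitz_gxy: "\<And>x. x \<in> X \<Longrightarrow> lipschitz_map_on dY dX LXY Y (\<lambda>y. gx x y)"
    and lipschitz_gyx: "\<And>y. y \<in> Y \<Longrightarrow> lipschitz_map_on dX dY LYX X (\<lambda>x. gy x y)"
begin

text \<open>Maximizing \<open>f\<close> over \<open>y\<close> is minimizing \<open>- f\<close>.
  Interpreting the locale with this instance yields for one block what was proved for the
  other.\<close>

lemma swapped:
  "saddle_problem dY dX Y X (\<lambda>y x. - f x y) (\<lambda>y x. - gy x y) (\<lambda>y x. - gx x y)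
     muY muX LY LX LGY LGX LYX LXY DY DX"
proof -
  have neg_fun: "lipschitz_fun_on d c S (\<lambda>z. - h z)" if "lipschitz_fun_on d c S h" for d c S h
    using that by (auto simp: lipschitz_fun_on_def abs_minus_commute)
  have neg_map: "lipschitz_map_on d e c S (\<lambda>z. - h z)" if "lipschitz_map_on d e c S h" for d e c S h
    using that unfolding lipschitz_map_on_def uminus_diff_uminus_vec by (metis enorm_minus_commute)
  show ?thesis
    using compact_X compact_Y convex_X convex_Y nonempty_X nonempty_Y diam_X diam_Y muX muY nonneg
      sconvex_x sconvex_y lipschitz_x lipschitz_y grad_x grad_y lipschitz_gx lipschitz_gy
      lipschitz_gxy lipschitz_gyx
    by unfold_locales (auto intro: neg_fun neg_map has_gradient_uminus)
qed

lemma X_subset: "X \<subseteq> Rn dX"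
  using compact_X by (rule compactin_subset_topspace)

lemma Y_subset: "Y \<subseteq> Rn dY"
  using compact_Y by (rule compactin_subset_topspace)

lemma DX_nonneg: "0 \<le> DX"
  using nonempty_X diam_X by (metis all_not_in_conv enorm_nonneg order_trans)

section \<open>Best responses and the descent of one block\<close>

lemma best_response:
  assumes "x \<in> X"
  obtains yh where "yh \<in> Y" "\<And>y. y \<in> Y \<Longrightarrow> f x y \<le> f x yh" "(SUP y\<in>Y. f x y) = f x yh"
proof -
  obtain yh where yh: "yh \<in> Y" "\<And>y. y \<in> Y \<Longrightarrow> f x y \<le> f x yh"
    using continuous_attains_sup[OF compactin_Euclidean_compact[OF compact_Y] nonempty_Y
        lipschitz_fun_continuous[OF lipschitz_y[OF assms]]] by blast
  moreover have "(SUP y\<in>Y. f x y) = f x yh"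
    using yh by (intro cSup_eq_maximum) auto
  ultimately show thesis
    using that by blast
qed

lemma le_SUP: "x \<in> X \<Longrightarrow> y \<in> Y \<Longrightarrow> f x y \<le> (SUP y\<in>Y. f x y)"
  by (metis best_response)

lemma best_response_dist:
  assumes "x \<in> X" "y \<in> Y" "yh \<in> Y" and max: "\<And>y. y \<in> Y \<Longrightarrow> f x y \<le> f x yh"
  shows "muY / 2 * (enorm dY (yh - y))\<^sup>2 \<le> f x yh - f x y"
  using strongly_convex_minimizer[OF sconvex_y[OF assms(1)] convex_Y assms(3,2)] max by fastforce

text \<open>Quadratic growth at both best responses is added up. The four values combine to a mixed
  second difference, which \<open>increment_diff_le\<close> bounds by the cross-Lipschitz constant
  times both displacements.\<close>

lemma best_response_lipschitz:
  assumes x: "x \<in> X" "x' \<in> X" and y: "yh \<in> Y" "yh' \<in> Y"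
    and max: "\<And>y. y \<in> Y \<Longrightarrow> f x y \<le> f x yh" "\<And>y. y \<in> Y \<Longrightarrow> f x' y \<le> f x' yh'"
  shows "muY * enorm dY (yh' - yh) \<le> LYX * enorm dX (x' - x)"
proof -
  let ?N = "enorm dY (yh' - yh)"
  have "muY * ?N\<^sup>2 \<le> (f x' yh' - f x yh') - (f x' yh - f x yh)"
    using best_response_dist[OF x(1) y(2,1) max(1)] best_response_dist[OF x(2) y max(2)]
    by (simp add: enorm_minus_commute[of dY yh])
  also have "\<dots> \<le> (LYX * enorm dX (x' - x)) * ?N"
    using lipschitz_gyx x y
    by (intro order_trans[OF abs_ge_self
          increment_diff_le[OF convex_Y Y_subset, where g = "\<lambda>y. gy x' y" and g' = "\<lambda>y. gy x y"]] grad_y)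
       (auto simp: lipschitz_map_on_def)
  finally have "(muY * ?N) * ?N \<le> (LYX * enorm dX (x' - x)) * ?N"
    by (simp add: power2_eq_square mult.assoc)
  then show ?thesis
    using nonneg by (cases "?N = 0") (auto simp: less_le)
qed

text \<open>The new maximum is attained at some \<open>yh'\<close>, and along \<open>f _ yh'\<close>
  the step is a smooth descent step, starting from at most the old maximum. Its slope is the
  gradient at \<open>yh'\<close>, to be replaced by the one at \<open>y\<close>. The distance of
  \<open>yh'\<close> and \<open>y\<close> is split at the old best response \<open>yh\<close>:
  \<open>yh' - yh\<close> is of order \<gamma> and goes into the quadratic term, while
  \<open>yh - y\<close> is bounded by the root of the gap in \<open>y\<close>, which gives the
  coupling term.\<close>

lemma primal_descent:
  assumes x: "x \<in> X" "s \<in> X" and y: "y \<in> Y" and \<gamma>: "0 \<le> \<gamma>" "\<gamma> \<le> 1"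
  shows "(SUP y'\<in>Y. f (conv_comb \<gamma> x s) y') \<le> (SUP y'\<in>Y. f x y') + \<gamma> * einner dX (gx x y) (s - x)
     + \<gamma> * (DX * LXY * sqrt (2 * ((SUP y'\<in>Y. f x y') - f x y) / muY))
     + \<gamma>\<^sup>2 * ((LGX / 2 + LXY * LYX / muY) * DX\<^sup>2)"
proof -
  let ?x = "conv_comb \<gamma> x s"
  let ?r = "sqrt (2 * ((SUP y'\<in>Y. f x y') - f x y) / muY)"
  have x': "?x \<in> X"
    using conv_comb_mem[OF convex_X x \<gamma>] .
  obtain yh where yh: "yh \<in> Y" "\<And>y. y \<in> Y \<Longrightarrow> f x y \<le> f x yh" "(SUP y\<in>Y. f x y) = f x yh"
    using best_response[OF x(1)] by blast
  obtain yh' where yh': "yh' \<in> Y" "\<And>y. y \<in> Y \<Longrightarrow> f ?x y \<le> f ?x yh'" "(SUP y\<in>Y. f ?x y) = f ?x yh'"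
    using best_response[OF x'] by blast
  have dx: "?x - x = (\<lambda>i. \<gamma> * (s - x) i)"
    by (rule conv_comb_diff_left)
  have ndx: "enorm dX (?x - x) \<le> \<gamma> * DX"
    unfolding dx enorm_scale using \<gamma> mult_left_mono[OF diam_X[OF x(2,1)] \<gamma>(1)] by (simp only: abs_of_nonneg)
  have "enorm dY (yh - y) \<le> ?r"
    using best_response_dist[OF x(1) y yh(1,2)] muY yh(3)
    by (intro real_le_rsqrt) (simp add: field_simps)
  moreover have "enorm dY (yh' - yh) \<le> LYX * (\<gamma> * DX) / muY"
  proof -
    have "muY * enorm dY (yh' - yh) \<le> LYX * (\<gamma> * DX)"
      using best_response_lipschitz[OF x(1) x' yh(1) yh'(1) yh(2) yh'(2)] mult_left_mono[OF ndx nonneg(4)]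
      by linarith
    then show ?thesis
      using muY by (simp add: field_simps)
  qed
  ultimately have ny: "enorm dY (yh' - y) \<le> LYX * (\<gamma> * DX) / muY + ?r"
    using enorm_triangle_diff[of dY yh' y yh] by linarith
  have "\<bar>einner dX (gx x yh' - gx x y) (s - x)\<bar> \<le> enorm dX (gx x yh' - gx x y) * enorm dX (s - x)"
    by (rule einner_le_enorm)
  also have "\<dots> \<le> (LXY * enorm dY (yh' - y)) * DX"
    using lipschitz_gxy[OF x(1)] yh'(1) y diam_X[OF x(2,1)] nonneg(3)
    by (intro mult_mono) (auto simp: lipschitz_map_on_def)
  also have "\<dots> \<le> (LXY * (LYX * (\<gamma> * DX) / muY + ?r)) * DX"
    by (intro mult_right_mono mult_left_mono ny nonneg DX_nonneg)
  finally have cross: "einner dX (gx x yh') (s - x) \<le> einner dX (gx x y) (s - x)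
      + (LXY * (LYX * (\<gamma> * DX) / muY + ?r)) * DX"
    unfolding einner_diff_left by linarith
  have "f ?x yh' \<le> f x yh' + einner dX (gx x yh') (?x - x) + LGX / 2 * (enorm dX (?x - x))\<^sup>2"
    using gradient_remainder[OF convex_X X_subset grad_x[OF _ yh'(1)] lipschitz_gx[OF yh'(1)] x(1) x']
    by linarith
  also have "\<dots> \<le> f x yh + \<gamma> * (einner dX (gx x y) (s - x) + (LXY * (LYX * (\<gamma> * DX) / muY + ?r)) * DX)
      + LGX / 2 * (\<gamma> * DX)\<^sup>2"
  proof (intro add_mono mult_left_mono power_mono ndx)
    show "einner dX (gx x yh') (?x - x) \<le>
        \<gamma> * (einner dX (gx x y) (s - x) + (LXY * (LYX * (\<gamma> * DX) / muY + ?r)) * DX)"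
      unfolding dx einner_scale_right by (intro mult_left_mono cross \<gamma>)
  qed (use yh yh' nonneg in auto)
  finally show ?thesis
    unfolding yh'(3) yh(3) by (simp add: algebra_simps power2_eq_square)
qed

text \<open>Polyak-Lojasiewicz inequality: the strongly convex tangent bound is a concave quadratic
  in the distance \<open>?N\<close>, with maximum at \<open>?N = ?g / muX\<close>.\<close>

lemma gradient_dominance:
  assumes x: "x \<in> X" "x' \<in> X" and y: "y \<in> Y"
  shows "f x y - f x' y \<le> (enorm dX (gx x y))\<^sup>2 / (2 * muX)"
proof -
  let ?g = "enorm dX (gx x y)" and ?N = "enorm dX (x' - x)"
  have "f x y - f x' y \<le> - einner dX (gx x y) (x' - x) - muX / 2 * ?N\<^sup>2"
    using strongly_convex_tangent[OF sconvex_x[OF y] convex_X X_subset grad_x[OF x(1) y] x]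
    by (simp add: enorm_minus_commute)
  also have "\<dots> \<le> ?g * ?N - muX / 2 * ?N\<^sup>2"
    using einner_le_enorm[of dX "gx x y" "x' - x"] by linarith
  also have "\<dots> \<le> ?g\<^sup>2 / (2 * muX)"
  proof -
    have "0 \<le> (?g - muX * ?N)\<^sup>2 / (2 * muX)"
      using muX by simp
    also have "\<dots> = ?g\<^sup>2 / (2 * muX) - (?g * ?N - muX / 2 * ?N\<^sup>2)"
      using muX by (simp add: field_simps power2_eq_square)
    finally show ?thesis
      by simp
  qed
  finally show ?thesis .
qed

text \<open>Optimality of \<open>s\<close> for the estimate \<open>G\<close> is transferred to the
  gradient \<open>g\<close>. The difference \<open>G - g\<close> is tested against
  \<open>s - s'\<close> only, whence the diameter.\<close>

lemma linear_minimization: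
  assumes x: "s \<in> X" "s' \<in> X" and min: "\<And>a. a \<in> X \<Longrightarrow> einner dX s G \<le> einner dX a G"
  shows "einner dX g (s - x) \<le> einner dX g (s' - x) + DX * enorm dX (G - g)"
proof -
  have "einner dX g (s - s') = einner dX (g - G) (s - s') + (einner dX s G - einner dX s' G)"
    by (simp add: einner_diff_left einner_diff_right einner_commute)
  also have "\<dots> \<le> enorm dX (g - G) * enorm dX (s - s') + 0"
    using einner_le_enorm[of dX "g - G" "s - s'"] min[OF x(2)] by linarith
  also have "\<dots> \<le> DX * enorm dX (G - g)"
    using mult_left_mono[OF diam_X[OF x], of "enorm dX (g - G)"]
    by (simp add: enorm_minus_commute[of dX G] mult.commute)
  finally show ?thesis
    by (simp add: einner_diff_right)
qed

text \<open>By \<open>linear_minimization\<close>, \<open>a\<close> dominates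
  \<open>- einner dX (gx x y) (s' - x)\<close> for every \<open>s'\<close> in \<open>X\<close>. The
  minimizer of \<open>f _ y\<close> as \<open>s'\<close> gives the first bound, a point at distance
  \<open>\<delta>\<close> from \<open>xs\<close> the second.\<close>

lemma gap_lower_bounds:
  assumes x: "x \<in> X" and y: "y \<in> Y" and s: "s \<in> X"
    and min: "\<And>a. a \<in> X \<Longrightarrow> einner dX s G \<le> einner dX a G"
    and xs: "xs \<in> X" "\<And>q. q \<in> Rn dX \<Longrightarrow> enorm dX (xs - q) \<le> \<delta> \<Longrightarrow> q \<in> X" and \<delta>: "0 \<le> \<delta>"
  defines "a \<equiv> DX * enorm dX (G - gx x y) - einner dX (gx x y) (s - x)"
  shows "(SUP x'\<in>X. - f x' y) + f x y \<le> a"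
    and "\<delta> * enorm dX (gx x y) + (f x y - f xs y) \<le> a"
proof -
  interpret swap: saddle_problem dY dX Y X "\<lambda>y x. - f x y" "\<lambda>y x. - gy x y" "\<lambda>y x. - gx x y"
    muY muX LY LX LGY LGX LYX LXY DY DX
    by (rule swapped)
  have tangent: "f x y - f x' y \<le> - einner dX (gx x y) (x' - x)" if "x' \<in> X" for x'
  proof -
    have "0 \<le> muX / 2 * (enorm dX (x - x'))\<^sup>2"
      using muX by simp
    then show ?thesis
      using strongly_convex_tangent[OF sconvex_x[OF y] convex_X X_subset grad_x[OF x y] x that]
      by linarith
  qed
  obtain xh where "xh \<in> X" "(SUP x'\<in>X. - f x' y) = - f xh y"
    using swap.best_response[OF y] by metis
  then show "(SUP x'\<in>X. - f x' y) + f x y \<le> a"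
    using tangent[of xh] linear_minimization[OF s _ min, of xh "gx x y" x] by (simp add: a_def)
  let ?g = "gx x y"
  \<comment> \<open>The point of the ball around \<open>xs\<close> in the direction of steepest
    descent. For a vanishing gradient division by 0 gives \<open>q = xs\<close>, and the argument
    still holds.\<close>
  define q where "q = (\<lambda>i. xs i - \<delta> * (?g i / enorm dX ?g))"
  have "?g \<in> Rn dX"
    using grad_x[OF x y] by (simp add: has_gradient_def)
  then have qR: "q \<in> Rn dX"
    using xs(1) X_subset by (auto simp: q_def mem_Rn)
  have xq: "xs - q = (\<lambda>i. (\<delta> / enorm dX ?g) * ?g i)"
    by (simp add: q_def fun_eq_iff)
  have "enorm dX (xs - q) \<le> \<delta>"
    unfolding xq enorm_scale using \<delta> by (cases "enorm dX ?g = 0") auto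
  then have "q \<in> X"
    using xs(2) qR by blast
  then have "- einner dX ?g (q - x) \<le> a"
    using linear_minimization[OF s _ min, of q ?g x] by (simp add: a_def)
  moreover have "einner dX ?g (xs - q) = \<delta> * enorm dX ?g"
    unfolding xq einner_scale_right enorm_sq_einner[symmetric] by (simp add: power2_eq_square)
  ultimately show "\<delta> * enorm dX ?g + (f x y - f xs y) \<le> a"
    using tangent[OF xs(1)] by (simp add: einner_diff_right)
qed

text \<open>The quantities \<open>a\<close> and \<open>b\<close> of the proof contain the estimator
  errors in addition to the exact Frank-Wolfe gaps. The coupling is absorbed by \<open>a + b\<close>
  as a whole, so the errors come out with factor 1 and are not multiplied by constants of the
  coupling.\<close>

lemma frank_wolfe_step:
  assumes x: "x \<in> X" and y: "y \<in> Y" and s: "sx \<in> X" "sy \<in> Y" and \<gamma>: "0 \<le> \<gamma>" "\<gamma> \<le> 1"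
    and minx: "\<And>a. a \<in> X \<Longrightarrow> einner dX sx GX \<le> einner dX a GX"
    and miny: "\<And>b. b \<in> Y \<Longrightarrow> einner dY sy (- GY) \<le> einner dY b (- GY)"
    and saddle: "is_saddle_point X Y f xs ys"
    and ballX: "\<And>q. q \<in> Rn dX \<Longrightarrow> enorm dX (xs - q) \<le> \<delta>X \<Longrightarrow> q \<in> X"
    and ballY: "\<And>q. q \<in> Rn dY \<Longrightarrow> enorm dY (ys - q) \<le> \<delta>Y \<Longrightarrow> q \<in> Y"
    and \<delta>: "0 < \<delta>X" "0 < \<delta>Y"
  defines "C0 \<equiv> 1 - sqrt 2 / sqrt (min (muX * \<delta>X\<^sup>2) (muY * \<delta>Y\<^sup>2)) *
      max (DX * LXY / sqrt muY) (DY * LYX / sqrt muX)"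
  assumes C0: "0 < C0"
  shows "duality_gap X Y f (conv_comb \<gamma> x sx) (conv_comb \<gamma> y sy) \<le> (1 - \<gamma> * C0) * duality_gap X Y f x y
    + \<gamma> * (DX * enorm dX (GX - gx x y) + DY * enorm dY (GY - gy x y))
    + \<gamma>\<^sup>2 * ((LGX / 2 + LXY * LYX / muY) * DX\<^sup>2 + (LGY / 2 + LXY * LYX / muX) * DY\<^sup>2)"
proof -
  interpret swap: saddle_problem dY dX Y X "\<lambda>y x. - f x y" "\<lambda>y x. - gy x y" "\<lambda>y x. - gx x y"
    muY muX LY LX LGY LGX LYX LXY DY DX
    by (rule swapped)
  define P where "P = (SUP y'\<in>Y. f x y') - f x y"
  define Q where "Q = (SUP x'\<in>X. - f x' y) + f x y"
  define a where "a = DX * enorm dX (GX - gx x y) - einner dX (gx x y) (sx - x)"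
  define b where "b = DY * enorm dY (- GY - - gy x y) - einner dY (- gy x y) (sy - y)"
  define \<delta>\<mu> where "\<delta>\<mu> = sqrt (min (muX * \<delta>X\<^sup>2) (muY * \<delta>Y\<^sup>2))"
  define m where "m = max (DX * LXY / sqrt muY) (DY * LYX / sqrt muX)"
  have gap: "duality_gap X Y f x y = P + Q"
    by (simp add: duality_gap_def P_def Q_def)
  have P: "0 \<le> P"
    using le_SUP[OF x y] by (simp add: P_def)
  have Q: "0 \<le> Q"
    using swap.le_SUP[OF y x] by (simp add: Q_def)
  have sad: "xs \<in> X" "ys \<in> Y" "f xs y \<le> f x ys"
    using saddle x y by (auto simp: is_saddle_point_def intro: order_trans)
  have GY: "enorm dY (- GY - - gy x y) = enorm dY (GY - gy x y)"
    unfolding uminus_diff_uminus_vec by (rule enorm_minus_commute)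
  note la = gap_lower_bounds[OF x y s(1) minx sad(1) ballX less_imp_le[OF \<delta>(1)], folded a_def Q_def]
  have lb: "P \<le> b" "\<delta>Y * enorm dY (gy x y) + (f x ys - f x y) \<le> b"
    using swap.gap_lower_bounds[OF y x s(2) miny sad(2) ballY less_imp_le[OF \<delta>(2)], folded b_def]
    by (simp_all add: P_def)
  define u where "u = \<delta>X * enorm dX (gx x y)"
  define v where "v = \<delta>Y * enorm dY (gy x y)"
  have uv: "0 \<le> u" "0 \<le> v"
    using \<delta> by (auto simp: u_def v_def)
  \<comment> \<open>In the sum the two second bounds contribute \<open>f x ys - f xs y\<close>,
    which is nonnegative at a saddle point; the gradient terms remain.\<close>
  have ab: "u + v \<le> a + b" "P + Q \<le> a + b"
    using la lb sad(3) by (auto simp: u_def v_def)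
  have "0 < min (muX * \<delta>X\<^sup>2) (muY * \<delta>Y\<^sup>2)"
    using muX muY \<delta> by simp
  then have \<delta>\<mu>: "0 < \<delta>\<mu>" "\<delta>\<mu>\<^sup>2 \<le> muX * \<delta>X\<^sup>2" "\<delta>\<mu>\<^sup>2 \<le> muY * \<delta>Y\<^sup>2"
    by (auto simp: \<delta>\<mu>_def)
  \<comment> \<open>The modulus \<open>muX\<close> cancels between \<open>gradient_dominance\<close>
    and \<open>\<delta>\<mu>\<close>; this is why \<open>\<delta>\<mu>\<close> weighs each border
    distance by its modulus.\<close>
  have "2 * \<delta>\<mu>\<^sup>2 * Q \<le> u\<^sup>2"
  proof -
    obtain xh where "xh \<in> X" "(SUP x'\<in>X. - f x' y) = - f xh y"
      using swap.best_response[OF y] by metis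
    then have xh: "xh \<in> X" "Q = f x y - f xh y"
      by (simp_all add: Q_def)
    have "2 * \<delta>\<mu>\<^sup>2 * Q \<le> 2 * (muX * \<delta>X\<^sup>2) * Q"
      using \<delta>\<mu> Q by (intro mult_right_mono) auto
    also have "\<dots> \<le> 2 * (muX * \<delta>X\<^sup>2) * ((enorm dX (gx x y))\<^sup>2 / (2 * muX))"
      using gradient_dominance[OF x xh(1) y] xh(2) muX by (intro mult_left_mono) auto
    finally show ?thesis
      using muX by (simp add: u_def power_mult_distrib)
  qed
  moreover have "2 * \<delta>\<mu>\<^sup>2 * P \<le> v\<^sup>2"
  proof -
    obtain yh where "yh \<in> Y" "(SUP y'\<in>Y. f x y') = f x yh"
      using best_response[OF x] by metis
    then have yh: "yh \<in> Y" "P = f x yh - f x y"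
      by (simp_all add: P_def)
    have "2 * \<delta>\<mu>\<^sup>2 * P \<le> 2 * (muY * \<delta>Y\<^sup>2) * P"
      using \<delta>\<mu> P by (intro mult_right_mono) auto
    also have "\<dots> \<le> 2 * (muY * \<delta>Y\<^sup>2) * ((enorm dY (gy x y))\<^sup>2 / (2 * muY))"
      using swap.gradient_dominance[OF y yh(1) x] yh(2) muY by (intro mult_left_mono) auto
    finally show ?thesis
      using muY by (simp add: v_def power_mult_distrib)
  qed
  ultimately have "2 * \<delta>\<mu>\<^sup>2 * (P + Q) \<le> u\<^sup>2 + v\<^sup>2"
    by (simp add: algebra_simps)
  also have "\<dots> \<le> (u + v)\<^sup>2"
    using uv by (simp add: power2_sum)
  also have "\<dots> \<le> (a + b)\<^sup>2"
    using ab uv by (intro power_mono) auto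
  finally have "sqrt (2 * \<delta>\<mu>\<^sup>2 * (P + Q)) \<le> a + b"
    using ab P Q by (intro real_le_lsqrt) auto
  then have q: "sqrt 2 * sqrt (P + Q) \<le> (a + b) / \<delta>\<mu>"
    unfolding real_sqrt_mult using \<delta>\<mu>(1) by (simp add: pos_le_divide_eq mult_ac)
  have m: "0 \<le> m"
    using DX_nonneg nonneg muY by (simp add: m_def le_max_iff_disj)
  \<comment> \<open>This root of 2 uses up the one gained in \<open>q\<close>; the root of 2 in
    \<open>C0\<close> is the one inside the best-response distance
    \<open>sqrt (2 * P / muY)\<close>.\<close>
  have "sqrt P + sqrt Q \<le> sqrt 2 * sqrt (P + Q)"
  proof -
    have "(sqrt P + sqrt Q)\<^sup>2 \<le> 2 * (P + Q)"
      using P Q sum_squares_bound[of "sqrt P" "sqrt Q"] by (simp add: power2_sum)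
    then show ?thesis
      unfolding real_sqrt_mult[symmetric] by (rule real_le_rsqrt)
  qed
  with q have pq: "sqrt P + sqrt Q \<le> (a + b) / \<delta>\<mu>"
    by linarith
  have "DX * LXY * sqrt (2 * P / muY) + DY * LYX * sqrt (2 * Q / muX) =
      sqrt 2 * (DX * LXY / sqrt muY * sqrt P + DY * LYX / sqrt muX * sqrt Q)"
    by (simp add: real_sqrt_mult real_sqrt_divide algebra_simps)
  also have "\<dots> \<le> sqrt 2 * (m * sqrt P + m * sqrt Q)"
    using P Q by (intro mult_left_mono add_mono mult_right_mono) (auto simp: m_def)
  also have "\<dots> \<le> sqrt 2 * (m * ((a + b) / \<delta>\<mu>))"
    unfolding distrib_left[symmetric] by (intro mult_left_mono pq m) auto
  also have "\<dots> = (1 - C0) * (a + b)"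
    by (simp add: C0_def m_def \<delta>\<mu>_def)
  finally have cross: "DX * LXY * sqrt (2 * P / muY) + DY * LYX * sqrt (2 * Q / muX) \<le> (1 - C0) * (a + b)" .
  define K where "K = (LGX / 2 + LXY * LYX / muY) * DX\<^sup>2 + (LGY / 2 + LXY * LYX / muX) * DY\<^sup>2"
  define ex where "ex = DX * enorm dX (GX - gx x y)"
  define ey where "ey = DY * enorm dY (GY - gy x y)"
  have "duality_gap X Y f (conv_comb \<gamma> x sx) (conv_comb \<gamma> y sy) \<le> (P + Q) + \<gamma> * (ex - a) + \<gamma> * (ey - b)
      + \<gamma> * (DX * LXY * sqrt (2 * P / muY) + DY * LYX * sqrt (2 * Q / muX)) + \<gamma>\<^sup>2 * K"
  proof -
    have "(SUP y'\<in>Y. f (conv_comb \<gamma> x sx) y') \<le> P + f x y + \<gamma> * (ex - a)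
        + \<gamma> * (DX * LXY * sqrt (2 * P / muY)) + \<gamma>\<^sup>2 * ((LGX / 2 + LXY * LYX / muY) * DX\<^sup>2)"
      using primal_descent[OF x s(1) y \<gamma>] unfolding P_def a_def ex_def by simp
    moreover have "(SUP x'\<in>X. - f x' (conv_comb \<gamma> y sy)) \<le> Q - f x y + \<gamma> * (ey - b)
        + \<gamma> * (DY * LYX * sqrt (2 * Q / muX)) + \<gamma>\<^sup>2 * ((LGY / 2 + LXY * LYX / muX) * DY\<^sup>2)"
      using swap.primal_descent[OF y s(2) x \<gamma>]
      unfolding Q_def b_def ey_def GY mult.commute[of LYX LXY] by simp
    ultimately show ?thesis
      unfolding duality_gap_def K_def distrib_left by linarith
  qed
  also have "\<dots> \<le> (P + Q) + \<gamma> * (ex - a) + \<gamma> * (ey - b) + \<gamma> * ((1 - C0) * (a + b)) + \<gamma>\<^sup>2 * K"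
    using mult_left_mono[OF cross \<gamma>(1)] by simp
  also have "\<dots> = (P + Q) - \<gamma> * (C0 * (a + b)) + \<gamma> * (ex + ey) + \<gamma>\<^sup>2 * K"
    by (simp add: algebra_simps)
  also have "\<dots> \<le> (P + Q) - \<gamma> * (C0 * (P + Q)) + \<gamma> * (ex + ey) + \<gamma>\<^sup>2 * K"
    using mult_left_mono[OF mult_left_mono[OF ab(2), of C0] \<gamma>(1)] C0 by simp
  finally show ?thesis
    unfolding gap K_def ex_def ey_def by (simp add: algebra_simps)
qed

section \<open>Range and drift of the duality gap, and its relation to the merit\<close>

lemma duality_gap_nonneg:
  assumes "x \<in> X" "y \<in> Y"
  shows "0 \<le> duality_gap X Y f x y"
proof -
  interpret swap: saddle_problem dY dX Y X "\<lambda>y x. - f x y" "\<lambda>y x. - gy x y" "\<lambda>y x. - gx x y"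
    muY muX LY LX LGY LGX LYX LXY DY DX
    by (rule swapped)
  show ?thesis
    using le_SUP[OF assms] swap.le_SUP[OF assms(2,1)] by (simp add: duality_gap_def)
qed

text \<open>Bounds the initial gap of the telescoping sum. Absolute values appear because the locale
  fixes no sign for \<open>LX\<close> and \<open>LY\<close>.\<close>

lemma duality_gap_le_diameter:
  assumes x: "x \<in> X" and y: "y \<in> Y"
  shows "duality_gap X Y f x y \<le> \<bar>LX\<bar> * DX + \<bar>LY\<bar> * DY"
proof -
  have "f x y' - f x y \<le> \<bar>LY\<bar> * DY" if "y' \<in> Y" for y'
  proof -
    have "\<bar>f x y' - f x y\<bar> \<le> LY * enorm dY (y' - y)"
      using lipschitz_y[OF x] y that by (auto simp: lipschitz_fun_on_def)
    also have "\<dots> \<le> \<bar>LY\<bar> * DY"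
      using diam_Y[OF that y] by (intro mult_mono) auto
    finally show ?thesis
      by simp
  qed
  then have "(SUP y'\<in>Y. f x y') \<le> f x y + \<bar>LY\<bar> * DY"
    using nonempty_Y by (intro cSUP_least) (auto simp: algebra_simps)
  moreover have "f x y - f x' y \<le> \<bar>LX\<bar> * DX" if "x' \<in> X" for x'
  proof -
    have "\<bar>f x y - f x' y\<bar> \<le> LX * enorm dX (x - x')"
      using lipschitz_x[OF y] x that by (auto simp: lipschitz_fun_on_def)
    also have "\<dots> \<le> \<bar>LX\<bar> * DX"
      using diam_X[OF x that] by (intro mult_mono) auto
    finally show ?thesis
      by simp
  qed
  then have "(SUP x'\<in>X. - f x' y) \<le> - f x y + \<bar>LX\<bar> * DX"
    using nonempty_X by (intro cSUP_least) (auto simp: algebra_simps)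
  ultimately show ?thesis
    by (simp add: duality_gap_def)
qed

text \<open>Each of the two suprema moves by at most \<open>w\<close>, which is the origin of the
  factor 2 in front of \<open>W\<close>.\<close>

lemma duality_gap_perturb:
  assumes x: "x \<in> X" and y: "y \<in> Y"
    and w: "\<And>x y. x \<in> X \<Longrightarrow> y \<in> Y \<Longrightarrow> \<bar>f x y - f' x y\<bar> \<le> w"
  shows "duality_gap X Y f' x y \<le> duality_gap X Y f x y + 2 * w"
proof -
  interpret swap: saddle_problem dY dX Y X "\<lambda>y x. - f x y" "\<lambda>y x. - gy x y" "\<lambda>y x. - gx x y"
    muY muX LY LX LGY LGX LYX LXY DY DX
    by (rule swapped)
  have "(SUP y'\<in>Y. f' x y') \<le> (SUP y'\<in>Y. f x y') + w"
  proof (rule cSUP_least[OF nonempty_Y])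
    fix y' assume "y' \<in> Y"
    then show "f' x y' \<le> (SUP y'\<in>Y. f x y') + w"
      using w[OF x] le_SUP[OF x] by (smt (verit))
  qed
  moreover have "(SUP x'\<in>X. - f' x' y) \<le> (SUP x'\<in>X. - f x' y) + w"
  proof (rule cSUP_least[OF nonempty_X])
    fix x' assume "x' \<in> X"
    then show "- f' x' y \<le> (SUP x'\<in>X. - f x' y) + w"
      using w[OF _ y] swap.le_SUP[OF y] by (smt (verit))
  qed
  ultimately show ?thesis
    by (simp add: duality_gap_def)
qed

text \<open>Quadratic growth on both sides of the saddle point makes the sum of the squared
  distances at most \<open>2 / \<mu>\<close> times the gap, and the payoff is Lipschitz along the
  path through \<open>(xs, y)\<close>. The square of the merit is thus linear in the gap; the other
  factor 2 is that of \<open>(u + v)\<^sup>2 \<le> 2 * (u\<^sup>2 + v\<^sup>2)\<close>.\<close>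

lemma merit_le_duality_gap:
  assumes x: "x \<in> X" and y: "y \<in> Y" and saddle: "is_saddle_point X Y f xs ys"
  defines "\<mu> \<equiv> min muX muY" and "L \<equiv> max \<bar>LX\<bar> \<bar>LY\<bar>"
  shows "(f x y - f xs ys)\<^sup>2 \<le> 4 * L\<^sup>2 / \<mu> * duality_gap X Y f x y"
proof -
  interpret swap: saddle_problem dY dX Y X "\<lambda>y x. - f x y" "\<lambda>y x. - gy x y" "\<lambda>y x. - gx x y"
    muY muX LY LX LGY LGX LYX LXY DY DX
    by (rule swapped)
  have s: "xs \<in> X" "ys \<in> Y" "\<And>x y. x \<in> X \<Longrightarrow> y \<in> Y \<Longrightarrow> f xs y \<le> f xs ys \<and> f xs ys \<le> f x ys"
    using saddle by (auto simp: is_saddle_point_def)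
  define u where "u = enorm dX (x - xs)"
  define v where "v = enorm dY (y - ys)"
  have uv: "0 \<le> u" "0 \<le> v"
    by (auto simp: u_def v_def)
  have \<mu>: "0 < \<mu>" "\<mu> \<le> muX" "\<mu> \<le> muY"
    using muX muY by (auto simp: \<mu>_def)
  have "muX / 2 * u\<^sup>2 \<le> f x ys - f xs ys"
    using strongly_convex_minimizer[OF sconvex_x[OF s(2)] convex_X s(1) x] s
    by (fastforce simp: u_def enorm_minus_commute[of dX x])
  moreover have "muY / 2 * v\<^sup>2 \<le> f xs ys - f xs y"
    using best_response_dist[OF s(1) y s(2)] s by (fastforce simp: v_def enorm_minus_commute[of dY y])
  moreover have "\<mu> / 2 * u\<^sup>2 \<le> muX / 2 * u\<^sup>2" "\<mu> / 2 * v\<^sup>2 \<le> muY / 2 * v\<^sup>2"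
    using \<mu> by (auto intro!: mult_right_mono)
  moreover have "f x ys - f xs y \<le> duality_gap X Y f x y"
    using le_SUP[OF x s(2)] swap.le_SUP[OF y s(1)] by (simp add: duality_gap_def)
  ultimately have "\<mu> / 2 * (u\<^sup>2 + v\<^sup>2) \<le> duality_gap X Y f x y"
    by (simp add: distrib_left)
  then have uv2: "u\<^sup>2 + v\<^sup>2 \<le> 2 / \<mu> * duality_gap X Y f x y"
    using \<mu> by (simp add: field_simps)
  have "\<bar>f x y - f xs y\<bar> \<le> L * u"
  proof -
    have "\<bar>f x y - f xs y\<bar> \<le> LX * u"
      using lipschitz_x[OF y] x s(1) unfolding lipschitz_fun_on_def u_def by blast
    also have "\<dots> \<le> L * u"
      using uv by (intro mult_right_mono) (auto simp: L_def)
    finally show ?thesis .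
  qed
  moreover have "\<bar>f xs y - f xs ys\<bar> \<le> L * v"
  proof -
    have "\<bar>f xs y - f xs ys\<bar> \<le> LY * v"
      using lipschitz_y[OF s(1)] y s(2) unfolding lipschitz_fun_on_def v_def by blast
    also have "\<dots> \<le> L * v"
      using uv by (intro mult_right_mono) (auto simp: L_def)
    finally show ?thesis .
  qed
  ultimately have "\<bar>f x y - f xs ys\<bar> \<le> L * (u + v)"
    by (simp add: distrib_left)
  then have "(f x y - f xs ys)\<^sup>2 \<le> (L * (u + v))\<^sup>2"
    by (metis abs_ge_zero power2_abs power_mono)
  also have "\<dots> = L\<^sup>2 * (u + v)\<^sup>2"
    by (simp add: power_mult_distrib)
  also have "\<dots> \<le> L\<^sup>2 * (2 * (u\<^sup>2 + v\<^sup>2))"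
    using sum_squares_bound[of u v] by (intro mult_left_mono) (auto simp: power2_sum)
  also have "\<dots> \<le> L\<^sup>2 * (2 * (2 / \<mu> * duality_gap X Y f x y))"
    by (intro mult_left_mono uv2) auto
  finally show ?thesis
    by (simp add: mult_ac)
qed

end

section \<open>Gaussian moments\<close>

abbreviation gauss1 :: "real measure" where
  "gauss1 \<equiv> density lborel std_normal_density"

lemma gauss1_moment: "has_bochner_integral lborel (\<lambda>x. std_normal_density x * x ^ k) m \<Longrightarrow>
    integrable gauss1 (\<lambda>x. x ^ k) \<and> (\<integral>x. x ^ k \<partial>gauss1) = m"
  by (auto simp: has_bochner_integral_iff integrable_density integral_density normal_density_nonneg)

lemma gauss1_moments:
  "integrable gauss1 (\<lambda>x. x ^ k)"
  "(\<integral>x. x ^ 0 \<partial>gauss1) = 1" "(\<integral>x. x ^ 1 \<partial>gauss1) = 0" "(\<integral>x. x ^ 2 \<partial>gauss1) = 1"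
  "(\<integral>x. x ^ 3 \<partial>gauss1) = 0" "(\<integral>x. x ^ 4 \<partial>gauss1) = 3"
proof -
  show "integrable gauss1 (\<lambda>x. x ^ k)"
    using integrable_std_normal_moment[of k] by (simp add: integrable_density normal_density_nonneg)
  show "(\<integral>x. x ^ 0 \<partial>gauss1) = 1"
    using gauss1_moment[of 0 1] std_normal_moment_even[of 0] by simp
  show "(\<integral>x. x ^ 1 \<partial>gauss1) = 0"
    using gauss1_moment[of 1 0] std_normal_moment_odd[of 0] by simp
  show "(\<integral>x. x ^ 2 \<partial>gauss1) = 1"
    using gauss1_moment[of 2 1] std_normal_moment_even[of 1] by (simp add: fact_numeral)
  show "(\<integral>x. x ^ 3 \<partial>gauss1) = 0"
    using gauss1_moment[of 3 0] std_normal_moment_odd[of 1] by (simp add: eval_nat_numeral)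
  show "(\<integral>x. x ^ 4 \<partial>gauss1) = 3"
    using gauss1_moment[of 4 3] std_normal_moment_even[of 2] by (simp add: fact_numeral)
qed

interpretation gauss1: prob_space gauss1
  by (rule prob_space_normal_density) simp

section \<open>Measurability and moments of Gaussian vectors\<close>

lemma measurable_vec_component [measurable]: "(\<lambda>u :: vec. u i) \<in> borel_measurable borel"
  by (intro borel_measurable_continuous_onI continuous_on_product_coordinates)

text \<open>There are countably many coordinates, so the Borel sets of the product topology form the
  product \<sigma>-algebra.\<close>

lemma measurable_vecI:
  assumes "\<And>i. (\<lambda>x. f x i) \<in> borel_measurable M"
  shows "f \<in> M \<rightarrow>\<^sub>M (borel :: vec measure)"
proof -
  have "f \<in> M \<rightarrow>\<^sub>M PiM UNIV (\<lambda>_. borel)"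
    using assms by (intro measurable_PiM_single') auto
  then show ?thesis
    by (simp add: measurable_cong_sets[OF refl sets_PiM_equal_borel])
qed

lemma measurable_gauss_embedding [measurable]:
  "(\<lambda>u i. if i < d then u i else 0) \<in> PiM {..<d} (\<lambda>_. gauss1) \<rightarrow>\<^sub>M (borel :: vec measure)"
proof (rule measurable_vecI)
  fix i
  have "(\<lambda>u. u i) \<in> PiM {..<d} (\<lambda>_. gauss1) \<rightarrow>\<^sub>M gauss1" if "i < d"
    using that by (intro measurable_component_singleton) auto
  then show "(\<lambda>u. if i < d then u i else 0) \<in> borel_measurable (PiM {..<d} (\<lambda>_. gauss1))"
    by (cases "i < d") (auto simp: measurable_cong_sets[OF refl, of gauss1 borel])
qed

lemma sets_std_gauss [measurable_cong, simp]: "sets (std_gauss d) = sets borel"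
  by (simp add: std_gauss_def)

lemma space_std_gauss [simp]: "space (std_gauss d) = UNIV"
  by (simp add: std_gauss_def)

lemma prob_space_std_gauss: "prob_space (std_gauss d)"
  unfolding std_gauss_def
  by (intro prob_space.prob_space_distr prob_space_PiM gauss1.prob_space_axioms measurable_gauss_embedding)

text \<open>\<open>std_gauss\<close> is a measure on all sequences, whereas the Taylor bound of the
  payoff is available for increments in \<open>Rn d\<close>.\<close>

lemma AE_std_gauss_Rn: "AE u in std_gauss d. u \<in> Rn d"
proof -
  have "{u :: vec. \<forall>i\<ge>d. u i = 0} = {u \<in> space borel. \<forall>i\<ge>d. u i = 0}"
    by simp
  also have "\<dots> \<in> sets borel"
    by measurable
  finally show ?thesis
    unfolding std_gauss_def mem_Rn by (subst AE_distr_iff) auto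
qed

text \<open>Each mixed moment below is that of a monomial with exponents \<open>k\<close>, and
  independence turns its integral into a product of one-dimensional moments.\<close>

lemma std_gauss_monomial:
  "integrable (std_gauss d) (\<lambda>u. \<Prod>i<d. u i ^ k i)"
  "(\<integral>u. (\<Prod>i<d. u i ^ k i) \<partial>std_gauss d) = (\<Prod>i<d. \<integral>x. x ^ k i \<partial>gauss1)"
proof -
  interpret product_sigma_finite "\<lambda>_ :: nat. gauss1"
    by standard
  have "integrable (PiM {..<d} (\<lambda>_. gauss1)) (\<lambda>u. \<Prod>i<d. u i ^ k i)"
    by (rule product_integrable_prod) (auto intro: gauss1_moments)
  then show "integrable (std_gauss d) (\<lambda>u. \<Prod>i<d. u i ^ k i)"
    unfolding std_gauss_def by (subst integrable_distr_eq) auto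
  have "(\<integral>u. (\<Prod>i<d. u i ^ k i) \<partial>std_gauss d) = (\<integral>u. (\<Prod>i<d. u i ^ k i) \<partial>PiM {..<d} (\<lambda>_. gauss1))"
    unfolding std_gauss_def by (subst integral_distr) auto
  also have "\<dots> = (\<Prod>i<d. \<integral>x. x ^ k i \<partial>gauss1)"
    by (rule product_integral_prod) (auto intro: gauss1_moments)
  finally show "(\<integral>u. (\<Prod>i<d. u i ^ k i) \<partial>std_gauss d) = (\<Prod>i<d. \<integral>x. x ^ k i \<partial>gauss1)" .
qed

lemma prod_power_delta: "i < d \<Longrightarrow> (\<Prod>l<d. u l ^ (if l = i then n else 0)) = (u :: vec) i ^ n"
  by (simp add: if_distrib[of "power _"] prod.delta cong: if_cong)

lemma std_gauss_second_moment:
  assumes "i < d" "j < d"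
  shows "integrable (std_gauss d) (\<lambda>u. u i * u j)"
    and "(\<integral>u. u i * u j \<partial>std_gauss d) = (if i = j then 1 else 0)"
proof -
  \<comment> \<open>\<open>?k\<close> counts how often \<open>u l\<close> occurs in the product,
    which also covers coinciding indices.\<close>
  let ?k = "\<lambda>l. (if l = i then 1 else 0) + (if l = j then 1 else (0 :: nat))"
  have *: "u i * u j = (\<Prod>l<d. u l ^ ?k l)" for u :: vec
    using assms by (simp add: power_add prod.distrib prod_power_delta)
  show "integrable (std_gauss d) (\<lambda>u. u i * u j)"
    unfolding * by (rule std_gauss_monomial)
  have "(\<integral>u. u i * u j \<partial>std_gauss d) = (\<Prod>l<d. \<integral>x. x ^ ?k l \<partial>gauss1)"
    unfolding * by (rule std_gauss_monomial)
  also have "\<dots> = (if i = j then 1 else 0)"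
  proof (cases "i = j")
    case True
    then have "?k l = (if l = i then 2 else 0)" for l
      by simp
    then have "(\<Prod>l<d. \<integral>x. x ^ ?k l \<partial>gauss1) = (\<Prod>l<d. 1)"
      using gauss1_moments(2,4) by (intro prod.cong) (auto simp del: power_0)
    then show ?thesis
      using True by simp
  next
    case False
    then have "(\<integral>x. x ^ ?k i \<partial>gauss1) = 0"
      using gauss1_moments(3) by simp
    then show ?thesis
      using False assms by (auto intro!: prod_zero)
  qed
  finally show "(\<integral>u. u i * u j \<partial>std_gauss d) = (if i = j then 1 else 0)" .
qed

lemma std_gauss_fourth_moment:
  assumes "i < d" "j < d" "k < d"
  shows "integrable (std_gauss d) (\<lambda>u. u i * u j * (u k)\<^sup>2)"
    and "(\<integral>u. u i * u j * (u k)\<^sup>2 \<partial>std_gauss d) = (if i = j then (if i = k then 3 else 1) else 0)"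
proof -
  define K where "K l = (if l = i then 1 else 0) + (if l = j then 1 else 0) + (if l = k then 2 else (0 :: nat))" for l
  have *: "u i * u j * (u k)\<^sup>2 = (\<Prod>l<d. u l ^ K l)" for u :: vec
    unfolding K_def power_add prod.distrib using assms by (simp only: prod_power_delta power_one_right)
  show "integrable (std_gauss d) (\<lambda>u. u i * u j * (u k)\<^sup>2)"
    unfolding * by (rule std_gauss_monomial)
  have int: "(\<integral>u. u i * u j * (u k)\<^sup>2 \<partial>std_gauss d) = (\<Prod>l<d. \<integral>x. x ^ K l \<partial>gauss1)"
    unfolding * by (rule std_gauss_monomial)
  show "(\<integral>u. u i * u j * (u k)\<^sup>2 \<partial>std_gauss d) = (if i = j then (if i = k then 3 else 1) else 0)"
  proof (cases "i = j")
    case False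
    \<comment> \<open>The coordinate \<open>i\<close> has an odd exponent, whose moment vanishes by
      symmetry.\<close>
    then consider "K i = 1" | "K i = 3"
      by (cases "i = k") (auto simp: K_def)
    then have "(\<integral>x. x ^ K i \<partial>gauss1) = 0"
      by cases (simp_all only: gauss1_moments)
    then have "(\<Prod>l<d. \<integral>x. x ^ K l \<partial>gauss1) = 0"
      using assms by (intro prod_zero) auto
    then show ?thesis
      using False int by simp
  next
    case ij: True
    have "(\<integral>x. x ^ K l \<partial>gauss1) = (if l = i \<and> i = k then 3 else 1)" for l
    proof -
      consider "K l = 4" "l = i \<and> i = k" | "K l = 2" "\<not> (l = i \<and> i = k)" | "K l = 0" "\<not> (l = i \<and> i = k)"
        using ij by (cases "i = k"; cases "l = i"; cases "l = k") (auto simp: K_def)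
      then show ?thesis
        by cases (simp_all only: gauss1_moments if_True if_False simp_thms)
    qed
    then have "(\<Prod>l<d. \<integral>x. x ^ K l \<partial>gauss1) = (\<Prod>l<d. if l = i \<and> i = k then 3 else 1)"
      by simp
    also have "\<dots> = (if i = k then 3 else 1)"
      using assms by (cases "i = k") (auto simp: prod.delta)
    finally show ?thesis
      using ij int by simp
  qed
qed

text \<open>The covariance of \<open>u\<close> is the identity. Hence the linear part of the
  zeroth-order estimator is unbiased.\<close>

lemma std_gauss_projection:
  assumes "i < d"
  shows "(\<integral>u. einner d g u * u i \<partial>std_gauss d) = g i"
proof -
  have "(\<integral>u. einner d g u * u i \<partial>std_gauss d) = (\<integral>u. (\<Sum>j<d. g j * (u j * u i)) \<partial>std_gauss d)"
    by (simp add: einner_def sum_distrib_right mult.assoc)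
  also have "\<dots> = (\<Sum>j<d. g j * (\<integral>u. u j * u i \<partial>std_gauss d))"
    using assms std_gauss_second_moment(1) by (subst Bochner_Integration.integral_sum) auto
  also have "\<dots> = (\<Sum>j<d. if j = i then g j else 0)"
    using assms std_gauss_second_moment(2) by (intro sum.cong) auto
  also have "\<dots> = g i"
    using assms by simp
  finally show ?thesis .
qed

text \<open>The exact value is \<open>(real d + 2) * (enorm d g)\<^sup>2\<close>; bounding every
  fourth moment with equal first indices by 3 gives the factor \<open>3 * real d\<close>.\<close>

lemma std_gauss_projection_norm:
  "integrable (std_gauss d) (\<lambda>u. (einner d g u)\<^sup>2 * (enorm d u)\<^sup>2)"
  "(\<integral>u. (einner d g u)\<^sup>2 * (enorm d u)\<^sup>2 \<partial>std_gauss d) \<le> 3 * real d * (enorm d g)\<^sup>2"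
proof -
  have *: "(einner d g u)\<^sup>2 * (enorm d u)\<^sup>2 = (\<Sum>i<d. \<Sum>j<d. \<Sum>k<d. g i * g j * (u i * u j * (u k)\<^sup>2))" for u
  proof -
    have "(einner d g u)\<^sup>2 * (enorm d u)\<^sup>2 = (\<Sum>i<d. \<Sum>j<d. (g i * u i) * (g j * u j)) * (\<Sum>k<d. (u k)\<^sup>2)"
    proof -
      have "(einner d g u)\<^sup>2 = (\<Sum>i<d. \<Sum>j<d. (g i * u i) * (g j * u j))"
        by (simp only: power2_eq_square einner_def sum_product)
      then show ?thesis
        by (simp only: enorm_sq)
    qed
    also have "\<dots> = (\<Sum>i<d. \<Sum>j<d. \<Sum>k<d. (g i * u i) * (g j * u j) * (u k)\<^sup>2)"
      by (simp only: sum_distrib_right) (simp only: sum_distrib_left)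
    also have "\<dots> = (\<Sum>i<d. \<Sum>j<d. \<Sum>k<d. g i * g j * (u i * u j * (u k)\<^sup>2))"
      by (simp only: mult_ac)
    finally show ?thesis .
  qed
  show "integrable (std_gauss d) (\<lambda>u. (einner d g u)\<^sup>2 * (enorm d u)\<^sup>2)"
    unfolding * using std_gauss_fourth_moment(1)
    by (intro Bochner_Integration.integrable_sum integrable_mult_right) auto
  have "(\<integral>u. (einner d g u)\<^sup>2 * (enorm d u)\<^sup>2 \<partial>std_gauss d) =
      (\<Sum>i<d. \<Sum>j<d. \<Sum>k<d. g i * g j * (\<integral>u. u i * u j * (u k)\<^sup>2 \<partial>std_gauss d))"
  proof -
    have int: "integrable (std_gauss d) (\<lambda>u. g i * g j * (u i * u j * (u k)\<^sup>2))" if "i < d" "j < d" "k < d" for i j k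
      using std_gauss_fourth_moment(1)[OF that] by (rule integrable_mult_right)
    have "(\<integral>u. (einner d g u)\<^sup>2 * (enorm d u)\<^sup>2 \<partial>std_gauss d) =
        (\<Sum>i<d. \<integral>u. (\<Sum>j<d. \<Sum>k<d. g i * g j * (u i * u j * (u k)\<^sup>2)) \<partial>std_gauss d)"
      unfolding * by (intro Bochner_Integration.integral_sum Bochner_Integration.integrable_sum int) auto
    also have "\<dots> = (\<Sum>i<d. \<Sum>j<d. \<integral>u. (\<Sum>k<d. g i * g j * (u i * u j * (u k)\<^sup>2)) \<partial>std_gauss d)"
      by (intro sum.cong refl Bochner_Integration.integral_sum Bochner_Integration.integrable_sum int) auto
    also have "\<dots> = (\<Sum>i<d. \<Sum>j<d. \<Sum>k<d. g i * g j * (\<integral>u. u i * u j * (u k)\<^sup>2 \<partial>std_gauss d))"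
      by (intro sum.cong refl trans[OF Bochner_Integration.integral_sum] int) auto
    finally show ?thesis .
  qed
  also have "\<dots> = (\<Sum>i<d. \<Sum>j<d. \<Sum>k<d. if i = j then (g i)\<^sup>2 * (if i = k then 3 else 1) else 0)"
    by (intro sum.cong refl) (simp add: std_gauss_fourth_moment(2) power2_eq_square[of "g _"])
  also have "\<dots> \<le> (\<Sum>i<d. \<Sum>j<d. \<Sum>k<d. if i = j then (g i)\<^sup>2 * 3 else 0)"
    by (intro sum_mono) auto
  also have "\<dots> = (\<Sum>i<d. \<Sum>j<d. if i = j then real d * ((g i)\<^sup>2 * 3) else 0)"
    by (intro sum.cong) auto
  also have "\<dots> = 3 * real d * (enorm d g)\<^sup>2"
    by (simp add: enorm_sq sum_distrib_left mult_ac)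
  finally show "(\<integral>u. (einner d g u)\<^sup>2 * (enorm d u)\<^sup>2 \<partial>std_gauss d) \<le> 3 * real d * (enorm d g)\<^sup>2" .
qed

text \<open>The cube of the norm is not a polynomial in the coordinates, so it is interpolated
  between the second and the fourth power. With the weight \<open>r\<close> the two contribute
  \<open>3 / 2 * real d * r\<close> and \<open>1 / 2 * real d * r\<close>.\<close>

lemma std_gauss_norm_cubed:
  assumes d: "1 \<le> d"
  shows "integrable (std_gauss d) (\<lambda>u. (enorm d u) ^ 3)"
    and "(\<integral>u. (enorm d u) ^ 3 \<partial>std_gauss d) \<le> 2 * real d * sqrt (real d)"
proof -
  define r where "r = sqrt (real d)"
  have r: "0 < r" "r * r = real d"
    using d by (auto simp: r_def)
  have m2: "integrable (std_gauss d) (\<lambda>u. (enorm d u)\<^sup>2)" "(\<integral>u. (enorm d u)\<^sup>2 \<partial>std_gauss d) = real d"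
    unfolding enorm_sq
    unfolding power2_eq_square using std_gauss_second_moment
    by (auto simp: Bochner_Integration.integral_sum)
  have *: "(enorm d u) ^ 4 = (\<Sum>i<d. \<Sum>k<d. u i * u i * (u k)\<^sup>2)" for u
  proof -
    have "(enorm d u) ^ 4 = (enorm d u)\<^sup>2 * (enorm d u)\<^sup>2"
      by (simp flip: power_add)
    then show ?thesis
      unfolding enorm_sq sum_product by (simp add: power2_eq_square)
  qed
  have i4: "integrable (std_gauss d) (\<lambda>u. (enorm d u) ^ 4)"
    unfolding * using std_gauss_fourth_moment(1) by (intro Bochner_Integration.integrable_sum) auto
  have "(\<integral>u. (enorm d u) ^ 4 \<partial>std_gauss d) = (\<Sum>i<d. \<Sum>k<d. \<integral>u. u i * u i * (u k)\<^sup>2 \<partial>std_gauss d)"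
    unfolding *
    by (subst Bochner_Integration.integral_sum, force intro!: Bochner_Integration.integrable_sum std_gauss_fourth_moment(1))
      (intro sum.cong refl Bochner_Integration.integral_sum std_gauss_fourth_moment(1); simp)
  also have "\<dots> \<le> (\<Sum>i<d. \<Sum>k<d. 3)"
    by (intro sum_mono) (auto simp: std_gauss_fourth_moment(2))
  finally have m4: "(\<integral>u. (enorm d u) ^ 4 \<partial>std_gauss d) \<le> 3 * (real d)\<^sup>2"
    by (simp add: power2_eq_square)
  have amgm: "(enorm d u) ^ 3 \<le> (enorm d u) ^ 4 / (2 * r) + r / 2 * (enorm d u)\<^sup>2" for u
  proof -
    have "0 \<le> (enorm d u)\<^sup>2 * (enorm d u - r)\<^sup>2 / (2 * r)"
      using r by simp
    also have "\<dots> = (enorm d u) ^ 4 / (2 * r) + r / 2 * (enorm d u)\<^sup>2 - (enorm d u) ^ 3"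
      using r by (simp add: power2_diff field_simps power2_eq_square power3_eq_cube power4_eq_xxxx)
    finally show ?thesis
      by simp
  qed
  have int: "integrable (std_gauss d) (\<lambda>u. (enorm d u) ^ 4 / (2 * r) + r / 2 * (enorm d u)\<^sup>2)"
    using m2 i4 by auto
  have meas: "(\<lambda>u. enorm d u) \<in> borel_measurable (std_gauss d)"
    unfolding enorm_def L2_set_def by measurable
  show "integrable (std_gauss d) (\<lambda>u. (enorm d u) ^ 3)"
    by (rule Bochner_Integration.integrable_bound[OF int]) (use meas amgm in \<open>auto intro: order_trans[OF _ abs_ge_self]\<close>)
  then have "(\<integral>u. (enorm d u) ^ 3 \<partial>std_gauss d) \<le>
      (\<integral>u. (enorm d u) ^ 4 / (2 * r) + r / 2 * (enorm d u)\<^sup>2 \<partial>std_gauss d)"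
    using int amgm by (intro integral_mono) auto
  also have "\<dots> = (\<integral>u. (enorm d u) ^ 4 \<partial>std_gauss d) / (2 * r) + r / 2 * real d"
    using m2 i4 by simp
  also have "\<dots> \<le> 3 * (real d)\<^sup>2 / (2 * r) + r / 2 * real d"
    using m4 r by (intro add_right_mono divide_right_mono) auto
  also have "\<dots> = 2 * real d * r"
    using r(1) unfolding r(2)[symmetric] by (simp add: field_simps power2_eq_square)
  finally show "(\<integral>u. (enorm d u) ^ 3 \<partial>std_gauss d) \<le> 2 * real d * sqrt (real d)"
    by (simp add: r_def)
qed


section \<open>Monte Carlo averages\<close>

lemma (in prob_space) square_le_integral_square:
  fixes h :: "'a \<Rightarrow> real"
  assumes "integrable M (\<lambda>s. (h s)\<^sup>2)" "h \<in> borel_measurable M"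
  shows "integrable M h" and "(\<integral>s. h s \<partial>M)\<^sup>2 \<le> (\<integral>s. (h s)\<^sup>2 \<partial>M)"
    and "(\<integral>s. (h s - (\<integral>s. h s \<partial>M))\<^sup>2 \<partial>M) \<le> (\<integral>s. (h s)\<^sup>2 \<partial>M)"
proof -
  show int: "integrable M h"
    using assms(2,1) by (rule square_integrable_imp_integrable)
  have eq: "variance h = (\<integral>s. (h s)\<^sup>2 \<partial>M) - (\<integral>s. h s \<partial>M)\<^sup>2"
    using int assms(1) by (rule variance_eq)
  then show "(\<integral>s. h s \<partial>M)\<^sup>2 \<le> (\<integral>s. (h s)\<^sup>2 \<partial>M)"
    using variance_positive[of h] by linarith
  show "(\<integral>s. (h s - (\<integral>s. h s \<partial>M))\<^sup>2 \<partial>M) \<le> (\<integral>s. (h s)\<^sup>2 \<partial>M)"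
    using eq zero_le_power2[of "\<integral>s. h s \<partial>M"] by linarith
qed

lemma integral_square_sum_centered:
  fixes h :: "'s \<Rightarrow> real"
  assumes "prob_space S" and h [measurable]: "h \<in> borel_measurable S"
    and sq: "integrable S (\<lambda>s. (h s)\<^sup>2)" and mean: "(\<integral>s. h s \<partial>S) = 0"
  shows "integrable (PiM {1..m} (\<lambda>_. S)) (\<lambda>w. (\<Sum>j=1..m. h (w j))\<^sup>2)"
    and "(\<integral>w. (\<Sum>j=1..m. h (w j))\<^sup>2 \<partial>PiM {1..m} (\<lambda>_. S)) = real m * (\<integral>s. (h s)\<^sup>2 \<partial>S)"
proof -
  interpret S: prob_space S by fact
  interpret product_sigma_finite "\<lambda>_ :: nat. S"
    by standard
  let ?P = "PiM {1..m} (\<lambda>_ :: nat. S)"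
  have int_h: "integrable S h"
    using S.square_le_integral_square(1)[OF sq h] .
  have *: "integrable ?P (\<lambda>w. h (w j) * h (w k)) \<and>
      (\<integral>w. h (w j) * h (w k) \<partial>?P) = (if j = k then (\<integral>s. (h s)\<^sup>2 \<partial>S) else 0)"
    if jk: "j \<in> {1..m}" "k \<in> {1..m}" for j k
  proof (cases "j = k")
    case True
    have d: "distr ?P S (\<lambda>w. w j) = S"
      using jk by (intro distr_PiM_component S.prob_space_axioms)
    have "integrable (distr ?P S (\<lambda>w. w j)) (\<lambda>s. (h s)\<^sup>2)" "(\<integral>s. (h s)\<^sup>2 \<partial>distr ?P S (\<lambda>w. w j)) = (\<integral>s. (h s)\<^sup>2 \<partial>S)"
      unfolding d using sq by auto
    then show ?thesis
      using True jk by (subst (asm) integrable_distr_eq, simp, simp) (subst (asm) integral_distr, auto simp: power2_eq_square)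
  next
    case False
    \<comment> \<open>\<open>f\<close> carries \<open>h\<close> at the two indices and 1 elsewhere,
      so the product formula applies and the factor at \<open>j\<close> has mean 0.\<close>
    define f where "f l = (if l \<in> {j, k} then h else (\<lambda>_. 1))" for l
    have f: "integrable S (f l)" for l
      using int_h by (auto simp: f_def)
    have prod: "(\<Prod>l\<in>{1..m}. f l (w l)) = h (w j) * h (w k)" for w
    proof -
      have "(\<Prod>l\<in>{1..m}. f l (w l)) = (\<Prod>l\<in>{j, k}. f l (w l))"
        using jk by (intro prod.mono_neutral_right) (auto simp: f_def)
      also have "\<dots> = h (w j) * h (w k)"
        using False by (simp add: f_def)
      finally show ?thesis .
    qed
    have "integrable ?P (\<lambda>w. \<Prod>l\<in>{1..m}. f l (w l))"
      by (rule product_integrable_prod) (auto intro: f)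
    moreover have "(\<integral>w. (\<Prod>l\<in>{1..m}. f l (w l)) \<partial>?P) = (\<Prod>l\<in>{1..m}. \<integral>s. f l s \<partial>S)"
      by (rule product_integral_prod) (auto intro: f)
    moreover have "(\<Prod>l\<in>{1..m}. \<integral>s. f l s \<partial>S) = 0"
      using jk mean by (intro prod_zero bexI[of _ j]) (auto simp: f_def)
    ultimately show ?thesis
      using False unfolding prod by simp
  qed
  have sum: "(\<Sum>j=1..m. h (w j))\<^sup>2 = (\<Sum>j=1..m. \<Sum>k=1..m. h (w j) * h (w k))" for w
    by (simp add: power2_eq_square sum_product)
  show "integrable ?P (\<lambda>w. (\<Sum>j=1..m. h (w j))\<^sup>2)"
    unfolding sum using * by (intro Bochner_Integration.integrable_sum) blast
  have "(\<integral>w. (\<Sum>j=1..m. h (w j))\<^sup>2 \<partial>?P) = (\<Sum>j=1..m. \<Sum>k=1..m. \<integral>w. h (w j) * h (w k) \<partial>?P)"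
  proof -
    have "(\<integral>w. (\<Sum>j=1..m. h (w j))\<^sup>2 \<partial>?P) = (\<Sum>j=1..m. \<integral>w. (\<Sum>k=1..m. h (w j) * h (w k)) \<partial>?P)"
      unfolding sum using * by (intro Bochner_Integration.integral_sum Bochner_Integration.integrable_sum) blast
    also have "\<dots> = (\<Sum>j=1..m. \<Sum>k=1..m. \<integral>w. h (w j) * h (w k) \<partial>?P)"
      using * by (intro sum.cong refl Bochner_Integration.integral_sum) blast
    finally show ?thesis .
  qed
  also have "\<dots> = (\<Sum>j=1..m. \<Sum>k=1..m. if j = k then (\<integral>s. (h s)\<^sup>2 \<partial>S) else 0)"
    using * by (intro sum.cong) auto
  also have "\<dots> = real m * (\<integral>s. (h s)\<^sup>2 \<partial>S)"
    by simp
  finally show "(\<integral>w. (\<Sum>j=1..m. h (w j))\<^sup>2 \<partial>?P) = real m * (\<integral>s. (h s)\<^sup>2 \<partial>S)" .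
qed

lemma measurable_enorm:
  assumes "\<And>i. i < d \<Longrightarrow> (\<lambda>s. g s i) \<in> borel_measurable S"
  shows "(\<lambda>s. enorm d (g s)) \<in> borel_measurable S"
  unfolding enorm_def L2_set_def using assms by measurable

text \<open>Averaging divides the variance of each coordinate by \<open>m\<close>, and the variance
  is at most the second moment; Jensen then passes from the mean square to the mean norm. As
  \<open>bound\<close> is on a nonnegative integral, it also provides integrability.\<close>

lemma monte_carlo_error:
  fixes g :: "'s \<Rightarrow> vec"
  assumes S: "prob_space S" and m: "1 \<le> m" and B: "0 \<le> B"
    and g [measurable]: "\<And>i. i < d \<Longrightarrow> (\<lambda>s. g s i) \<in> borel_measurable S"
    and bound: "(\<integral>\<^sup>+s. ennreal ((enorm d (g s))\<^sup>2) \<partial>S) \<le> ennreal B"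
  shows "(\<integral>\<^sup>+w. ennreal (enorm d (\<lambda>i. 1 / real m * (\<Sum>j=1..m. g (w j) i) - (\<integral>s. g s i \<partial>S)))
    \<partial>PiM {1..m} (\<lambda>_. S)) \<le> ennreal (sqrt (B / real m))"
proof -
  interpret S: prob_space S by fact
  let ?P = "PiM {1..m} (\<lambda>_ :: nat. S)"
  interpret P: prob_space ?P
    by (intro prob_space_PiM S)
  have sq_norm: "integrable S (\<lambda>s. (enorm d (g s))\<^sup>2)"
    using bound measurable_enorm[of d g S] g
    by (intro integrableI_bounded) (auto intro: le_less_trans)
  have sq: "integrable S (\<lambda>s. (g s i)\<^sup>2)" if "i < d" for i
    by (rule Bochner_Integration.integrable_bound[OF sq_norm])
       (use that g in \<open>auto simp: enorm_sq sum_nonneg intro!: member_le_sum\<close>)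
  define c where "c i = (\<integral>s. g s i \<partial>S)" for i
  define h where "h i s = g s i - c i" for i s
  have h: "h i \<in> borel_measurable S" "integrable S (\<lambda>s. (h i s)\<^sup>2)" "(\<integral>s. h i s \<partial>S) = 0"
    "(\<integral>s. (h i s)\<^sup>2 \<partial>S) \<le> (\<integral>s. (g s i)\<^sup>2 \<partial>S)" if i: "i < d" for i
  proof -
    note sl = S.square_le_integral_square[OF sq[OF i] g[OF i], folded c_def]
    show "h i \<in> borel_measurable S"
      unfolding h_def using g[OF i] by measurable
    show "integrable S (\<lambda>s. (h i s)\<^sup>2)"
      unfolding h_def power2_diff using sq[OF i] sl(1) by auto
    show "(\<integral>s. h i s \<partial>S) = 0"
      unfolding h_def using sl(1) by (simp add: c_def S.prob_space)
    show "(\<integral>s. (h i s)\<^sup>2 \<partial>S) \<le> (\<integral>s. (g s i)\<^sup>2 \<partial>S)"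
      unfolding h_def by (rule sl(3))
  qed
  define E where "E w = enorm d (\<lambda>i. 1 / real m * (\<Sum>j=1..m. g (w j) i) - c i)" for w
  have E_sq: "(E w)\<^sup>2 = (\<Sum>i<d. (1 / real m)\<^sup>2 * (\<Sum>j=1..m. h i (w j))\<^sup>2)" for w
  proof -
    have "1 / real m * (\<Sum>j=1..m. g (w j) i) - c i = 1 / real m * (\<Sum>j=1..m. h i (w j))" for i
      using m by (simp add: h_def sum_subtractf field_simps)
    then show ?thesis
      unfolding E_def enorm_sq by (simp only: power_mult_distrib)
  qed
  have E0: "0 \<le> E w" for w
    by (simp add: E_def)
  have E_meas: "E \<in> borel_measurable ?P"
    unfolding E_def using g by (intro measurable_enorm) measurable
  have E_int: "integrable ?P (\<lambda>w. (E w)\<^sup>2)"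
    unfolding E_sq using h integral_square_sum_centered(1)[OF S]
    by (intro Bochner_Integration.integrable_sum integrable_mult_right) auto
  have "(\<integral>w. (E w)\<^sup>2 \<partial>?P) = (\<Sum>i<d. (1 / real m)\<^sup>2 * (\<integral>w. (\<Sum>j=1..m. h i (w j))\<^sup>2 \<partial>?P))"
    unfolding E_sq using h integral_square_sum_centered(1)[OF S]
    by (subst Bochner_Integration.integral_sum) auto
  also have "\<dots> = (\<Sum>i<d. (1 / real m)\<^sup>2 * (real m * (\<integral>s. (h i s)\<^sup>2 \<partial>S)))"
    using h integral_square_sum_centered(2)[OF S] by (intro sum.cong) auto
  also have "\<dots> \<le> (\<Sum>i<d. (1 / real m)\<^sup>2 * (real m * (\<integral>s. (g s i)\<^sup>2 \<partial>S)))"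
    using h by (intro sum_mono mult_left_mono) auto
  also have "\<dots> = 1 / real m * (\<integral>s. (enorm d (g s))\<^sup>2 \<partial>S)"
    unfolding enorm_sq using sq m
    by (subst Bochner_Integration.integral_sum) (auto simp: sum_distrib_left power2_eq_square)
  also have "\<dots> \<le> 1 / real m * B"
  proof (intro mult_left_mono)
    have "ennreal (\<integral>s. (enorm d (g s))\<^sup>2 \<partial>S) \<le> ennreal B"
      using bound sq_norm by (subst (asm) nn_integral_eq_integral) auto
    then show "(\<integral>s. (enorm d (g s))\<^sup>2 \<partial>S) \<le> B"
      using B by simp
  qed auto
  finally have "(\<integral>w. E w \<partial>?P)\<^sup>2 \<le> B / real m"
    using P.square_le_integral_square(2)[OF E_int E_meas] by simp
  then have "(\<integral>w. E w \<partial>?P) \<le> sqrt (B / real m)"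
    by (rule real_le_rsqrt)
  moreover have "(\<integral>\<^sup>+w. ennreal (E w) \<partial>?P) = ennreal (\<integral>w. E w \<partial>?P)"
    using P.square_le_integral_square(1)[OF E_int E_meas] by (intro nn_integral_eq_integral) (simp_all add: E0)
  ultimately show ?thesis
    unfolding E_def c_def by (simp add: ennreal_leI)
qed

section \<open>Errors of the gradient estimators\<close>

text \<open>Moving by \<open>r\<close> along the gradient changes \<open>h\<close> at rate
  \<open>r * enorm d g\<close>, and the Lipschitz bound allows at most
  \<open>\<bar>c\<bar> * r\<close>. The ball around \<open>z\<close> keeps that segment in
  \<open>S\<close>, where \<open>h\<close> is known to be Lipschitz.\<close>

lemma lipschitz_gradient_norm_le:
  assumes S: "convex_set S" "S \<subseteq> A" "A \<subseteq> Rn d" and lip: "lipschitz_fun_on d c S h"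
    and g: "has_gradient d A h g z" and z: "z \<in> S"
    and r: "0 < r" "\<And>q. q \<in> Rn d \<Longrightarrow> enorm d (z - q) \<le> r \<Longrightarrow> q \<in> S"
  shows "enorm d g \<le> \<bar>c\<bar>"
proof (cases "enorm d g = 0")
  case False
  then have N: "0 < enorm d g"
    by (simp add: less_le)
  define v where "v = (\<lambda>i. r / enorm d g * g i)"
  define q where "q = (\<lambda>i. z i + v i)"
  have qz: "q - z = v"
    by (simp add: q_def fun_eq_iff)
  have v: "enorm d v = r"
    unfolding v_def enorm_scale using r(1) N by simp
  have gR: "g \<in> Rn d"
    using g by (simp add: has_gradient_def)
  then have "q \<in> Rn d"
    using z S by (auto simp: q_def v_def mem_Rn subset_iff)
  then have q: "q \<in> S"
    using r(2) v qz enorm_minus_commute[of d z q] by simp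
  let ?c = "\<lambda>k. conv_comb k z q"
  have "((\<lambda>k. h (?c k)) has_real_derivative einner d g (q - z)) (at 0 within {0..1})"
    using g S z q conv_comb_mem[OF S(1) z q] by (intro has_gradient_derivative[where A = A]) auto
  then have lim: "((\<lambda>k. (h (?c k) - h z) / k) \<longlongrightarrow> einner d g (q - z)) (at_right 0)"
    by (simp add: has_field_derivative_iff at_within_Icc_at_right)
  have "\<forall>\<^sub>F k in at_right 0. (h (?c k) - h z) / k \<le> \<bar>c\<bar> * r"
    using eventually_at_right_less[of 0] eventually_at_right_real[of 0 1, simplified]
  proof eventually_elim
    case (elim k)
    then have "\<bar>h (?c k) - h z\<bar> \<le> c * enorm d (?c k - z)"
      using lip conv_comb_mem[OF S(1) z q, of k] z unfolding lipschitz_fun_on_def by auto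
    also have "\<dots> \<le> \<bar>c\<bar> * enorm d (?c k - z)"
      by (intro mult_right_mono) auto
    also have "\<dots> = \<bar>c\<bar> * r * k"
      using enorm_conv_comb_diff[of d k z q 0] elim qz v by simp
    finally show ?case
      using elim by (simp add: pos_divide_le_eq)
  qed
  from tendsto_upperbound[OF lim this] have "einner d g (q - z) \<le> \<bar>c\<bar> * r"
    by simp
  moreover have "einner d g (q - z) = r * enorm d g"
    unfolding qz v_def einner_scale_right enorm_sq_einner[symmetric] using N by (simp add: power2_eq_square)
  ultimately show ?thesis
    using r(1) by (simp add: mult.commute)
qed simp

text \<open>The Lipschitz constant bounds the gradient at the inner point \<open>z\<close>, the
  Lipschitz gradient its change from there. The bound holds up to the border and does not depend on
  \<open>r\<close>.\<close>

lemma lipschitz_gradient_norm_le_diameter: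
  assumes S: "convex_set S" "S \<subseteq> A" "A \<subseteq> Rn d" and lip: "lipschitz_fun_on d c S h" and c: "0 \<le> c" "0 \<le> L"
    and G: "has_gradient d A h (G z) z" "lipschitz_map_on d d L A G" and z: "z \<in> S"
    and r: "0 < r" "\<And>q. q \<in> Rn d \<Longrightarrow> enorm d (z - q) \<le> r \<Longrightarrow> q \<in> S"
    and x: "x \<in> S" "enorm d (x - z) \<le> D"
  shows "enorm d (G x) \<le> c + L * D"
proof -
  have "enorm d (G z) \<le> c"
    using lipschitz_gradient_norm_le[OF S lip G(1) z r] c by simp
  moreover have "enorm d (G x - G z) \<le> L * enorm d (x - z)"
    using G(2) x z S(2) unfolding lipschitz_map_on_def by blast
  moreover have "\<dots> \<le> L * D"
    using c x by (intro mult_left_mono)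
  ultimately show ?thesis
    using enorm_triangle_diff[of d "G x" "\<lambda>i. 0" "G z"] by (simp add: fun_diff_def)
qed

lemma fo_estimator_error:
  assumes S: "prob_space S" and m: "1 \<le> m" and B: "0 \<le> B"
    and G [measurable]: "\<And>i. i < d \<Longrightarrow> (\<lambda>s. G s i) \<in> borel_measurable S"
    and bound: "AE s in S. enorm d (G s) \<le> B"
  shows "(\<integral>\<^sup>+w. ennreal (enorm d (fo_estimator m G w - (\<lambda>i. \<integral>s. G s i \<partial>S))) \<partial>PiM {1..m} (\<lambda>_. S))
    \<le> ennreal (B / sqrt (real m))"
proof -
  interpret S: prob_space S by fact
  have "(\<integral>\<^sup>+s. ennreal ((enorm d (G s))\<^sup>2) \<partial>S) \<le> (\<integral>\<^sup>+s. ennreal (B\<^sup>2) \<partial>S)"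
    using bound by (intro nn_integral_mono_AE) (auto intro!: ennreal_leI power_mono)
  then have "(\<integral>\<^sup>+s. ennreal ((enorm d (G s))\<^sup>2) \<partial>S) \<le> ennreal (B\<^sup>2)"
    by (simp add: S.emeasure_space_1)
  from monte_carlo_error[OF S m _ G this] show ?thesis
    using B by (simp add: fo_estimator_def fun_diff_def real_sqrt_divide)
qed

lemma measurable_shift:
  assumes [measurable]: "(\<lambda>(a, s). h a s) \<in> borel_measurable (borel \<Otimes>\<^sub>M S)"
  shows "(\<lambda>p. h (\<lambda>k. z k + \<nu> * snd p k) (fst p)) \<in> borel_measurable (S \<Otimes>\<^sub>M std_gauss d)"
proof -
  have [measurable]: "(\<lambda>p. (\<lambda>k. z k + \<nu> * snd p k)) \<in> (S \<Otimes>\<^sub>M std_gauss d) \<rightarrow>\<^sub>M (borel :: vec measure)"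
    by (rule measurable_vecI) measurable
  have "(\<lambda>p. ((\<lambda>k. z k + \<nu> * snd p k), fst p)) \<in> (S \<Otimes>\<^sub>M std_gauss d) \<rightarrow>\<^sub>M (borel \<Otimes>\<^sub>M S)"
    by measurable
  from measurable_compose[OF this assms] show ?thesis
    by simp
qed

text \<open>Each summand splits into the linear part \<open>A\<close>, an unbiased sample with
  second moment at most \<open>3 * real d * B\<^sup>2\<close>, and a Taylor remainder
  \<open>R\<close> times \<open>u\<close>. Averaging improves the bound for \<open>A\<close> only;
  that for the remainder is the same for every batch size and is made small by
  \<open>\<nu>\<close>.\<close>

lemma zo_estimator_error:
  fixes h :: "vec \<Rightarrow> 's \<Rightarrow> real"
  assumes S: "prob_space S" and m: "1 \<le> m" and d: "1 \<le> d" and B: "0 \<le> B" and LG: "0 \<le> LG" and \<nu>: "0 < \<nu>"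
    and G [measurable]: "\<And>i. i < d \<Longrightarrow> (\<lambda>s. G s i) \<in> borel_measurable S"
    and h [measurable]: "(\<lambda>(a, s). h a s) \<in> borel_measurable (borel \<Otimes>\<^sub>M S)"
    and bound: "AE s in S. enorm d (G s) \<le> B \<and>
      (\<forall>v\<in>Rn d. \<bar>h (\<lambda>k. z k + v k) s - h z s - einner d (G s) v\<bar> \<le> LG / 2 * (enorm d v)\<^sup>2)"
  shows "(\<integral>\<^sup>+w. ennreal (enorm d (zo_estimator m \<nu> h z w - (\<lambda>i. \<integral>s. G s i \<partial>S)))
      \<partial>PiM {1..m} (\<lambda>_. S \<Otimes>\<^sub>M std_gauss d))
    \<le> ennreal (sqrt (3 * real d * B\<^sup>2 / real m) + LG * \<nu> * (real d * sqrt (real d)))"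
proof -
  interpret S: prob_space S by fact
  interpret U: prob_space "std_gauss d"
    by (rule prob_space_std_gauss)
  interpret SU: pair_prob_space S "std_gauss d" ..
  let ?Q = "S \<Otimes>\<^sub>M std_gauss d"
  let ?P = "PiM {1..m} (\<lambda>_ :: nat. ?Q)"
  have Q: "prob_space ?Q"
    by (rule SU.prob_space_axioms)
  define A where "A p i = einner d (G (fst p)) (snd p) * snd p i" for p :: "'s \<times> vec" and i
  define R where "R p = (h (\<lambda>k. z k + \<nu> * snd p k) (fst p) - h z (fst p)) / \<nu> - einner d (G (fst p)) (snd p)"
    for p :: "'s \<times> vec"
  have [measurable]: "(\<lambda>s. h z s) \<in> borel_measurable S"
    using measurable_compose[OF measurable_Pair1' h, of z] by simp
  have [measurable]: "(\<lambda>p. h (\<lambda>k. z k + \<nu> * snd p k) (fst p)) \<in> borel_measurable ?Q"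
    using h by (rule measurable_shift)
  have [measurable]: "(\<lambda>p. einner d (G (fst p)) (snd p)) \<in> borel_measurable ?Q"
    unfolding einner_def by measurable
  have [measurable]: "R \<in> borel_measurable ?Q"
    unfolding R_def by measurable
  have [measurable]: "(\<lambda>p. enorm d (snd p)) \<in> borel_measurable ?Q"
    by (rule measurable_enorm) measurable
  have A_meas [measurable]: "(\<lambda>p. A p i) \<in> borel_measurable ?Q" for i
    unfolding A_def by measurable
  have A_norm: "(enorm d (A p))\<^sup>2 = (einner d (G (fst p)) (snd p))\<^sup>2 * (enorm d (snd p))\<^sup>2" for p
    unfolding A_def enorm_sq by (simp add: power_mult_distrib sum_distrib_left)
  have "(\<integral>\<^sup>+p. ennreal ((enorm d (A p))\<^sup>2) \<partial>?Q) =
      (\<integral>\<^sup>+s. \<integral>\<^sup>+u. ennreal ((einner d (G s) u)\<^sup>2 * (enorm d u)\<^sup>2) \<partial>std_gauss d \<partial>S)"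
    unfolding A_norm by (subst U.nn_integral_fst[symmetric]) simp_all
  also have "\<dots> \<le> (\<integral>\<^sup>+s. ennreal (3 * real d * B\<^sup>2) \<partial>S)"
  proof (rule nn_integral_mono_AE)
    show "AE s in S. (\<integral>\<^sup>+u. ennreal ((einner d (G s) u)\<^sup>2 * (enorm d u)\<^sup>2) \<partial>std_gauss d) \<le> ennreal (3 * real d * B\<^sup>2)"
      using bound
    proof eventually_elim
      case (elim s)
      have "(\<integral>\<^sup>+u. ennreal ((einner d (G s) u)\<^sup>2 * (enorm d u)\<^sup>2) \<partial>std_gauss d) =
          ennreal (\<integral>u. (einner d (G s) u)\<^sup>2 * (enorm d u)\<^sup>2 \<partial>std_gauss d)"
        by (intro nn_integral_eq_integral std_gauss_projection_norm) auto
      also have "\<dots> \<le> ennreal (3 * real d * B\<^sup>2)"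
        using elim
        by (intro ennreal_leI order_trans[OF std_gauss_projection_norm(2)] mult_left_mono power_mono) auto
      finally show ?case .
    qed
  qed
  finally have A2: "(\<integral>\<^sup>+p. ennreal ((enorm d (A p))\<^sup>2) \<partial>?Q) \<le> ennreal (3 * real d * B\<^sup>2)"
    by (simp add: S.emeasure_space_1)
  have A_mean: "(\<integral>p. A p i \<partial>?Q) = (\<integral>s. G s i \<partial>S)" if i: "i < d" for i
  proof -
    \<comment> \<open>Square integrability comes first, because Fubini asks for an integrable
      \<open>A\<close>.\<close>
    have "(\<integral>\<^sup>+p. ennreal (norm ((A p i)\<^sup>2)) \<partial>?Q) \<le> (\<integral>\<^sup>+p. ennreal ((enorm d (A p))\<^sup>2) \<partial>?Q)"
      using i unfolding enorm_sq by (intro nn_integral_mono ennreal_leI) (auto intro!: member_le_sum)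
    also have "\<dots> < \<infinity>"
      using A2 by (rule le_less_trans) simp
    finally have "integrable ?Q (\<lambda>p. (A p i)\<^sup>2)"
      by (intro integrableI_bounded) measurable
    then have int: "integrable ?Q (\<lambda>p. A p i)"
      by (rule SU.square_le_integral_square(1)) measurable
    have "(\<integral>p. A p i \<partial>?Q) = (\<integral>s. \<integral>u. A (s, u) i \<partial>std_gauss d \<partial>S)"
      using SU.integral_fst'[OF int] by simp
    also have "\<dots> = (\<integral>s. G s i \<partial>S)"
      using std_gauss_projection[OF i] by (simp add: A_def)
    finally show ?thesis .
  qed
  define E where "E w = enorm d (\<lambda>i. 1 / real m * (\<Sum>j=1..m. A (w j) i) - (\<integral>p. A p i \<partial>?Q))" for w
  define r where "r p = \<bar>R p\<bar> * enorm d (snd p)" for p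
  have r0: "0 \<le> r p" for p
    by (simp add: r_def)
  have r_meas [measurable]: "r \<in> borel_measurable ?Q"
    unfolding r_def by measurable
  have E_meas [measurable]: "E \<in> borel_measurable ?P"
    unfolding E_def by (rule measurable_enorm) measurable
  have E_bound: "(\<integral>\<^sup>+w. ennreal (E w) \<partial>?P) \<le> ennreal (sqrt (3 * real d * B\<^sup>2 / real m))"
    unfolding E_def using monte_carlo_error[OF Q m _ A_meas A2] by simp
  have split: "enorm d (zo_estimator m \<nu> h z w - (\<lambda>i. \<integral>s. G s i \<partial>S)) \<le>
      E w + 1 / real m * (\<Sum>j=1..m. r (w j))" for w
  proof -
    have "enorm d (zo_estimator m \<nu> h z w - (\<lambda>i. \<integral>s. G s i \<partial>S)) =
        enorm d (\<lambda>i. (1 / real m * (\<Sum>j=1..m. A (w j) i) - (\<integral>p. A p i \<partial>?Q)) +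
          1 / real m * (\<Sum>j=1..m. R (w j) * snd (w j) i))"
    proof (rule enorm_cong)
      fix i assume "i < d"
      have "(\<Sum>j=1..m. (h (\<lambda>k. z k + \<nu> * snd (w j) k) (fst (w j)) - h z (fst (w j))) / \<nu> * snd (w j) i) =
          (\<Sum>j=1..m. A (w j) i) + (\<Sum>j=1..m. R (w j) * snd (w j) i)"
        unfolding sum.distrib[symmetric] A_def R_def by (intro sum.cong) (auto simp: algebra_simps)
      then show "(zo_estimator m \<nu> h z w - (\<lambda>i. \<integral>s. G s i \<partial>S)) i =
          (1 / real m * (\<Sum>j=1..m. A (w j) i) - (\<integral>p. A p i \<partial>?Q)) +
          1 / real m * (\<Sum>j=1..m. R (w j) * snd (w j) i)"
        using A_mean[OF \<open>i < d\<close>] by (simp add: zo_estimator_def add_divide_distrib)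
    qed
    also have "\<dots> \<le> E w + enorm d (\<lambda>i. 1 / real m * (\<Sum>j=1..m. R (w j) * snd (w j) i))"
      unfolding E_def by (rule enorm_triangle)
    also have "enorm d (\<lambda>i. 1 / real m * (\<Sum>j=1..m. R (w j) * snd (w j) i)) =
        1 / real m * enorm d (\<lambda>i. \<Sum>j=1..m. R (w j) * snd (w j) i)"
      unfolding enorm_scale by simp
    also have "enorm d (\<lambda>i. \<Sum>j=1..n. R (w j) * snd (w j) i) \<le> (\<Sum>j=1..n. r (w j))" for n
    proof (induction n)
      case (Suc n)
      have "enorm d (\<lambda>i. \<Sum>j=1..Suc n. R (w j) * snd (w j) i) \<le>
          enorm d (\<lambda>i. \<Sum>j=1..n. R (w j) * snd (w j) i) + enorm d (\<lambda>i. R (w (Suc n)) * snd (w (Suc n)) i)"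
        using enorm_triangle[of d "\<lambda>i. \<Sum>j=1..n. R (w j) * snd (w j) i"] by simp
      then show ?case
        using Suc by (simp add: enorm_scale r_def)
    qed simp
    finally show ?thesis
      by (simp add: mult_left_mono divide_right_mono fun_diff_def)
  qed
  have r_bound: "(\<integral>\<^sup>+p. ennreal (r p) \<partial>?Q) \<le> ennreal (LG * \<nu> * (real d * sqrt (real d)))"
  proof -
    have "(\<integral>\<^sup>+p. ennreal (r p) \<partial>?Q) = (\<integral>\<^sup>+s. \<integral>\<^sup>+u. ennreal (r (s, u)) \<partial>std_gauss d \<partial>S)"
      by (rule U.nn_integral_fst[symmetric]) measurable
    also have "\<dots> \<le> (\<integral>\<^sup>+s. ennreal (LG * \<nu> * (real d * sqrt (real d))) \<partial>S)"
    proof (rule nn_integral_mono_AE)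
      show "AE s in S. (\<integral>\<^sup>+u. ennreal (r (s, u)) \<partial>std_gauss d) \<le> ennreal (LG * \<nu> * (real d * sqrt (real d)))"
        using bound
      proof eventually_elim
        case (elim s)
        \<comment> \<open>The quadratic remainder of the increment \<open>\<nu> * u\<close> is
          divided by \<open>\<nu>\<close> once and multiplied by \<open>u\<close>; one factor
          \<open>\<nu>\<close> and the cube of the norm are left.\<close>
        have *: "r (s, u) \<le> LG / 2 * \<nu> * enorm d u ^ 3" if "u \<in> Rn d" for u
        proof -
          have mem: "(\<lambda>k. \<nu> * u k) \<in> Rn d"
            using that by (simp add: mem_Rn)
          have "\<bar>h (\<lambda>k. z k + \<nu> * u k) s - h z s - einner d (G s) (\<lambda>k. \<nu> * u k)\<bar>
              \<le> LG / 2 * (enorm d (\<lambda>k. \<nu> * u k))\<^sup>2"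
            using bspec[OF conjunct2[OF elim] mem] .
          then have 1: "\<bar>h (\<lambda>k. z k + \<nu> * u k) s - h z s - \<nu> * einner d (G s) u\<bar>
              \<le> LG / 2 * \<nu>\<^sup>2 * (enorm d u)\<^sup>2"
            unfolding einner_scale_right enorm_scale by (simp add: power_mult_distrib mult.assoc)
          have "R (s, u) = (h (\<lambda>k. z k + \<nu> * u k) s - h z s - \<nu> * einner d (G s) u) / \<nu>"
            using \<nu> by (simp add: R_def diff_divide_distrib)
          then have "\<bar>R (s, u)\<bar> = \<bar>h (\<lambda>k. z k + \<nu> * u k) s - h z s - \<nu> * einner d (G s) u\<bar> / \<nu>"
            using \<nu> by simp
          also have "\<dots> \<le> LG / 2 * \<nu>\<^sup>2 * (enorm d u)\<^sup>2 / \<nu>"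
            using 1 \<nu> by (intro divide_right_mono) auto
          also have "\<dots> = LG / 2 * \<nu> * (enorm d u)\<^sup>2"
            using \<nu> by (simp add: power2_eq_square)
          finally have "\<bar>R (s, u)\<bar> * enorm d u \<le> LG / 2 * \<nu> * (enorm d u)\<^sup>2 * enorm d u"
            by (rule mult_right_mono) simp
          then show ?thesis
            by (simp add: r_def power2_eq_square power3_eq_cube mult.assoc)
        qed
        have "(\<integral>\<^sup>+u. ennreal (r (s, u)) \<partial>std_gauss d) \<le> (\<integral>\<^sup>+u. ennreal (LG / 2 * \<nu> * enorm d u ^ 3) \<partial>std_gauss d)"
          by (intro nn_integral_mono_AE eventually_mono[OF AE_std_gauss_Rn] ennreal_leI *)
        also have "\<dots> = ennreal (LG / 2 * \<nu> * (\<integral>u. enorm d u ^ 3 \<partial>std_gauss d))"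
          using std_gauss_norm_cubed(1)[OF d] LG \<nu> by (subst nn_integral_eq_integral) auto
        also have "\<dots> \<le> ennreal (LG / 2 * \<nu> * (2 * real d * sqrt (real d)))"
          using LG \<nu> by (intro ennreal_leI mult_left_mono std_gauss_norm_cubed(2)[OF d]) auto
        finally show ?case
          by (simp add: mult.assoc)
      qed
    qed
    finally show ?thesis
      by (simp add: S.emeasure_space_1)
  qed
  have r_component: "(\<integral>\<^sup>+w. ennreal (r (w j)) \<partial>?P) = (\<integral>\<^sup>+p. ennreal (r p) \<partial>?Q)" if j: "j \<in> {1..m}" for j
  proof -
    have "(\<integral>\<^sup>+p. ennreal (r p) \<partial>distr ?P ?Q (\<lambda>w. w j)) = (\<integral>\<^sup>+w. ennreal (r (w j)) \<partial>?P)"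
      using j by (intro nn_integral_distr) (auto intro: measurable_component_singleton)
    then show ?thesis
      using distr_PiM_component[of "{1..m}" "\<lambda>_. ?Q" j] j Q by simp
  qed
  have "(\<integral>\<^sup>+w. ennreal (enorm d (zo_estimator m \<nu> h z w - (\<lambda>i. \<integral>s. G s i \<partial>S))) \<partial>?P) \<le>
      (\<integral>\<^sup>+w. ennreal (E w) + ennreal (1 / real m) * (\<Sum>j=1..m. ennreal (r (w j))) \<partial>?P)"
  proof (rule nn_integral_mono)
    fix w
    have "ennreal (E w) + ennreal (1 / real m) * (\<Sum>j=1..m. ennreal (r (w j))) =
        ennreal (E w + 1 / real m * (\<Sum>j=1..m. r (w j)))"
      using r0 by (simp add: ennreal_plus[symmetric] ennreal_mult'[symmetric] sum_nonneg E_def del: ennreal_plus)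
    then show "ennreal (enorm d (zo_estimator m \<nu> h z w - (\<lambda>i. \<integral>s. G s i \<partial>S))) \<le>
        ennreal (E w) + ennreal (1 / real m) * (\<Sum>j=1..m. ennreal (r (w j)))"
      using split[of w] by (simp add: ennreal_leI)
  qed
  also have "\<dots> = (\<integral>\<^sup>+w. ennreal (E w) \<partial>?P) + ennreal (1 / real m) * (\<Sum>j=1..m. \<integral>\<^sup>+w. ennreal (r (w j)) \<partial>?P)"
  proof -
    have rj: "(\<lambda>w. ennreal (r (w j))) \<in> borel_measurable ?P" if "j \<in> {1..m}" for j
      using that by measurable
    have "(\<integral>\<^sup>+w. ennreal (E w) + ennreal (1 / real m) * (\<Sum>j=1..m. ennreal (r (w j))) \<partial>?P) =
        (\<integral>\<^sup>+w. ennreal (E w) \<partial>?P) + (\<integral>\<^sup>+w. ennreal (1 / real m) * (\<Sum>j=1..m. ennreal (r (w j))) \<partial>?P)"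
      by (rule nn_integral_add) (use rj in measurable)
    also have "(\<integral>\<^sup>+w. ennreal (1 / real m) * (\<Sum>j=1..m. ennreal (r (w j))) \<partial>?P) =
        ennreal (1 / real m) * (\<integral>\<^sup>+w. (\<Sum>j=1..m. ennreal (r (w j))) \<partial>?P)"
      by (rule nn_integral_cmult) (use rj in measurable)
    also have "(\<integral>\<^sup>+w. (\<Sum>j=1..m. ennreal (r (w j))) \<partial>?P) = (\<Sum>j=1..m. \<integral>\<^sup>+w. ennreal (r (w j)) \<partial>?P)"
      by (rule nn_integral_sum) (rule rj)
    finally show ?thesis .
  qed
  also have "\<dots> = (\<integral>\<^sup>+w. ennreal (E w) \<partial>?P) + ennreal (1 / real m) * (of_nat m * (\<integral>\<^sup>+p. ennreal (r p) \<partial>?Q))"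
    using r_component by simp
  also have "\<dots> = (\<integral>\<^sup>+w. ennreal (E w) \<partial>?P) + (\<integral>\<^sup>+p. ennreal (r p) \<partial>?Q)"
  proof -
    have "ennreal (1 / real m) * of_nat m = 1"
      using m by (simp add: ennreal_of_nat_eq_real_of_nat ennreal_mult[symmetric])
    then show ?thesis
      by (simp add: mult.assoc[symmetric])
  qed
  also have "\<dots> \<le> ennreal (sqrt (3 * real d * B\<^sup>2 / real m)) + ennreal (LG * \<nu> * (real d * sqrt (real d)))"
    by (intro add_mono E_bound r_bound)
  also have "\<dots> = ennreal (sqrt (3 * real d * B\<^sup>2 / real m) + LG * \<nu> * (real d * sqrt (real d)))"
    using LG \<nu> by (intro ennreal_plus[symmetric]) auto
  finally show ?thesis .
qed

section \<open>Fresh samples\<close>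

lemma (in prob_space) distr_pair_snd:
  assumes "prob_space N"
  shows "distr (M \<Otimes>\<^sub>M N) N snd = N"
proof (intro measure_eqI)
  interpret N: prob_space N by fact
  fix A assume A: "A \<in> sets (distr (M \<Otimes>\<^sub>M N) N snd)"
  then have "emeasure (distr (M \<Otimes>\<^sub>M N) N snd) A = emeasure (M \<Otimes>\<^sub>M N) (space M \<times> A)"
    by (auto simp: emeasure_distr space_pair_measure dest: sets.sets_into_space intro!: arg_cong2[where f = emeasure])
  with A show "emeasure (distr (M \<Otimes>\<^sub>M N) N snd) A = emeasure N A"
    by (simp add: N.emeasure_pair_measure_Times emeasure_space_1)
qed simp

lemma (in prob_space) fresh_noise_compose:
  assumes fresh: "fresh_noise M z S N" and f [measurable]: "f \<in> S \<rightarrow>\<^sub>M P" and P: "distr S P f = P"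
  shows "fresh_noise M z P (\<lambda>\<omega>. f (N \<omega>))"
proof -
  have z [measurable]: "z \<in> borel_measurable M" and N [measurable]: "N \<in> M \<rightarrow>\<^sub>M S"
    and ind: "indep_set {z -` A \<inter> space M |A. A \<in> sets borel} {N -` C \<inter> space M |C. C \<in> sets S}"
    and d: "distr M S N = S"
    using fresh by (auto simp: fresh_noise_def)
  have "distr M P (\<lambda>\<omega>. f (N \<omega>)) = distr (distr M S N) P f"
    by (subst distr_distr) (auto simp: comp_def)
  then have "distr M P (\<lambda>\<omega>. f (N \<omega>)) = P"
    by (simp add: d P)
  moreover have "indep_set {z -` A \<inter> space M |A. A \<in> sets borel} {(\<lambda>\<omega>. f (N \<omega>)) -` C \<inter> space M |C. C \<in> sets P}"
  proof (rule indep_setI)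
    show "{(\<lambda>\<omega>. f (N \<omega>)) -` C \<inter> space M |C. C \<in> sets P} \<subseteq> events"
      by (auto intro!: measurable_sets[of _ M P])
    fix a b
    assume a: "a \<in> {z -` A \<inter> space M |A. A \<in> sets borel}"
      and "b \<in> {(\<lambda>\<omega>. f (N \<omega>)) -` C \<inter> space M |C. C \<in> sets P}"
    then obtain C where C: "C \<in> sets P" "b = (\<lambda>\<omega>. f (N \<omega>)) -` C \<inter> space M"
      by blast
    then have "b = N -` (f -` C \<inter> space S) \<inter> space M"
      using measurable_space[OF N] by auto
    then have "b \<in> {N -` C \<inter> space M |C. C \<in> sets S}"
      using measurable_sets[OF f C(1)] by blast
    then show "prob (a \<inter> b) = prob a * prob b"
      using indep_setD[OF ind a] by blast
  qed (auto intro: measurable_sets)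
  ultimately show ?thesis
    by (simp add: fresh_noise_def)
qed

text \<open>In the zeroth-order method both batches are drawn jointly. Each error depends on one of
  them, so freshness is passed to the projections.\<close>

lemma (in prob_space) fresh_noise_pair:
  assumes fresh: "fresh_noise M z (P \<Otimes>\<^sub>M Q) (\<lambda>\<omega>. (NX \<omega>, NY \<omega>))" and P: "prob_space P" and Q: "prob_space Q"
  shows "fresh_noise M z P NX" "fresh_noise M z Q NY"
  using fresh_noise_compose[OF fresh measurable_fst prob_space.distr_pair_fst[OF Q]]
    fresh_noise_compose[OF fresh measurable_snd prob_space.distr_pair_snd[OF P Q]] by simp_all

text \<open>Independence of the preimages is the product formula on rectangles, and these determine
  the product measure.\<close>

lemma (in prob_space) fresh_noise_joint:
  assumes fresh: "fresh_noise M z S N"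
  shows "distr M (borel \<Otimes>\<^sub>M S) (\<lambda>\<omega>. (z \<omega>, N \<omega>)) = distr M borel z \<Otimes>\<^sub>M S"
proof -
  have z [measurable]: "z \<in> borel_measurable M" and N [measurable]: "N \<in> M \<rightarrow>\<^sub>M S"
    and ind: "indep_set {z -` A \<inter> space M |A. A \<in> sets borel} {N -` C \<inter> space M |C. C \<in> sets S}"
    and d: "distr M S N = S"
    using fresh by (auto simp: fresh_noise_def)
  interpret S: prob_space S
    using prob_space_distr[OF N] by (simp add: d)
  interpret Z: prob_space "distr M borel z"
    by (rule prob_space_distr) measurable
  have "distr M borel z \<Otimes>\<^sub>M S = distr M (borel \<Otimes>\<^sub>M S) (\<lambda>\<omega>. (z \<omega>, N \<omega>))"
  proof (rule pair_measure_eqI)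
    fix A C assume A: "A \<in> sets (distr M borel z)" and C: "C \<in> sets S"
    have "emeasure (distr M borel z) A * emeasure S C = emeasure (distr M borel z) A * emeasure (distr M S N) C"
      by (simp add: d)
    also have "\<dots> = ennreal (prob (z -` A \<inter> space M) * prob (N -` C \<inter> space M))"
      using A C by (simp add: emeasure_distr emeasure_eq_measure ennreal_mult)
    also have "\<dots> = ennreal (prob ((z -` A \<inter> space M) \<inter> (N -` C \<inter> space M)))"
    proof -
      have a: "z -` A \<inter> space M \<in> {z -` A \<inter> space M |A. A \<in> sets borel}"
        using A unfolding sets_distr by blast
      have c: "N -` C \<inter> space M \<in> {N -` C \<inter> space M |C. C \<in> sets S}"
        using C by blast
      show ?thesis
        by (simp only: indep_setD[OF ind a c])
    qed
    also have "(z -` A \<inter> space M) \<inter> (N -` C \<inter> space M) = (\<lambda>\<omega>. (z \<omega>, N \<omega>)) -` (A \<times> C) \<inter> space M"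
      by auto
    also have "ennreal (prob \<dots>) = emeasure (distr M (borel \<Otimes>\<^sub>M S) (\<lambda>\<omega>. (z \<omega>, N \<omega>))) (A \<times> C)"
    proof -
      have "A \<times> C \<in> sets (borel \<Otimes>\<^sub>M S)"
        using A C unfolding sets_distr by (rule pair_measureI)
      then show ?thesis
        by (subst emeasure_distr) (simp_all add: emeasure_eq_measure)
    qed
    finally show "emeasure (distr M borel z) A * emeasure S C =
        emeasure (distr M (borel \<Otimes>\<^sub>M S) (\<lambda>\<omega>. (z \<omega>, N \<omega>))) (A \<times> C)" .
  next
    show "sets (distr M borel z \<Otimes>\<^sub>M S) = sets (distr M (borel \<Otimes>\<^sub>M S) (\<lambda>\<omega>. (z \<omega>, N \<omega>)))"
      unfolding sets_distr by (rule sets_pair_measure_cong) simp_all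
  qed (simp_all add: Z.sigma_finite_measure_axioms S.sigma_finite_measure_axioms)
  then show ?thesis ..
qed

text \<open>Takes the place of conditioning on the iterate: the joint law is a product, the noise is
  integrated first, and the inner bound is uniform.\<close>

lemma (in prob_space) fresh_expectation_le:
  assumes fresh: "fresh_noise M z S N"
    and \<phi> [measurable]: "\<phi> \<in> borel_measurable (borel \<Otimes>\<^sub>M S)"
    and le: "\<And>\<omega>. \<omega> \<in> space M \<Longrightarrow> (\<integral>\<^sup>+n. \<phi> (z \<omega>, n) \<partial>S) \<le> \<kappa>"
  shows "(\<integral>\<^sup>+\<omega>. \<phi> (z \<omega>, N \<omega>) \<partial>M) \<le> \<kappa>"
proof -
  have z [measurable]: "z \<in> borel_measurable M" and N [measurable]: "N \<in> M \<rightarrow>\<^sub>M S"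
    using fresh by (auto simp: fresh_noise_def)
  interpret S: prob_space S
    using fresh prob_space_distr[OF N] by (simp add: fresh_noise_def)
  have "(\<integral>\<^sup>+\<omega>. \<phi> (z \<omega>, N \<omega>) \<partial>M) = (\<integral>\<^sup>+q. \<phi> q \<partial>distr M (borel \<Otimes>\<^sub>M S) (\<lambda>\<omega>. (z \<omega>, N \<omega>)))"
    by (subst nn_integral_distr) auto
  also have "distr M (borel \<Otimes>\<^sub>M S) (\<lambda>\<omega>. (z \<omega>, N \<omega>)) = distr M borel z \<Otimes>\<^sub>M S"
    using fresh by (rule fresh_noise_joint)
  also have "(\<integral>\<^sup>+q. \<phi> q \<partial>(distr M borel z \<Otimes>\<^sub>M S)) = (\<integral>\<^sup>+a. \<integral>\<^sup>+n. \<phi> (a, n) \<partial>S \<partial>distr M borel z)"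
    by (rule S.nn_integral_fst[symmetric]) simp
  \<comment> \<open>Pulled back to \<open>M\<close>, the inner bound is required only at attained
    values of \<open>z\<close>, which later are feasible iterates.\<close>
  also have "\<dots> = (\<integral>\<^sup>+\<omega>. \<integral>\<^sup>+n. \<phi> (z \<omega>, n) \<partial>S \<partial>M)"
    by (subst nn_integral_distr) auto
  also have "\<dots> \<le> (\<integral>\<^sup>+\<omega>. \<kappa> \<partial>M)"
    by (intro nn_integral_mono le)
  also have "\<dots> = \<kappa>"
    by (simp add: emeasure_space_1)
  finally show ?thesis .
qed

text \<open>Joint measurability of \<open>G\<close> in the point and the sample makes the error at a
  random point a random variable.\<close>

lemma (in prob_space) fresh_fo_error:
  fixes G :: "'z::topological_space \<Rightarrow> 'k \<Rightarrow> vec"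
  assumes fresh: "fresh_noise M z (PiM {1..m} (\<lambda>_. S)) N"
    and S: "prob_space S" and m: "1 \<le> m" and B: "0 \<le> B"
    and G: "\<And>i. i < d \<Longrightarrow> (\<lambda>(a, s). G a s i) \<in> borel_measurable (borel \<Otimes>\<^sub>M S)"
    and bound: "\<And>\<omega>. \<omega> \<in> space M \<Longrightarrow> AE s in S. enorm d (G (z \<omega>) s) \<le> B"
  defines "err \<equiv> (\<lambda>\<omega>. enorm d (fo_estimator m (G (z \<omega>)) (N \<omega>) - (\<lambda>i. \<integral>s. G (z \<omega>) s i \<partial>S)))"
  shows "err \<in> borel_measurable M" "(\<integral>\<^sup>+\<omega>. ennreal (err \<omega>) \<partial>M) \<le> ennreal (B / sqrt (real m))"
proof -
  interpret S: prob_space S by fact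
  let ?P = "PiM {1..m} (\<lambda>_. S)"
  define \<phi> where "\<phi> q = enorm d (fo_estimator m (G (fst q)) (snd q) - (\<lambda>i. \<integral>s. G (fst q) s i \<partial>S))" for q
  have \<phi> [measurable]: "\<phi> \<in> borel_measurable (borel \<Otimes>\<^sub>M ?P)"
    unfolding \<phi>_def
  proof (rule measurable_enorm)
    fix i assume i: "i < d"
    have [measurable]: "(\<lambda>a. \<integral>s. G a s i \<partial>S) \<in> borel_measurable borel"
      using G[OF i] by (rule S.borel_measurable_lebesgue_integral)
    have [measurable]: "(\<lambda>q. G (fst q) (snd q j) i) \<in> borel_measurable (borel \<Otimes>\<^sub>M ?P)" if j: "j \<in> {1..m}" for j
    proof -
      have "(\<lambda>q. (fst q, snd q j)) \<in> (borel \<Otimes>\<^sub>M ?P) \<rightarrow>\<^sub>M (borel \<Otimes>\<^sub>M S)"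
        using j by measurable
      from measurable_compose[OF this G[OF i]] show ?thesis
        by simp
    qed
    show "(\<lambda>q. (fo_estimator m (G (fst q)) (snd q) - (\<lambda>i. \<integral>s. G (fst q) s i \<partial>S)) i)
        \<in> borel_measurable (borel \<Otimes>\<^sub>M ?P)"
      unfolding fo_estimator_def fun_diff_def by measurable
  qed
  have [measurable]: "z \<in> borel_measurable M" "N \<in> M \<rightarrow>\<^sub>M ?P"
    using fresh by (auto simp: fresh_noise_def)
  have err: "err \<omega> = \<phi> (z \<omega>, N \<omega>)" for \<omega>
    by (simp add: err_def \<phi>_def)
  show "err \<in> borel_measurable M"
    unfolding err by measurable
  show "(\<integral>\<^sup>+\<omega>. ennreal (err \<omega>) \<partial>M) \<le> ennreal (B / sqrt (real m))"
    unfolding err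
  proof (rule fresh_expectation_le[OF fresh])
    show "(\<lambda>q. ennreal (\<phi> q)) \<in> borel_measurable (borel \<Otimes>\<^sub>M ?P)"
      by measurable
    fix \<omega> assume \<omega>: "\<omega> \<in> space M"
    have "(\<lambda>s. G (z \<omega>) s i) \<in> borel_measurable S" if "i < d" for i
      using measurable_compose[OF measurable_Pair1' G[OF that], of "z \<omega>"] by simp
    from fo_estimator_error[OF S m B this bound[OF \<omega>]]
    show "(\<integral>\<^sup>+n. ennreal (\<phi> (z \<omega>, n)) \<partial>?P) \<le> ennreal (B / sqrt (real m))"
      by (simp add: \<phi>_def)
  qed
qed

text \<open>\<open>base\<close> extracts the perturbed block from the iterate \<open>z\<close>, as
  \<open>fst\<close> or \<open>snd\<close>, so that one statement serves both blocks.\<close>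

lemma (in prob_space) fresh_zo_error:
  fixes G :: "'z::topological_space \<Rightarrow> 'k \<Rightarrow> vec"
  assumes fresh: "fresh_noise M z (PiM {1..m} (\<lambda>_. S \<Otimes>\<^sub>M std_gauss d)) N"
    and S: "prob_space S" and m: "1 \<le> m" and d: "1 \<le> d" and B: "0 \<le> B" and LG: "0 \<le> LG" and \<nu>: "0 < \<nu>"
    and G: "\<And>i. i < d \<Longrightarrow> (\<lambda>(a, s). G a s i) \<in> borel_measurable (borel \<Otimes>\<^sub>M S)"
    and H: "(\<lambda>((a, v), s). H a v s) \<in> borel_measurable ((borel \<Otimes>\<^sub>M borel) \<Otimes>\<^sub>M S)"
    and base [measurable]: "base \<in> borel \<rightarrow>\<^sub>M borel"
    and bound: "\<And>\<omega>. \<omega> \<in> space M \<Longrightarrow> AE s in S. enorm d (G (z \<omega>) s) \<le> B \<and>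
      (\<forall>v\<in>Rn d. \<bar>H (z \<omega>) (\<lambda>k. base (z \<omega>) k + v k) s - H (z \<omega>) (base (z \<omega>)) s - einner d (G (z \<omega>) s) v\<bar>
        \<le> LG / 2 * (enorm d v)\<^sup>2)"
  defines "err \<equiv> (\<lambda>\<omega>. enorm d (zo_estimator m \<nu> (H (z \<omega>)) (base (z \<omega>)) (N \<omega>) - (\<lambda>i. \<integral>s. G (z \<omega>) s i \<partial>S)))"
  shows "err \<in> borel_measurable M"
    and "(\<integral>\<^sup>+\<omega>. ennreal (err \<omega>) \<partial>M) \<le>
      ennreal (sqrt (3 * real d * B\<^sup>2 / real m) + LG * \<nu> * (real d * sqrt (real d)))"
proof -
  interpret S: prob_space S by fact
  let ?P = "PiM {1..m} (\<lambda>_. S \<Otimes>\<^sub>M std_gauss d)"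
  define \<phi> where "\<phi> q = enorm d (zo_estimator m \<nu> (H (fst q)) (base (fst q)) (snd q) - (\<lambda>i. \<integral>s. G (fst q) s i \<partial>S))" for q
  have \<phi> [measurable]: "\<phi> \<in> borel_measurable (borel \<Otimes>\<^sub>M ?P)"
    unfolding \<phi>_def
  proof (rule measurable_enorm)
    fix i assume i: "i < d"
    have [measurable]: "(\<lambda>a. \<integral>s. G a s i \<partial>S) \<in> borel_measurable borel"
      using G[OF i] by (rule S.borel_measurable_lebesgue_integral)
    have comp [measurable]: "(\<lambda>q. snd q j) \<in> (borel \<Otimes>\<^sub>M ?P) \<rightarrow>\<^sub>M (S \<Otimes>\<^sub>M std_gauss d)" if "j \<in> {1..m}" for j
      using that by measurable
    have gauss_comp: "(\<lambda>q. snd (snd q j)) \<in> (borel \<Otimes>\<^sub>M ?P) \<rightarrow>\<^sub>M (borel :: vec measure)" if "j \<in> {1..m}" for j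
      using measurable_compose[OF comp[OF that] measurable_snd]
      by (simp add: measurable_cong_sets[OF refl sets_std_gauss])
    have [measurable]: "(\<lambda>q. H (fst q) (base (fst q)) (fst (snd q j))) \<in> borel_measurable (borel \<Otimes>\<^sub>M ?P)"
      if j: "j \<in> {1..m}" for j
    proof -
      have "(\<lambda>q. ((fst q, base (fst q)), fst (snd q j))) \<in> (borel \<Otimes>\<^sub>M ?P) \<rightarrow>\<^sub>M ((borel \<Otimes>\<^sub>M borel) \<Otimes>\<^sub>M S)"
        using comp[OF j] by measurable
      from measurable_compose[OF this H] show ?thesis
        by simp
    qed
    have [measurable]: "(\<lambda>q. H (fst q) (\<lambda>k. base (fst q) k + \<nu> * snd (snd q j) k) (fst (snd q j)))
        \<in> borel_measurable (borel \<Otimes>\<^sub>M ?P)" if j: "j \<in> {1..m}" for j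
    proof -
      note [measurable] = gauss_comp[OF j]
      have [measurable]: "(\<lambda>q k. base (fst q) k + \<nu> * snd (snd q j) k) \<in> (borel \<Otimes>\<^sub>M ?P) \<rightarrow>\<^sub>M (borel :: vec measure)"
        by (rule measurable_vecI) measurable
      have "(\<lambda>q. ((fst q, (\<lambda>k. base (fst q) k + \<nu> * snd (snd q j) k)), fst (snd q j)))
          \<in> (borel \<Otimes>\<^sub>M ?P) \<rightarrow>\<^sub>M ((borel \<Otimes>\<^sub>M borel) \<Otimes>\<^sub>M S)"
        using comp[OF j] by measurable
      from measurable_compose[OF this H] show ?thesis
        by simp
    qed
    have [measurable]: "(\<lambda>q. snd (snd q j) i) \<in> borel_measurable (borel \<Otimes>\<^sub>M ?P)" if j: "j \<in> {1..m}" for j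
      using measurable_compose[OF gauss_comp[OF j] measurable_vec_component] .
    show "(\<lambda>q. (zo_estimator m \<nu> (H (fst q)) (base (fst q)) (snd q) - (\<lambda>i. \<integral>s. G (fst q) s i \<partial>S)) i)
        \<in> borel_measurable (borel \<Otimes>\<^sub>M ?P)"
      unfolding zo_estimator_def fun_diff_def by measurable
  qed
  have [measurable]: "z \<in> borel_measurable M" "N \<in> M \<rightarrow>\<^sub>M ?P"
    using fresh by (auto simp: fresh_noise_def)
  have err: "err \<omega> = \<phi> (z \<omega>, N \<omega>)" for \<omega>
    by (simp add: err_def \<phi>_def)
  show "err \<in> borel_measurable M"
    unfolding err by measurable
  show "(\<integral>\<^sup>+\<omega>. ennreal (err \<omega>) \<partial>M) \<le>
      ennreal (sqrt (3 * real d * B\<^sup>2 / real m) + LG * \<nu> * (real d * sqrt (real d)))"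
    unfolding err
  proof (rule fresh_expectation_le[OF fresh])
    show "(\<lambda>q. ennreal (\<phi> q)) \<in> borel_measurable (borel \<Otimes>\<^sub>M ?P)"
      by measurable
    fix \<omega> assume \<omega>: "\<omega> \<in> space M"
    have 1: "(\<lambda>s. G (z \<omega>) s i) \<in> borel_measurable S" if "i < d" for i
      using measurable_compose[OF measurable_Pair1' G[OF that], of "z \<omega>"] by simp
    have "(\<lambda>(v, s). ((z \<omega>, v), s)) \<in> (borel \<Otimes>\<^sub>M S) \<rightarrow>\<^sub>M ((borel \<Otimes>\<^sub>M borel) \<Otimes>\<^sub>M S)"
      by measurable
    from measurable_compose[OF this H]
    have 2: "(\<lambda>(v, s). H (z \<omega>) v s) \<in> borel_measurable (borel \<Otimes>\<^sub>M S)"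
      by (simp add: case_prod_beta')
    from zo_estimator_error[OF S m d B LG \<nu> 1 2 bound[OF \<omega>]]
    show "(\<integral>\<^sup>+n. ennreal (\<phi> (z \<omega>, n)) \<partial>?P) \<le>
        ennreal (sqrt (3 * real d * B\<^sup>2 / real m) + LG * \<nu> * (real d * sqrt (real d)))"
      by (simp add: \<phi>_def)
  qed
qed

section \<open>The expected saddle-point problem\<close>

text \<open>Jensen's inequality for means taken coordinatewise: pairing the difference
  \<open>u\<close> of the means with itself gives
  \<open>(enorm d u)\<^sup>2 \<le> enorm d u * c\<close>.\<close>

lemma (in prob_space) enorm_mean_diff_le:
  assumes G: "\<And>i. i < d \<Longrightarrow> integrable M (\<lambda>s. G s i)" "\<And>i. i < d \<Longrightarrow> integrable M (\<lambda>s. G' s i)"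
    and c: "AE s in M. enorm d (G s - G' s) \<le> c"
  shows "enorm d ((\<lambda>i. \<integral>s. G s i \<partial>M) - (\<lambda>i. \<integral>s. G' s i \<partial>M)) \<le> c"
proof -
  define u where "u = (\<lambda>i. \<integral>s. G s i \<partial>M) - (\<lambda>i. \<integral>s. G' s i \<partial>M)"
  have "AE s in M. 0 \<le> c"
    using c by eventually_elim (rule order_trans[OF enorm_nonneg])
  then have c0: "0 \<le> c"
    by simp
  have int: "integrable M (\<lambda>s. einner d u (G s - G' s))"
    using G unfolding einner_def by (intro Bochner_Integration.integrable_sum) auto
  have "(enorm d u)\<^sup>2 = (\<Sum>i<d. u i * (\<integral>s. G s i - G' s i \<partial>M))"
    unfolding enorm_sq using G by (intro sum.cong) (auto simp: u_def power2_eq_square)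
  also have "\<dots> = (\<integral>s. einner d u (G s - G' s) \<partial>M)"
    unfolding einner_def using G by (subst Bochner_Integration.integral_sum) auto
  also have "\<dots> \<le> (\<integral>s. enorm d u * c \<partial>M)"
  proof (rule integral_mono_AE[OF int])
    show "AE s in M. einner d u (G s - G' s) \<le> enorm d u * c"
      using c
    proof eventually_elim
      case (elim s)
      have "einner d u (G s - G' s) \<le> enorm d u * enorm d (G s - G' s)"
        using einner_le_enorm[of d u "G s - G' s"] by linarith
      also have "\<dots> \<le> enorm d u * c"
        using elim by (intro mult_left_mono) auto
      finally show ?case .
    qed
  qed simp
  finally have "(enorm d u)\<^sup>2 \<le> enorm d u * c"
    by (simp add: prob_space)
  then have "enorm d u * enorm d u \<le> enorm d u * c"
    by (simp only: power2_eq_square)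
  then show ?thesis
    unfolding u_def[symmetric] using c0 by (cases "enorm d u = 0") (auto simp: less_le)
qed

text \<open>The signs of the Lipschitz constants are consequences of the assumptions, since two
  distinct points of \<open>Rn d\<close> have positive distance.\<close>

lemma lipschitz_constant_nonneg:
  assumes "lipschitz_map_on d e c S G" "a \<in> S" "b \<in> S" "a \<noteq> b" "S \<subseteq> Rn d"
  shows "0 \<le> c"
proof -
  have "0 \<le> c * enorm d (a - b)"
    using assms(1-3) enorm_nonneg[of e "G a - G b"] unfolding lipschitz_map_on_def by (meson order_trans)
  moreover have "0 < enorm d (a - b)"
    using assms by (intro enorm_pos) auto
  ultimately show ?thesis
    by (simp add: zero_le_mult_iff)
qed

lemma lipschitz_fun_constant_nonneg:
  assumes "lipschitz_fun_on d c S h" "a \<in> S" "b \<in> S" "a \<noteq> b" "S \<subseteq> Rn d"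
  shows "0 \<le> c"
proof -
  have "0 \<le> c * enorm d (a - b)"
    using assms(1-3) abs_ge_zero[of "h a - h b"] unfolding lipschitz_fun_on_def by (meson order_trans)
  moreover have "0 < enorm d (a - b)"
    using assms by (intro enorm_pos) auto
  ultimately show ?thesis
    by (simp add: zero_le_mult_iff)
qed

lemma ball_has_two_points:
  assumes z: "z \<in> S" "S \<subseteq> Rn d" and d: "1 \<le> d" and r: "0 < r" "\<And>q. q \<in> Rn d \<Longrightarrow> enorm d (z - q) \<le> r \<Longrightarrow> q \<in> S"
  obtains b where "b \<in> S" "z \<noteq> b"
proof
  let ?b = "\<lambda>i. if i = 0 then z 0 + r else z i"
  have "z - ?b = (\<lambda>i. (- r) * (if i = 0 then 1 else 0))"
    by (auto simp: fun_eq_iff)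
  moreover have "enorm d (\<lambda>i. if i = 0 then 1 else 0) = 1"
    using d by (simp add: enorm_def L2_set_def if_distrib[of "\<lambda>x. x\<^sup>2"] cong: if_cong)
  ultimately have "enorm d (z - ?b) = r"
    using r(1) by (simp only: enorm_scale)
  moreover have "?b \<in> Rn d"
    using z d by (auto simp: mem_Rn subset_iff)
  ultimately show "?b \<in> S"
    using r(2) by simp
  show "z \<noteq> ?b"
    using r(1) by (auto simp: fun_eq_iff intro: exI[of _ 0])
qed

text \<open>\<open>A\<close> and \<open>B\<close> stay open so that both oracles share what follows:
  they become the whole spaces for Gaussian smoothing and the feasible sets for the first-order
  oracle.\<close>

locale stochastic_saddle =
  fixes p :: "'k sp_problem" and A B :: "vec set" and \<sigma> :: real
  assumes asm: "sp_assumptions p A B" and orac: "stochastic_oracle p \<sigma>"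
    and A: "sp_X p \<subseteq> A" "A \<subseteq> Rn (sp_dX p)" "convex_set A"
    and B: "sp_Y p \<subseteq> B" "B \<subseteq> Rn (sp_dY p)" "convex_set B"
begin

abbreviation "T \<equiv> sp_T p"
abbreviation "X \<equiv> sp_X p"
abbreviation "Y \<equiv> sp_Y p"
abbreviation "dX \<equiv> sp_dX p"
abbreviation "dY \<equiv> sp_dY p"
abbreviation "\<delta>X \<equiv> border_distance (sp_dX p) (sp_X p) (sp_T p) (sp_xstar p)"
abbreviation "\<delta>Y \<equiv> border_distance (sp_dY p) (sp_Y p) (sp_T p) (sp_ystar p)"

lemma feasible:
  "1 \<le> T" "1 \<le> dX" "1 \<le> dY" "compactin (Euclidean_space dX) X" "compactin (Euclidean_space dY) Y"
  "convex_set X" "convex_set Y" "X \<subseteq> Rn dX" "Y \<subseteq> Rn dY" "0 < sp_muX p" "0 < sp_muY p"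
  "\<And>a b. a \<in> X \<Longrightarrow> b \<in> X \<Longrightarrow> enorm dX (a - b) \<le> sp_DX p"
  "\<And>a b. a \<in> Y \<Longrightarrow> b \<in> Y \<Longrightarrow> enorm dY (a - b) \<le> sp_DY p"
  using asm compactin_subset_topspace by (auto simp: sp_assumptions_def sp_feasible_sets_def)

lemma noise: "t \<in> {1..T} \<Longrightarrow> well_posed_noise p A B t"
  using asm by (simp add: sp_assumptions_def)

lemma prob_space_noise: "t \<in> {1..T} \<Longrightarrow> prob_space (sp_noise p t)"
  using noise by (simp add: well_posed_noise_def)

lemma AE_regular: "t \<in> {1..T} \<Longrightarrow> AE \<xi> in sp_noise p t. strongly_convex_concave p t \<xi> \<and> lipschitz_function p t \<xi> \<and>
    continuously_differentiable p A B t \<xi> \<and> lipschitz_gradient p A B t \<xi> \<and> lipschitz_partial_gradient p t \<xi>"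
  using asm by (simp add: sp_assumptions_def)

lemma saddle: "t \<in> {1..T} \<Longrightarrow> is_saddle_point X Y (sp_f p t) (sp_xstar p t) (sp_ystar p t)"
  using asm by (simp add: sp_assumptions_def interior_saddle_points_def)

lemma star_mem: "t \<in> {1..T} \<Longrightarrow> sp_xstar p t \<in> X" "t \<in> {1..T} \<Longrightarrow> sp_ystar p t \<in> Y"
  using saddle by (simp_all add: is_saddle_point_def)

lemma border_pos: "0 < \<delta>X" "0 < \<delta>Y"
  using asm feasible
  by (auto simp: sp_assumptions_def interior_saddle_points_def intro!: border_distance_pos)

lemma border_ball:
  "t \<in> {1..T} \<Longrightarrow> q \<in> Rn dX \<Longrightarrow> enorm dX (sp_xstar p t - q) \<le> \<delta>X \<Longrightarrow> q \<in> X"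
  "t \<in> {1..T} \<Longrightarrow> q \<in> Rn dY \<Longrightarrow> enorm dY (sp_ystar p t - q) \<le> \<delta>Y \<Longrightarrow> q \<in> Y"
  using border_distance_ball feasible(4,5) star_mem by blast+

lemma constants_nonneg:
  "0 \<le> sp_LX p" "0 \<le> sp_LY p" "0 \<le> sp_LGX p" "0 \<le> sp_LGY p" "0 \<le> sp_LXY p" "0 \<le> sp_LYX p"
  "0 \<le> sp_DX p" "0 \<le> sp_DY p"
proof -
  have t: "1 \<in> {1..T}"
    using feasible(1) by simp
  note z = star_mem[OF t]
  obtain a where a: "a \<in> X" "sp_xstar p 1 \<noteq> a"
    using ball_has_two_points[OF z(1) feasible(8,2) border_pos(1) border_ball(1)[OF t]] by blast
  obtain b where b: "b \<in> Y" "sp_ystar p 1 \<noteq> b"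
    using ball_has_two_points[OF z(2) feasible(9,3) border_pos(2) border_ball(2)[OF t]] by blast
  interpret prob_space "sp_noise p 1"
    using t by (rule prob_space_noise)
  \<comment> \<open>The claim does not involve \<open>\<xi>\<close>, so holding almost surely in a
    probability space means that it holds.\<close>
  have "AE \<xi> in sp_noise p 1. 0 \<le> sp_LX p \<and> 0 \<le> sp_LY p \<and> 0 \<le> sp_LGX p \<and> 0 \<le> sp_LGY p \<and> 0 \<le> sp_LXY p \<and> 0 \<le> sp_LYX p"
    using AE_regular[OF t]
  proof eventually_elim
    case (elim \<xi>)
    then have 1: "lipschitz_fun_on dX (sp_LX p) X (\<lambda>x. sp_F p 1 x (sp_ystar p 1) \<xi>)"
      and 2: "lipschitz_fun_on dY (sp_LY p) Y (\<lambda>y. sp_F p 1 (sp_xstar p 1) y \<xi>)"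
      and 3: "lipschitz_map_on dX dX (sp_LGX p) A (\<lambda>x. sp_gradX p 1 x (sp_ystar p 1) \<xi>)"
      and 4: "lipschitz_map_on dY dY (sp_LGY p) B (\<lambda>y. sp_gradY p 1 (sp_xstar p 1) y \<xi>)"
      and 5: "lipschitz_map_on dY dX (sp_LXY p) Y (\<lambda>y. sp_gradX p 1 (sp_xstar p 1) y \<xi>)"
      and 6: "lipschitz_map_on dX dY (sp_LYX p) X (\<lambda>x. sp_gradY p 1 x (sp_ystar p 1) \<xi>)"
      using z by (simp_all add: lipschitz_function_def lipschitz_gradient_def lipschitz_partial_gradient_def)
    have zA: "sp_xstar p 1 \<in> A" "a \<in> A" "sp_ystar p 1 \<in> B" "b \<in> B"
      using z a b A B by auto
    show ?case
      using lipschitz_fun_constant_nonneg[OF 1 z(1) a feasible(8)] lipschitz_fun_constant_nonneg[OF 2 z(2) b feasible(9)]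
        lipschitz_constant_nonneg[OF 3 zA(1,2) a(2) A(2)] lipschitz_constant_nonneg[OF 4 zA(3,4) b(2) B(2)]
        lipschitz_constant_nonneg[OF 5 z(2) b feasible(9)] lipschitz_constant_nonneg[OF 6 z(1) a feasible(8)]
      by blast
  qed
  then show "0 \<le> sp_LX p" "0 \<le> sp_LY p" "0 \<le> sp_LGX p" "0 \<le> sp_LGY p" "0 \<le> sp_LXY p" "0 \<le> sp_LYX p"
    by simp_all
  show "0 \<le> sp_DX p" "0 \<le> sp_DY p"
    using feasible(12)[OF z(1) z(1)] feasible(13)[OF z(2) z(2)] by simp_all
qed

lemma integrable_F: "t \<in> {1..T} \<Longrightarrow> x \<in> X \<Longrightarrow> y \<in> Y \<Longrightarrow> integrable (sp_noise p t) (sp_F p t x y)"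
  using noise A(1) unfolding well_posed_noise_def by blast

lemma mean_gradX_gradient:
  assumes "t \<in> {1..T}" "x \<in> X" "y \<in> Y"
  shows "i < dX \<Longrightarrow> integrable (sp_noise p t) (\<lambda>\<xi>. sp_gradX p t x y \<xi> i)"
    and "has_gradient dX X (\<lambda>x'. sp_f p t x' y) (mean_gradX p t x y) x"
  using orac assms unfolding stochastic_oracle_def by blast+

lemma mean_gradY_gradient:
  assumes "t \<in> {1..T}" "x \<in> X" "y \<in> Y"
  shows "i < dY \<Longrightarrow> integrable (sp_noise p t) (\<lambda>\<xi>. sp_gradY p t x y \<xi> i)"
    and "has_gradient dY Y (\<lambda>y'. sp_f p t x y') (mean_gradY p t x y) y"
  using orac assms unfolding stochastic_oracle_def by blast+

text \<open>Each inequality holds for almost every realization and is preserved by taking means.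
  Differentiability of the mean comes from \<open>stochastic_oracle\<close>, not from
  differentiating under the integral.\<close>

lemma expected_saddle_problem:
  assumes t: "t \<in> {1..T}"
  shows "saddle_problem dX dY X Y (sp_f p t) (mean_gradX p t) (mean_gradY p t)
    (sp_muX p) (sp_muY p) (sp_LX p) (sp_LY p) (sp_LGX p) (sp_LGY p) (sp_LXY p) (sp_LYX p) (sp_DX p) (sp_DY p)"
proof -
  interpret prob_space "sp_noise p t"
    using t by (rule prob_space_noise)
  note int = integrable_F[OF t]
  have scx: "strongly_convex_on dX (sp_muX p) X (\<lambda>x. sp_f p t x y)" if y: "y \<in> Y" for y
    unfolding strongly_convex_on_def
  proof (intro ballI)
    fix a b :: vec and l :: real assume ab: "a \<in> X" "b \<in> X" and l: "l \<in> {0..1}"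
    have c: "conv_comb l a b \<in> X"
      using conv_comb_mem[OF feasible(6) ab] l by simp
    have "sp_f p t (conv_comb l a b) y \<le> (\<integral>\<xi>. (1 - l) * sp_F p t a y \<xi> + l * sp_F p t b y \<xi>
        - sp_muX p / 2 * l * (1 - l) * (enorm dX (a - b))\<^sup>2 \<partial>sp_noise p t)"
      unfolding sp_f_def
    proof (rule integral_mono_AE)
      show "AE \<xi> in sp_noise p t. sp_F p t (conv_comb l a b) y \<xi> \<le> (1 - l) * sp_F p t a y \<xi> + l * sp_F p t b y \<xi>
          - sp_muX p / 2 * l * (1 - l) * (enorm dX (a - b))\<^sup>2"
        using AE_regular[OF t]
        by eventually_elim (use y ab l in \<open>auto simp: strongly_convex_concave_def strongly_convex_on_def\<close>)
    qed (use int[OF c y] int[OF ab(1) y] int[OF ab(2) y] in auto)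
    also have "\<dots> = (1 - l) * sp_f p t a y + l * sp_f p t b y - sp_muX p / 2 * l * (1 - l) * (enorm dX (a - b))\<^sup>2"
      using int[OF ab(1) y] int[OF ab(2) y] by (simp add: sp_f_def prob_space)
    finally show "sp_f p t (conv_comb l a b) y \<le>
        (1 - l) * sp_f p t a y + l * sp_f p t b y - sp_muX p / 2 * l * (1 - l) * (enorm dX (a - b))\<^sup>2" .
  qed
  have scy: "strongly_convex_on dY (sp_muY p) Y (\<lambda>y. - sp_f p t x y)" if x: "x \<in> X" for x
    unfolding strongly_convex_on_def
  proof (intro ballI)
    fix a b :: vec and l :: real assume ab: "a \<in> Y" "b \<in> Y" and l: "l \<in> {0..1}"
    have c: "conv_comb l a b \<in> Y"
      using conv_comb_mem[OF feasible(7) ab] l by simp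
    have "- sp_f p t x (conv_comb l a b) = (\<integral>\<xi>. - sp_F p t x (conv_comb l a b) \<xi> \<partial>sp_noise p t)"
      by (simp add: sp_f_def)
    also have "\<dots> \<le> (\<integral>\<xi>. (1 - l) * - sp_F p t x a \<xi> + l * - sp_F p t x b \<xi>
        - sp_muY p / 2 * l * (1 - l) * (enorm dY (a - b))\<^sup>2 \<partial>sp_noise p t)"
    proof (rule integral_mono_AE)
      show "AE \<xi> in sp_noise p t. - sp_F p t x (conv_comb l a b) \<xi> \<le> (1 - l) * - sp_F p t x a \<xi> + l * - sp_F p t x b \<xi>
          - sp_muY p / 2 * l * (1 - l) * (enorm dY (a - b))\<^sup>2"
        using AE_regular[OF t]
      proof eventually_elim
        case (elim \<xi>)
        then have "strongly_convex_on dY (sp_muY p) Y (\<lambda>y. - sp_F p t x y \<xi>)"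
          using x by (simp add: strongly_convex_concave_def)
        then show ?case
          using ab l unfolding strongly_convex_on_def by blast
      qed
    qed (use int[OF x c] int[OF x ab(1)] int[OF x ab(2)] in auto)
    also have "\<dots> = (1 - l) * - sp_f p t x a + l * - sp_f p t x b - sp_muY p / 2 * l * (1 - l) * (enorm dY (a - b))\<^sup>2"
      using int[OF x ab(1)] int[OF x ab(2)] by (simp add: sp_f_def prob_space)
    finally show "- sp_f p t x (conv_comb l a b) \<le>
        (1 - l) * - sp_f p t x a + l * - sp_f p t x b - sp_muY p / 2 * l * (1 - l) * (enorm dY (a - b))\<^sup>2" .
  qed
  have mean_le: "\<bar>sp_f p t x y - sp_f p t x' y'\<bar> \<le> c"
    if xy: "x \<in> X" "y \<in> Y" "x' \<in> X" "y' \<in> Y" and ae: "AE \<xi> in sp_noise p t. \<bar>sp_F p t x y \<xi> - sp_F p t x' y' \<xi>\<bar> \<le> c"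
    for x y x' y' c
  proof -
    have "\<bar>sp_f p t x y - sp_f p t x' y'\<bar> = \<bar>\<integral>\<xi>. sp_F p t x y \<xi> - sp_F p t x' y' \<xi> \<partial>sp_noise p t\<bar>"
      using int xy by (simp add: sp_f_def)
    also have "\<dots> \<le> (\<integral>\<xi>. \<bar>sp_F p t x y \<xi> - sp_F p t x' y' \<xi>\<bar> \<partial>sp_noise p t)"
      by (rule integral_abs_bound)
    also have "\<dots> \<le> (\<integral>\<xi>. c \<partial>sp_noise p t)"
      using int xy ae by (intro integral_mono_AE) auto
    finally show ?thesis
      by (simp add: prob_space)
  qed
  have lx: "lipschitz_fun_on dX (sp_LX p) X (\<lambda>x. sp_f p t x y)" if y: "y \<in> Y" for y
    unfolding lipschitz_fun_on_def
  proof (intro ballI mean_le y)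
    fix a b assume ab: "a \<in> X" "b \<in> X"
    show "AE \<xi> in sp_noise p t. \<bar>sp_F p t a y \<xi> - sp_F p t b y \<xi>\<bar> \<le> sp_LX p * enorm dX (a - b)"
      using AE_regular[OF t] by eventually_elim
        (use ab y in \<open>auto simp: lipschitz_function_def lipschitz_fun_on_def\<close>)
  qed
  have ly: "lipschitz_fun_on dY (sp_LY p) Y (\<lambda>y. sp_f p t x y)" if x: "x \<in> X" for x
    unfolding lipschitz_fun_on_def
  proof (intro ballI mean_le x)
    fix a b assume ab: "a \<in> Y" "b \<in> Y"
    show "AE \<xi> in sp_noise p t. \<bar>sp_F p t x a \<xi> - sp_F p t x b \<xi>\<bar> \<le> sp_LY p * enorm dY (a - b)"
      using AE_regular[OF t] by eventually_elim
        (use ab x in \<open>auto simp: lipschitz_function_def lipschitz_fun_on_def\<close>)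
  qed
  have gX: "enorm dX (mean_gradX p t x y - mean_gradX p t x' y') \<le> c"
    if "x \<in> X" "y \<in> Y" "x' \<in> X" "y' \<in> Y" "AE \<xi> in sp_noise p t. enorm dX (sp_gradX p t x y \<xi> - sp_gradX p t x' y' \<xi>) \<le> c"
    for x y x' y' c
    unfolding mean_gradX_def using that mean_gradX_gradient(1)[OF t] by (intro enorm_mean_diff_le) auto
  have gY: "enorm dY (mean_gradY p t x y - mean_gradY p t x' y') \<le> c"
    if "x \<in> X" "y \<in> Y" "x' \<in> X" "y' \<in> Y" "AE \<xi> in sp_noise p t. enorm dY (sp_gradY p t x y \<xi> - sp_gradY p t x' y' \<xi>) \<le> c"
    for x y x' y' c
    unfolding mean_gradY_def using that mean_gradY_gradient(1)[OF t] by (intro enorm_mean_diff_le) auto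
  have "lipschitz_map_on dX dX (sp_LGX p) X (\<lambda>x. mean_gradX p t x y)" if y: "y \<in> Y" for y
    unfolding lipschitz_map_on_def
  proof (intro ballI gX y)
    fix a b assume ab: "a \<in> X" "b \<in> X"
    show "AE \<xi> in sp_noise p t. enorm dX (sp_gradX p t a y \<xi> - sp_gradX p t b y \<xi>) \<le> sp_LGX p * enorm dX (a - b)"
      using AE_regular[OF t] by eventually_elim
        (use ab y A(1) in \<open>auto simp: lipschitz_gradient_def lipschitz_map_on_def subset_iff\<close>)
  qed
  moreover have "lipschitz_map_on dY dY (sp_LGY p) Y (\<lambda>y. mean_gradY p t x y)" if x: "x \<in> X" for x
    unfolding lipschitz_map_on_def
  proof (intro ballI gY x)
    fix a b assume ab: "a \<in> Y" "b \<in> Y"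
    show "AE \<xi> in sp_noise p t. enorm dY (sp_gradY p t x a \<xi> - sp_gradY p t x b \<xi>) \<le> sp_LGY p * enorm dY (a - b)"
      using AE_regular[OF t] by eventually_elim
        (use ab x B(1) in \<open>auto simp: lipschitz_gradient_def lipschitz_map_on_def subset_iff\<close>)
  qed
  moreover have "lipschitz_map_on dY dX (sp_LXY p) Y (\<lambda>y. mean_gradX p t x y)" if x: "x \<in> X" for x
    unfolding lipschitz_map_on_def
  proof (intro ballI gX x)
    fix a b assume ab: "a \<in> Y" "b \<in> Y"
    show "AE \<xi> in sp_noise p t. enorm dX (sp_gradX p t x a \<xi> - sp_gradX p t x b \<xi>) \<le> sp_LXY p * enorm dY (a - b)"
      using AE_regular[OF t] by eventually_elim
        (use ab x in \<open>auto simp: lipschitz_partial_gradient_def lipschitz_map_on_def\<close>)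
  qed
  moreover have "lipschitz_map_on dX dY (sp_LYX p) X (\<lambda>x. mean_gradY p t x y)" if y: "y \<in> Y" for y
    unfolding lipschitz_map_on_def
  proof (intro ballI gY y)
    fix a b assume ab: "a \<in> X" "b \<in> X"
    show "AE \<xi> in sp_noise p t. enorm dY (sp_gradY p t a y \<xi> - sp_gradY p t b y \<xi>) \<le> sp_LYX p * enorm dX (a - b)"
      using AE_regular[OF t] by eventually_elim
        (use ab y in \<open>auto simp: lipschitz_partial_gradient_def lipschitz_map_on_def\<close>)
  qed
  moreover have "X \<noteq> {}" "Y \<noteq> {}"
    using star_mem[OF t] by auto
  ultimately show ?thesis
    using feasible constants_nonneg scx scy lx ly mean_gradX_gradient(2)[OF t] mean_gradY_gradient(2)[OF t]
    by unfold_locales auto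
qed

text \<open>The saddle point serves as the inner point at which the Lipschitz constant controls the
  gradient. The resulting constant is the bound \<open>B\<close> of the estimator errors.\<close>

lemma gradX_bound:
  assumes t: "t \<in> {1..T}"
  shows "AE \<xi> in sp_noise p t. \<forall>x\<in>X. \<forall>y\<in>Y. enorm dX (sp_gradX p t x y \<xi>) \<le> sp_LX p + sp_LGX p * sp_DX p"
  using AE_regular[OF t]
proof eventually_elim
  case (elim \<xi>)
  show ?case
  proof (intro ballI)
    fix x y assume xy: "x \<in> X" "y \<in> Y"
    note z = star_mem(1)[OF t]
    show "enorm dX (sp_gradX p t x y \<xi>) \<le> sp_LX p + sp_LGX p * sp_DX p"
    proof (rule lipschitz_gradient_norm_le_diameter[where G = "\<lambda>x. sp_gradX p t x y \<xi>" and h = "\<lambda>x. sp_F p t x y \<xi>",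
          OF feasible(6) A(1,2) _ constants_nonneg(1,3) _ _ z border_pos(1) border_ball(1)[OF t] _ feasible(12)])
    qed (use elim xy z A(1) in
        \<open>auto simp: lipschitz_function_def continuously_differentiable_def lipschitz_gradient_def\<close>)
  qed
qed

lemma gradY_bound:
  assumes t: "t \<in> {1..T}"
  shows "AE \<xi> in sp_noise p t. \<forall>x\<in>X. \<forall>y\<in>Y. enorm dY (sp_gradY p t x y \<xi>) \<le> sp_LY p + sp_LGY p * sp_DY p"
  using AE_regular[OF t]
proof eventually_elim
  case (elim \<xi>)
  show ?case
  proof (intro ballI)
    fix x y assume xy: "x \<in> X" "y \<in> Y"
    note z = star_mem(2)[OF t]
    show "enorm dY (sp_gradY p t x y \<xi>) \<le> sp_LY p + sp_LGY p * sp_DY p"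
    proof (rule lipschitz_gradient_norm_le_diameter[where G = "\<lambda>y. sp_gradY p t x y \<xi>" and h = "\<lambda>y. sp_F p t x y \<xi>",
          OF feasible(7) B(1,2) _ constants_nonneg(2,4) _ _ z border_pos(2) border_ball(2)[OF t] _ feasible(13)])
    qed (use elim xy z B(1) in
        \<open>auto simp: lipschitz_function_def continuously_differentiable_def lipschitz_gradient_def\<close>)
  qed
qed

end

section \<open>Regret of the Frank-Wolfe method\<close>

lemma sum_le_telescope:
  fixes u a :: "nat \<Rightarrow> real"
  assumes "\<And>t. 1 \<le> t \<Longrightarrow> t \<le> n \<Longrightarrow> u (t + 1) \<le> u t - a t"
  shows "(\<Sum>t=1..n. a t) \<le> u 1 - u (n + 1)"
  using assms
proof (induction n)
  case (Suc n)
  then have "(\<Sum>t=1..n. a t) \<le> u 1 - u (n + 1)"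
    by simp
  moreover have "u (Suc n + 1) \<le> u (Suc n) - a (Suc n)"
    using Suc.prems[of "Suc n"] by simp
  ultimately show ?case
    by simp
qed simp

context stochastic_saddle
begin

section \<open>Estimator errors at the iterates\<close>

lemma measurable_F:
  assumes "t \<in> {1..T}"
  shows "(\<lambda>(z, \<xi>). sp_F p t (fst z) (snd z) \<xi>) \<in> borel_measurable (borel \<Otimes>\<^sub>M sp_noise p t)"
    and "(\<lambda>(z, \<xi>). sp_gradX p t (fst z) (snd z) \<xi> i) \<in> borel_measurable (borel \<Otimes>\<^sub>M sp_noise p t)"
    and "(\<lambda>(z, \<xi>). sp_gradY p t (fst z) (snd z) \<xi> i) \<in> borel_measurable (borel \<Otimes>\<^sub>M sp_noise p t)"
proof -
  have *: "(\<lambda>((x, y), \<xi>). sp_F p t x y \<xi>) \<in> borel_measurable (borel \<Otimes>\<^sub>M sp_noise p t)"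
    "(\<lambda>((x, y), \<xi>). sp_gradX p t x y \<xi>) \<in> borel_measurable (borel \<Otimes>\<^sub>M sp_noise p t)"
    "(\<lambda>((x, y), \<xi>). sp_gradY p t x y \<xi>) \<in> borel_measurable (borel \<Otimes>\<^sub>M sp_noise p t)"
    using noise[OF assms] unfolding well_posed_noise_def borel_prod by blast+
  show "(\<lambda>(z, \<xi>). sp_F p t (fst z) (snd z) \<xi>) \<in> borel_measurable (borel \<Otimes>\<^sub>M sp_noise p t)"
    using *(1) by (simp add: case_prod_beta')
  show "(\<lambda>(z, \<xi>). sp_gradX p t (fst z) (snd z) \<xi> i) \<in> borel_measurable (borel \<Otimes>\<^sub>M sp_noise p t)"
    "(\<lambda>(z, \<xi>). sp_gradY p t (fst z) (snd z) \<xi> i) \<in> borel_measurable (borel \<Otimes>\<^sub>M sp_noise p t)"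
    using measurable_compose[OF *(2) measurable_vec_component[of i]]
      measurable_compose[OF *(3) measurable_vec_component[of i]] by (simp_all add: case_prod_beta')
qed

lemma fo_errors:
  assumes M: "prob_space M" and t: "t \<in> {1..T}" and m: "1 \<le> m"
    and fresh: "fresh_noise M (\<lambda>\<omega>. (x \<omega>, y \<omega>)) (PiM {1..m} (\<lambda>_. sp_noise p t)) N"
    and xy: "\<And>\<omega>. \<omega> \<in> space M \<Longrightarrow> x \<omega> \<in> X \<and> y \<omega> \<in> Y"
  defines "errX \<equiv> (\<lambda>\<omega>. enorm dX (fo_estimator m (sp_gradX p t (x \<omega>) (y \<omega>)) (N \<omega>) - mean_gradX p t (x \<omega>) (y \<omega>)))"
    and "errY \<equiv> (\<lambda>\<omega>. enorm dY (fo_estimator m (sp_gradY p t (x \<omega>) (y \<omega>)) (N \<omega>) - mean_gradY p t (x \<omega>) (y \<omega>)))"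
  shows "errX \<in> borel_measurable M"
    "(\<integral>\<^sup>+\<omega>. ennreal (errX \<omega>) \<partial>M) \<le> ennreal ((sp_LX p + sp_LGX p * sp_DX p) / sqrt (real m))"
    "errY \<in> borel_measurable M"
    "(\<integral>\<^sup>+\<omega>. ennreal (errY \<omega>) \<partial>M) \<le> ennreal ((sp_LY p + sp_LGY p * sp_DY p) / sqrt (real m))"
proof -
  interpret M: prob_space M by fact
  have B: "0 \<le> sp_LX p + sp_LGX p * sp_DX p" "0 \<le> sp_LY p + sp_LGY p * sp_DY p"
    using constants_nonneg by simp_all
  have bX: "AE s in sp_noise p t. enorm dX (sp_gradX p t (fst (x \<omega>, y \<omega>)) (snd (x \<omega>, y \<omega>)) s) \<le> sp_LX p + sp_LGX p * sp_DX p"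
    if "\<omega> \<in> space M" for \<omega>
    using gradX_bound[OF t] by eventually_elim (use xy[OF that] in auto)
  have bY: "AE s in sp_noise p t. enorm dY (sp_gradY p t (fst (x \<omega>, y \<omega>)) (snd (x \<omega>, y \<omega>)) s) \<le> sp_LY p + sp_LGY p * sp_DY p"
    if "\<omega> \<in> space M" for \<omega>
    using gradY_bound[OF t] by eventually_elim (use xy[OF that] in auto)
  show "errX \<in> borel_measurable M"
    "(\<integral>\<^sup>+\<omega>. ennreal (errX \<omega>) \<partial>M) \<le> ennreal ((sp_LX p + sp_LGX p * sp_DX p) / sqrt (real m))"
    using M.fresh_fo_error[OF fresh prob_space_noise[OF t] m B(1) measurable_F(2)[OF t] bX]
    by (simp_all add: errX_def mean_gradX_def)
  show "errY \<in> borel_measurable M"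
    "(\<integral>\<^sup>+\<omega>. ennreal (errY \<omega>) \<partial>M) \<le> ennreal ((sp_LY p + sp_LGY p * sp_DY p) / sqrt (real m))"
    using M.fresh_fo_error[OF fresh prob_space_noise[OF t] m B(2) measurable_F(3)[OF t] bY]
    by (simp_all add: errY_def mean_gradY_def)
qed

lemma zo_errors:
  assumes M: "prob_space M" and t: "t \<in> {1..T}" and m: "1 \<le> mX" "1 \<le> mY" and \<nu>: "0 < \<nu>X" "0 < \<nu>Y"
    and AB: "A = Rn dX" "B = Rn dY"
    and fresh: "fresh_noise M (\<lambda>\<omega>. (x \<omega>, y \<omega>))
        (PiM {1..mX} (\<lambda>_. sp_noise p t \<Otimes>\<^sub>M std_gauss dX) \<Otimes>\<^sub>M PiM {1..mY} (\<lambda>_. sp_noise p t \<Otimes>\<^sub>M std_gauss dY))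
        (\<lambda>\<omega>. (NX \<omega>, NY \<omega>))"
    and xy: "\<And>\<omega>. \<omega> \<in> space M \<Longrightarrow> x \<omega> \<in> X \<and> y \<omega> \<in> Y"
  defines "errX \<equiv> (\<lambda>\<omega>. enorm dX (zo_estimator mX \<nu>X (\<lambda>a. sp_F p t a (y \<omega>)) (x \<omega>) (NX \<omega>) - mean_gradX p t (x \<omega>) (y \<omega>)))"
    and "errY \<equiv> (\<lambda>\<omega>. enorm dY (zo_estimator mY \<nu>Y (\<lambda>b. sp_F p t (x \<omega>) b) (y \<omega>) (NY \<omega>) - mean_gradY p t (x \<omega>) (y \<omega>)))"
    and "BX \<equiv> sp_LX p + sp_LGX p * sp_DX p" and "BY \<equiv> sp_LY p + sp_LGY p * sp_DY p"
  shows "errX \<in> borel_measurable M"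
    "(\<integral>\<^sup>+\<omega>. ennreal (errX \<omega>) \<partial>M) \<le>
      ennreal (sqrt (3 * real dX * BX\<^sup>2 / real mX) + sp_LGX p * \<nu>X * (real dX * sqrt (real dX)))"
    "errY \<in> borel_measurable M"
    "(\<integral>\<^sup>+\<omega>. ennreal (errY \<omega>) \<partial>M) \<le>
      ennreal (sqrt (3 * real dY * BY\<^sup>2 / real mY) + sp_LGY p * \<nu>Y * (real dY * sqrt (real dY)))"
proof -
  interpret M: prob_space M by fact
  note S = prob_space_noise[OF t]
  have PG: "prob_space (PiM {1..m} (\<lambda>_ :: nat. sp_noise p t \<Otimes>\<^sub>M std_gauss d))" for m d
    by (intro prob_space_PiM prob_space_pair S prob_space_std_gauss)
  note fX = M.fresh_noise_pair(1)[OF fresh PG PG] and fY = M.fresh_noise_pair(2)[OF fresh PG PG]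
  have BX: "0 \<le> BX" and BY: "0 \<le> BY"
    using constants_nonneg by (simp_all add: BX_def BY_def)
  have pm [measurable]: "fst \<in> (borel :: (vec \<times> vec) measure) \<rightarrow>\<^sub>M (borel :: vec measure)"
    "snd \<in> (borel :: (vec \<times> vec) measure) \<rightarrow>\<^sub>M (borel :: vec measure)"
    by (simp_all add: borel_prod[symmetric])
  have pair: "(\<lambda>q. (f q, g q)) \<in> Q \<rightarrow>\<^sub>M (borel :: (vec \<times> vec) measure)"
    if "f \<in> Q \<rightarrow>\<^sub>M (borel :: vec measure)" "g \<in> Q \<rightarrow>\<^sub>M (borel :: vec measure)" for f g and Q :: "'q measure"
    unfolding borel_prod[symmetric] using that by measurable
  have HX: "(\<lambda>((z, v), s). sp_F p t v (snd z) s) \<in> borel_measurable (((borel :: (vec \<times> vec) measure) \<Otimes>\<^sub>M borel) \<Otimes>\<^sub>M sp_noise p t)"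
  proof -
    have "(\<lambda>q. (snd (fst q), snd (fst (fst q)))) \<in>
        (((borel :: (vec \<times> vec) measure) \<Otimes>\<^sub>M (borel :: vec measure)) \<Otimes>\<^sub>M sp_noise p t) \<rightarrow>\<^sub>M borel"
      by (rule pair) measurable
    then have "(\<lambda>q. ((snd (fst q), snd (fst (fst q))), snd q)) \<in>
        (((borel :: (vec \<times> vec) measure) \<Otimes>\<^sub>M (borel :: vec measure)) \<Otimes>\<^sub>M sp_noise p t) \<rightarrow>\<^sub>M (borel \<Otimes>\<^sub>M sp_noise p t)"
      by measurable
    from measurable_compose[OF this measurable_F(1)[OF t]] show ?thesis
      by (simp add: case_prod_beta')
  qed
  have HY: "(\<lambda>((z, v), s). sp_F p t (fst z) v s) \<in> borel_measurable (((borel :: (vec \<times> vec) measure) \<Otimes>\<^sub>M borel) \<Otimes>\<^sub>M sp_noise p t)"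
  proof -
    have "(\<lambda>q. (fst (fst (fst q)), snd (fst q))) \<in>
        (((borel :: (vec \<times> vec) measure) \<Otimes>\<^sub>M (borel :: vec measure)) \<Otimes>\<^sub>M sp_noise p t) \<rightarrow>\<^sub>M borel"
      by (rule pair) measurable
    then have "(\<lambda>q. ((fst (fst (fst q)), snd (fst q)), snd q)) \<in>
        (((borel :: (vec \<times> vec) measure) \<Otimes>\<^sub>M (borel :: vec measure)) \<Otimes>\<^sub>M sp_noise p t) \<rightarrow>\<^sub>M (borel \<Otimes>\<^sub>M sp_noise p t)"
      by measurable
    from measurable_compose[OF this measurable_F(1)[OF t]] show ?thesis
      by (simp add: case_prod_beta')
  qed
  have bX: "AE s in sp_noise p t. enorm dX (sp_gradX p t (fst (x \<omega>, y \<omega>)) (snd (x \<omega>, y \<omega>)) s) \<le> BX \<and>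
      (\<forall>v\<in>Rn dX. \<bar>sp_F p t (\<lambda>k. fst (x \<omega>, y \<omega>) k + v k) (snd (x \<omega>, y \<omega>)) s - sp_F p t (fst (x \<omega>, y \<omega>)) (snd (x \<omega>, y \<omega>)) s
        - einner dX (sp_gradX p t (fst (x \<omega>, y \<omega>)) (snd (x \<omega>, y \<omega>)) s) v\<bar> \<le> sp_LGX p / 2 * (enorm dX v)\<^sup>2)"
    if \<omega>: "\<omega> \<in> space M" for \<omega>
    using gradX_bound[OF t] AE_regular[OF t]
  proof eventually_elim
    case (elim s)
    have x: "x \<omega> \<in> X" and y: "y \<omega> \<in> Y"
      using xy[OF \<omega>] by auto
    have g: "has_gradient dX A (\<lambda>a. sp_F p t a (y \<omega>) s) (sp_gradX p t a (y \<omega>) s) a" if "a \<in> A" for a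
      using elim(2) that y by (auto simp: continuously_differentiable_def)
    have l: "lipschitz_map_on dX dX (sp_LGX p) A (\<lambda>a. sp_gradX p t a (y \<omega>) s)"
      using elim(2) y by (auto simp: lipschitz_gradient_def)
    show ?case
    proof (intro conjI ballI)
      fix v assume v: "v \<in> Rn dX"
      have a: "x \<omega> \<in> A"
        using x A(1) by auto
      \<comment> \<open>A Gaussian increment may leave every bounded set, which is why
        \<open>A\<close> is the whole space here.\<close>
      then have b: "(\<lambda>k. x \<omega> k + v k) \<in> A"
        using v unfolding AB mem_Rn by auto
      have "(\<lambda>k. x \<omega> k + v k) - x \<omega> = v"
        by (simp add: fun_eq_iff)
      then show "\<bar>sp_F p t (\<lambda>k. fst (x \<omega>, y \<omega>) k + v k) (snd (x \<omega>, y \<omega>)) s - sp_F p t (fst (x \<omega>, y \<omega>)) (snd (x \<omega>, y \<omega>)) s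
          - einner dX (sp_gradX p t (fst (x \<omega>, y \<omega>)) (snd (x \<omega>, y \<omega>)) s) v\<bar> \<le> sp_LGX p / 2 * (enorm dX v)\<^sup>2"
        using gradient_remainder[OF A(3,2) g l a b] by (simp only: fst_conv snd_conv)
    qed (use elim(1) x y in \<open>auto simp: BX_def\<close>)
  qed
  have bY: "AE s in sp_noise p t. enorm dY (sp_gradY p t (fst (x \<omega>, y \<omega>)) (snd (x \<omega>, y \<omega>)) s) \<le> BY \<and>
      (\<forall>v\<in>Rn dY. \<bar>sp_F p t (fst (x \<omega>, y \<omega>)) (\<lambda>k. snd (x \<omega>, y \<omega>) k + v k) s - sp_F p t (fst (x \<omega>, y \<omega>)) (snd (x \<omega>, y \<omega>)) s
        - einner dY (sp_gradY p t (fst (x \<omega>, y \<omega>)) (snd (x \<omega>, y \<omega>)) s) v\<bar> \<le> sp_LGY p / 2 * (enorm dY v)\<^sup>2)"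
    if \<omega>: "\<omega> \<in> space M" for \<omega>
    using gradY_bound[OF t] AE_regular[OF t]
  proof eventually_elim
    case (elim s)
    have x: "x \<omega> \<in> X" and y: "y \<omega> \<in> Y"
      using xy[OF \<omega>] by auto
    have g: "has_gradient dY B (\<lambda>b. sp_F p t (x \<omega>) b s) (sp_gradY p t (x \<omega>) b s) b" if "b \<in> B" for b
      using elim(2) that x by (auto simp: continuously_differentiable_def)
    have l: "lipschitz_map_on dY dY (sp_LGY p) B (\<lambda>b. sp_gradY p t (x \<omega>) b s)"
      using elim(2) x by (auto simp: lipschitz_gradient_def)
    show ?case
    proof (intro conjI ballI)
      fix v assume v: "v \<in> Rn dY"
      have a: "y \<omega> \<in> B"
        using y B(1) by auto
      then have b: "(\<lambda>k. y \<omega> k + v k) \<in> B"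
        using v unfolding AB mem_Rn by auto
      have "(\<lambda>k. y \<omega> k + v k) - y \<omega> = v"
        by (simp add: fun_eq_iff)
      then show "\<bar>sp_F p t (fst (x \<omega>, y \<omega>)) (\<lambda>k. snd (x \<omega>, y \<omega>) k + v k) s - sp_F p t (fst (x \<omega>, y \<omega>)) (snd (x \<omega>, y \<omega>)) s
          - einner dY (sp_gradY p t (fst (x \<omega>, y \<omega>)) (snd (x \<omega>, y \<omega>)) s) v\<bar> \<le> sp_LGY p / 2 * (enorm dY v)\<^sup>2"
        using gradient_remainder[OF B(3,2) g l a b] by (simp only: fst_conv snd_conv)
    qed (use elim(1) x y in \<open>auto simp: BY_def\<close>)
  qed
  note eX = M.fresh_zo_error[OF fX S m(1) feasible(2) BX constants_nonneg(3) \<nu>(1) measurable_F(2)[OF t] HX pm(1) bX]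
  note eY = M.fresh_zo_error[OF fY S m(2) feasible(3) BY constants_nonneg(4) \<nu>(2) measurable_F(3)[OF t] HY pm(2) bY]
  show "errX \<in> borel_measurable M"
    "(\<integral>\<^sup>+\<omega>. ennreal (errX \<omega>) \<partial>M) \<le>
      ennreal (sqrt (3 * real dX * BX\<^sup>2 / real mX) + sp_LGX p * \<nu>X * (real dX * sqrt (real dX)))"
    using eX unfolding errX_def mean_gradX_def by (simp_all only: fst_conv snd_conv)
  show "errY \<in> borel_measurable M"
    "(\<integral>\<^sup>+\<omega>. ennreal (errY \<omega>) \<partial>M) \<le>
      ennreal (sqrt (3 * real dY * BY\<^sup>2 / real mY) + sp_LGY p * \<nu>Y * (real dY * sqrt (real dY)))"
    using eY unfolding errY_def mean_gradY_def by (simp_all only: fst_conv snd_conv)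
qed

section \<open>Regret along a single path\<close>

lemma path_in_domain:
  assumes path: "fw_path p (\<lambda>_. \<gamma>) x1 y1 GX GY x y" and \<gamma>: "0 \<le> \<gamma>" "\<gamma> \<le> 1" and x1: "x1 \<in> X" "y1 \<in> Y"
  shows "1 \<le> t \<Longrightarrow> t \<le> T + 1 \<Longrightarrow> x t \<in> X \<and> y t \<in> Y"
proof (induction t rule: nat_induct_at_least)
  case base
  then show ?case
    using path x1 by (simp add: fw_path_def)
next
  case (Suc t)
  then have "t \<in> {1..T}"
    by simp
  then obtain sx sy where s: "is_arg_min (\<lambda>(a, b). einner dX a (GX t) + einner dY b (- GY t)) (\<lambda>z. z \<in> X \<times> Y) (sx, sy)"
    "x (t + 1) = conv_comb \<gamma> (x t) sx" "y (t + 1) = conv_comb \<gamma> (y t) sy"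
    using path unfolding fw_path_def by blast
  then show ?case
    using Suc conv_comb_mem[OF feasible(6) _ _ \<gamma>] conv_comb_mem[OF feasible(7) _ _ \<gamma>] by (auto simp: is_arg_min_def)
qed

text \<open>A real supremum is guaranteed to dominate its members once they are bounded above. Here
  Lipschitz continuity and finite diameters keep each function within \<open>?D\<close> of its value
  at a fixed point.\<close>

lemma drift_le:
  assumes t: "t \<in> {1..T}" and xy: "x \<in> X" "y \<in> Y"
  shows "\<bar>sp_f p t x y - sp_f p (next_round p t) x y\<bar> \<le>
    (SUP (x, y)\<in>X \<times> Y. \<bar>sp_f p t x y - sp_f p (next_round p t) x y\<bar>)"
proof -
  let ?t = "next_round p t" and ?D = "sp_LX p * sp_DX p + sp_LY p * sp_DY p"
  have t': "?t \<in> {1..T}"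
    using t by (auto simp: next_round_def)
  obtain x0 y0 where z: "x0 \<in> X" "y0 \<in> Y"
    using star_mem[OF t] by blast
  have b: "\<bar>sp_f p s a b - sp_f p s x0 y0\<bar> \<le> ?D" if s: "s \<in> {1..T}" and ab: "a \<in> X" "b \<in> Y" for s a b
  proof -
    interpret saddle_problem dX dY X Y "sp_f p s" "mean_gradX p s" "mean_gradY p s"
      "sp_muX p" "sp_muY p" "sp_LX p" "sp_LY p" "sp_LGX p" "sp_LGY p" "sp_LXY p" "sp_LYX p" "sp_DX p" "sp_DY p"
      using s by (rule expected_saddle_problem)
    have "\<bar>sp_f p s a b - sp_f p s x0 b\<bar> \<le> sp_LX p * enorm dX (a - x0)"
      using lipschitz_x ab z by (auto simp: lipschitz_fun_on_def)
    moreover have "\<dots> \<le> sp_LX p * sp_DX p"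
      using constants_nonneg by (intro mult_left_mono diam_X ab z)
    moreover have "\<bar>sp_f p s x0 b - sp_f p s x0 y0\<bar> \<le> sp_LY p * enorm dY (b - y0)"
      using lipschitz_y ab z by (auto simp: lipschitz_fun_on_def)
    moreover have "\<dots> \<le> sp_LY p * sp_DY p"
      using constants_nonneg by (intro mult_left_mono diam_Y ab z)
    ultimately show ?thesis
      by linarith
  qed
  have "bdd_above ((\<lambda>(x, y). \<bar>sp_f p t x y - sp_f p ?t x y\<bar>) ` (X \<times> Y))"
  proof (rule bdd_aboveI2[where M = "\<bar>sp_f p t x0 y0 - sp_f p ?t x0 y0\<bar> + 2 * ?D"])
    fix q assume "q \<in> X \<times> Y"
    then show "(case q of (x, y) \<Rightarrow> \<bar>sp_f p t x y - sp_f p ?t x y\<bar>) \<le> \<bar>sp_f p t x0 y0 - sp_f p ?t x0 y0\<bar> + 2 * ?D"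
      using b[OF t, of "fst q" "snd q"] b[OF t', of "fst q" "snd q"] by (auto simp: case_prod_beta)
  qed
  from cSUP_upper[OF _ this, of "(x, y)"] xy show ?thesis
    by simp
qed

text \<open>The potential is the gap of the current function at the current iterate. Its changes
  telescope, so the sum of the gaps is controlled by the initial gap, the errors, the smoothness
  terms and the drift; the merit is compared with the gap round by round.\<close>

lemma path_regret_le:
  assumes path: "fw_path p (\<lambda>_. \<gamma>) x1 y1 GX GY x y" and \<gamma>: "0 < \<gamma>" "\<gamma> \<le> 1" and x1: "x1 \<in> X" "y1 \<in> Y"
    and C0: "0 < sp_C0 p" and W: "in_uncertainty_D p W"
  defines "\<mu> \<equiv> min (sp_muX p) (sp_muY p)" and "L \<equiv> max (sp_LX p) (sp_LY p)"
  defines "C \<equiv> (sp_LGX p / 2 + sp_LXY p * sp_LYX p / \<mu>) * (sp_DX p)\<^sup>2 + (sp_LGY p / 2 + sp_LXY p * sp_LYX p / \<mu>) * (sp_DY p)\<^sup>2"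
    and "e \<equiv> (\<lambda>t. sp_DX p * enorm dX (GX t - mean_gradX p t (x t) (y t)) + sp_DY p * enorm dY (GY t - mean_gradY p t (x t) (y t)))"
  shows "(\<Sum>t=1..T. (sp_f p t (x t) (y t) - sp_f p t (sp_xstar p t) (sp_ystar p t))\<^sup>2) \<le>
    4 * L\<^sup>2 / (\<mu> * (\<gamma> * sp_C0 p)) * (L * (sp_DX p + sp_DY p) + \<gamma> * (\<Sum>t=1..T. e t) + real T * (\<gamma>\<^sup>2 * C) + 2 * W)"
proof -
  note nn = constants_nonneg
  have dom: "x t \<in> X" "y t \<in> Y" if "1 \<le> t" "t \<le> T + 1" for t
    using path_in_domain[OF path _ \<gamma>(2) x1 that] \<gamma>(1) by auto
  define g where "g s t = duality_gap X Y (sp_f p s) (x t) (y t)" for s t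
  \<comment> \<open>There is an iterate \<open>T + 1\<close> but no function of that index;
    \<open>min t T\<close> matches \<open>next_round\<close>, so the last drift is 0.\<close>
  define u where "u t = g (min t T) t" for t
  define w where "w t = (SUP (x, y)\<in>X \<times> Y. \<bar>sp_f p t x y - sp_f p (next_round p t) x y\<bar>)" for t
  have \<mu>: "0 < \<mu>" "\<mu> \<le> sp_muX p" "\<mu> \<le> sp_muY p"
    using feasible by (auto simp: \<mu>_def)
  have C0eq: "1 - sqrt 2 / sqrt (min (sp_muX p * \<delta>X\<^sup>2) (sp_muY p * \<delta>Y\<^sup>2)) *
      max (sp_DX p * sp_LXY p / sqrt (sp_muY p)) (sp_DY p * sp_LYX p / sqrt (sp_muX p)) = sp_C0 p"
    by (simp add: sp_C0_def sp_delta_mu_def)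
  have step: "u (t + 1) \<le> u t - (\<gamma> * sp_C0 p * g t t - \<gamma> * e t - \<gamma>\<^sup>2 * C - 2 * w t)" if t: "1 \<le> t" "t \<le> T" for t
  proof -
    have tT: "t \<in> {1..T}"
      using t by simp
    interpret saddle_problem dX dY X Y "sp_f p t" "mean_gradX p t" "mean_gradY p t"
      "sp_muX p" "sp_muY p" "sp_LX p" "sp_LY p" "sp_LGX p" "sp_LGY p" "sp_LXY p" "sp_LYX p" "sp_DX p" "sp_DY p"
      using tT by (rule expected_saddle_problem)
    obtain sx sy where s: "is_arg_min (\<lambda>(a, b). einner dX a (GX t) + einner dY b (- GY t)) (\<lambda>z. z \<in> X \<times> Y) (sx, sy)"
      and next_xy: "x (t + 1) = conv_comb \<gamma> (x t) sx" "y (t + 1) = conv_comb \<gamma> (y t) sy"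
      using path tT unfolding fw_path_def by blast
    have sm: "sx \<in> X" "sy \<in> Y"
      using s by (auto simp: is_arg_min_def)
    have min: "einner dX sx (GX t) + einner dY sy (- GY t) \<le> einner dX a (GX t) + einner dY b (- GY t)"
      if "a \<in> X" "b \<in> Y" for a b
      using s that unfolding is_arg_min_def by (metis (no_types, lifting) case_prod_conv mem_Sigma_iff not_less)
    \<comment> \<open>Minimization over the product separates: fixing one block at its minimizer
      isolates the other.\<close>
    have minx: "einner dX sx (GX t) \<le> einner dX a (GX t)" if "a \<in> X" for a
      using min[OF that sm(2)] by simp
    have miny: "einner dY sy (- GY t) \<le> einner dY b (- GY t)" if "b \<in> Y" for b
      using min[OF sm(1) that] by simp
    have xy: "x t \<in> X" "y t \<in> Y" "x (t + 1) \<in> X" "y (t + 1) \<in> Y"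
      using dom[of t] dom[of "t + 1"] t by auto
    have "g t (t + 1) \<le> (1 - \<gamma> * sp_C0 p) * g t t + \<gamma> * e t
        + \<gamma>\<^sup>2 * ((sp_LGX p / 2 + sp_LXY p * sp_LYX p / sp_muY p) * (sp_DX p)\<^sup>2
               + (sp_LGY p / 2 + sp_LXY p * sp_LYX p / sp_muX p) * (sp_DY p)\<^sup>2)"
      unfolding g_def next_xy e_def
    proof (rule frank_wolfe_step[where xs = "sp_xstar p t" and ys = "sp_ystar p t" and \<delta>X = \<delta>X and \<delta>Y = \<delta>Y,
          unfolded C0eq])
      show "q \<in> X" if "q \<in> Rn dX" "enorm dX (sp_xstar p t - q) \<le> \<delta>X" for q
        using border_ball(1)[OF tT that] .
      show "q \<in> Y" if "q \<in> Rn dY" "enorm dY (sp_ystar p t - q) \<le> \<delta>Y" for q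
        using border_ball(2)[OF tT that] .
    qed (use xy sm \<gamma> minx miny saddle[OF tT] border_pos C0 in auto)
    \<comment> \<open>\<open>C\<close> has \<open>\<mu>\<close> in place of both moduli, so that the
      final constant depends on their minimum only.\<close>
    also have "\<dots> \<le> (1 - \<gamma> * sp_C0 p) * g t t + \<gamma> * e t + \<gamma>\<^sup>2 * C"
      unfolding C_def using \<mu> nn
      by (intro add_left_mono mult_left_mono add_mono mult_right_mono divide_left_mono) auto
    finally have 1: "g t (t + 1) \<le> g t t - \<gamma> * sp_C0 p * g t t + \<gamma> * e t + \<gamma>\<^sup>2 * C"
      by (simp add: algebra_simps)
    \<comment> \<open>The step is estimated for the old function; only then is the function
      exchanged, at the new iterate.\<close>
    have "g (next_round p t) (t + 1) \<le> g t (t + 1) + 2 * w t"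
      unfolding g_def w_def by (rule duality_gap_perturb[OF xy(3,4) drift_le[OF tT]])
    moreover have "u t = g t t" "u (t + 1) = g (next_round p t) (t + 1)"
      using t by (simp_all add: u_def next_round_def)
    ultimately show ?thesis
      using 1 by linarith
  qed
  have "(\<Sum>t=1..T. \<gamma> * sp_C0 p * g t t - \<gamma> * e t - \<gamma>\<^sup>2 * C - 2 * w t) \<le> u 1 - u (T + 1)"
    using step by (rule sum_le_telescope)
  moreover have "(\<Sum>t=1..T. \<gamma> * sp_C0 p * g t t - \<gamma> * e t - \<gamma>\<^sup>2 * C - 2 * w t) =
      \<gamma> * sp_C0 p * (\<Sum>t=1..T. g t t) - \<gamma> * (\<Sum>t=1..T. e t) - real T * (\<gamma>\<^sup>2 * C) - 2 * (\<Sum>t=1..T. w t)"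
    by (simp add: sum_subtractf sum_distrib_left)
  moreover have "(\<Sum>t=1..T. w t) \<le> W"
    using W by (simp add: in_uncertainty_D_def w_def)
  moreover have "u 1 \<le> L * (sp_DX p + sp_DY p)"
  proof -
    have t: "1 \<in> {1..T}"
      using feasible(1) by simp
    interpret saddle_problem dX dY X Y "sp_f p 1" "mean_gradX p 1" "mean_gradY p 1"
      "sp_muX p" "sp_muY p" "sp_LX p" "sp_LY p" "sp_LGX p" "sp_LGY p" "sp_LXY p" "sp_LYX p" "sp_DX p" "sp_DY p"
      using t by (rule expected_saddle_problem)
    have "u 1 \<le> sp_LX p * sp_DX p + sp_LY p * sp_DY p"
      using duality_gap_le_diameter[OF dom[of 1]] nn t by (simp add: u_def g_def min_def)
    also have "\<dots> \<le> L * sp_DX p + L * sp_DY p"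
      using nn by (intro add_mono mult_right_mono) (auto simp: L_def)
    finally show ?thesis
      by (simp add: distrib_left)
  qed
  moreover have "0 \<le> u (T + 1)"
  proof -
    have t: "T \<in> {1..T}"
      using feasible(1) by simp
    interpret saddle_problem dX dY X Y "sp_f p T" "mean_gradX p T" "mean_gradY p T"
      "sp_muX p" "sp_muY p" "sp_LX p" "sp_LY p" "sp_LGX p" "sp_LGY p" "sp_LXY p" "sp_LYX p" "sp_DX p" "sp_DY p"
      using t by (rule expected_saddle_problem)
    show ?thesis
      using duality_gap_nonneg[OF dom[of "T + 1"]] by (simp add: u_def g_def)
  qed
  ultimately have gaps: "(\<Sum>t=1..T. g t t) * (\<gamma> * sp_C0 p) \<le>
      L * (sp_DX p + sp_DY p) + \<gamma> * (\<Sum>t=1..T. e t) + real T * (\<gamma>\<^sup>2 * C) + 2 * W" (is "_ \<le> ?R")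
    by (simp add: mult.commute)
  have gC: "0 < \<gamma> * sp_C0 p"
    using \<gamma> C0 by simp
  have "(\<Sum>t=1..T. (sp_f p t (x t) (y t) - sp_f p t (sp_xstar p t) (sp_ystar p t))\<^sup>2) \<le> (\<Sum>t=1..T. 4 * L\<^sup>2 / \<mu> * g t t)"
  proof (rule sum_mono)
    fix t assume t: "t \<in> {1..T}"
    interpret saddle_problem dX dY X Y "sp_f p t" "mean_gradX p t" "mean_gradY p t"
      "sp_muX p" "sp_muY p" "sp_LX p" "sp_LY p" "sp_LGX p" "sp_LGY p" "sp_LXY p" "sp_LYX p" "sp_DX p" "sp_DY p"
      using t by (rule expected_saddle_problem)
    show "(sp_f p t (x t) (y t) - sp_f p t (sp_xstar p t) (sp_ystar p t))\<^sup>2 \<le> 4 * L\<^sup>2 / \<mu> * g t t"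
      using merit_le_duality_gap[OF dom(1)[of t] dom(2)[of t] saddle[OF t]] t nn by (simp add: L_def \<mu>_def g_def)
  qed
  also have "\<dots> = 4 * L\<^sup>2 / \<mu> * (\<Sum>t=1..T. g t t)"
    by (simp add: sum_distrib_left)
  also have "\<dots> \<le> 4 * L\<^sup>2 / \<mu> * (?R / (\<gamma> * sp_C0 p))"
    using gaps gC \<mu> by (intro mult_left_mono) (simp_all add: pos_le_divide_eq)
  finally show ?thesis
    by simp
qed

end

text \<open>\<open>T\<close> errors of size \<open>1 / sqrt T\<close> add up to
  \<open>sqrt T\<close>, which comes with the factor \<open>\<gamma>\<close>.\<close>

lemma (in stochastic_saddle) expected_regret_le:
  assumes M: "prob_space M" and \<gamma>: "0 < \<gamma>" "\<gamma> \<le> 1" and x1: "x1 \<in> X" "y1 \<in> Y"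
    and path: "\<And>\<omega>. \<omega> \<in> space M \<Longrightarrow>
      fw_path p (\<lambda>_. \<gamma>) x1 y1 (\<lambda>t. GX t \<omega>) (\<lambda>t. GY t \<omega>) (\<lambda>t. x t \<omega>) (\<lambda>t. y t \<omega>)"
    and C0: "0 < sp_C0 p" and W: "in_uncertainty_D p W" and \<kappa>: "0 \<le> \<kappa>X" "0 \<le> \<kappa>Y"
  defines "errX \<equiv> (\<lambda>t \<omega>. enorm dX (GX t \<omega> - mean_gradX p t (x t \<omega>) (y t \<omega>)))"
    and "errY \<equiv> (\<lambda>t \<omega>. enorm dY (GY t \<omega> - mean_gradY p t (x t \<omega>) (y t \<omega>)))"
  assumes eX: "\<And>t. t \<in> {1..T} \<Longrightarrow> errX t \<in> borel_measurable M"
      "\<And>t. t \<in> {1..T} \<Longrightarrow> (\<integral>\<^sup>+\<omega>. ennreal (errX t \<omega>) \<partial>M) \<le> ennreal (\<kappa>X / sqrt (real T))"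
    and eY: "\<And>t. t \<in> {1..T} \<Longrightarrow> errY t \<in> borel_measurable M"
      "\<And>t. t \<in> {1..T} \<Longrightarrow> (\<integral>\<^sup>+\<omega>. ennreal (errY t \<omega>) \<partial>M) \<le> ennreal (\<kappa>Y / sqrt (real T))"
  defines "\<mu> \<equiv> min (sp_muX p) (sp_muY p)" and "L \<equiv> max (sp_LX p) (sp_LY p)"
  defines "C \<equiv> (sp_LGX p / 2 + sp_LXY p * sp_LYX p / \<mu>) * (sp_DX p)\<^sup>2 + (sp_LGY p / 2 + sp_LXY p * sp_LYX p / \<mu>) * (sp_DY p)\<^sup>2"
  shows "regret_DSPM p M x y \<le> 4 * L\<^sup>2 / (\<mu> * (\<gamma> * sp_C0 p)) *
    (L * (sp_DX p + sp_DY p) + \<gamma> * (sqrt (real T) * (sp_DX p * \<kappa>X + sp_DY p * \<kappa>Y)) + real T * (\<gamma>\<^sup>2 * C) + 2 * W)"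
proof -
  interpret M: prob_space M by fact
  note nn = constants_nonneg
  have T: "1 \<le> T"
    by (rule feasible)
  have \<mu>: "0 < \<mu>"
    using feasible by (simp add: \<mu>_def)
  define c where "c = 4 * L\<^sup>2 / (\<mu> * (\<gamma> * sp_C0 p))"
  have c: "0 \<le> c"
    using \<mu> \<gamma> C0 by (simp add: c_def)
  have err: "integrable M h \<and> (\<integral>\<omega>. h \<omega> \<partial>M) \<le> k"
    if "h \<in> borel_measurable M" "(\<integral>\<^sup>+\<omega>. ennreal (h \<omega>) \<partial>M) \<le> ennreal k" "\<And>\<omega>. 0 \<le> h \<omega>" "0 \<le> k" for h k
  proof -
    have "(\<integral>\<^sup>+\<omega>. ennreal (norm (h \<omega>)) \<partial>M) < \<infinity>"
      using that by (auto intro: le_less_trans)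
    then have i: "integrable M h"
      using that(1) by (intro integrableI_bounded)
    have "ennreal (\<integral>\<omega>. h \<omega> \<partial>M) \<le> ennreal k"
      using that(2) nn_integral_eq_integral[OF i] that(3) by simp
    then show ?thesis
      using i that(4) by simp
  qed
  have EX: "integrable M (errX t)" "(\<integral>\<omega>. errX t \<omega> \<partial>M) \<le> \<kappa>X / sqrt (real T)" if "t \<in> {1..T}" for t
    using err[OF eX[OF that]] \<kappa> by (simp_all add: errX_def)
  have EY: "integrable M (errY t)" "(\<integral>\<omega>. errY t \<omega> \<partial>M) \<le> \<kappa>Y / sqrt (real T)" if "t \<in> {1..T}" for t
    using err[OF eY[OF that]] \<kappa> by (simp_all add: errY_def)
  define e where "e t \<omega> = sp_DX p * errX t \<omega> + sp_DY p * errY t \<omega>" for t \<omega>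
  have e_int: "integrable M (e t)" if "t \<in> {1..T}" for t
    unfolding e_def using EX(1)[OF that] EY(1)[OF that] by auto
  define k where "k = (sp_DX p * \<kappa>X + sp_DY p * \<kappa>Y) / sqrt (real T)"
  have e_le: "(\<integral>\<omega>. e t \<omega> \<partial>M) \<le> k" if t: "t \<in> {1..T}" for t
  proof -
    have "(\<integral>\<omega>. e t \<omega> \<partial>M) = sp_DX p * (\<integral>\<omega>. errX t \<omega> \<partial>M) + sp_DY p * (\<integral>\<omega>. errY t \<omega> \<partial>M)"
      unfolding e_def using EX(1)[OF t] EY(1)[OF t] by simp
    also have "\<dots> \<le> sp_DX p * (\<kappa>X / sqrt (real T)) + sp_DY p * (\<kappa>Y / sqrt (real T))"
      by (intro add_mono mult_left_mono EX(2)[OF t] EY(2)[OF t] nn)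
    finally show ?thesis
      by (simp add: k_def add_divide_distrib)
  qed
  define R where "R \<omega> = c * (L * (sp_DX p + sp_DY p) + \<gamma> * (\<Sum>t=1..T. e t \<omega>) + real T * (\<gamma>\<^sup>2 * C) + 2 * W)" for \<omega>
  have sum_int: "integrable M (\<lambda>\<omega>. \<Sum>t=1..T. e t \<omega>)"
    by (intro Bochner_Integration.integrable_sum e_int)
  have R_int: "integrable M R"
    unfolding R_def using sum_int by simp
  have le: "(\<Sum>t=1..T. (sp_f p t (x t \<omega>) (y t \<omega>) - sp_f p t (sp_xstar p t) (sp_ystar p t))\<^sup>2) \<le> R \<omega>"
    if "\<omega> \<in> space M" for \<omega>
    using path_regret_le[OF path[OF that] \<gamma> x1 C0 W]
    unfolding R_def c_def e_def errX_def errY_def \<mu>_def L_def C_def .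
  have R0: "0 \<le> R \<omega>" if "\<omega> \<in> space M" for \<omega>
    by (rule order_trans[OF _ le[OF that]]) (simp add: sum_nonneg)
  \<comment> \<open>\<open>integral_mono'\<close> asks for integrability of the majorant
    \<open>R\<close> only; the integral of a non-integrable merit would be 0.\<close>
  have "regret_DSPM p M x y \<le> (\<integral>\<omega>. R \<omega> \<partial>M)"
    unfolding regret_DSPM_def using R_int le R0 by (rule integral_mono')
  also have "\<dots> = c * (L * (sp_DX p + sp_DY p) + \<gamma> * (\<Sum>t=1..T. \<integral>\<omega>. e t \<omega> \<partial>M) + real T * (\<gamma>\<^sup>2 * C) + 2 * W)"
  proof -
    have "(\<integral>\<omega>. (\<Sum>t=1..T. e t \<omega>) \<partial>M) = (\<Sum>t=1..T. \<integral>\<omega>. e t \<omega> \<partial>M)"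
      by (rule Bochner_Integration.integral_sum) (rule e_int)
    then show ?thesis
      unfolding R_def using sum_int by (simp add: M.prob_space)
  qed
  also have "\<dots> \<le> c * (L * (sp_DX p + sp_DY p) + \<gamma> * (\<Sum>t=1..T. k) + real T * (\<gamma>\<^sup>2 * C) + 2 * W)"
    using \<gamma> by (intro mult_left_mono[OF _ c] add_right_mono add_left_mono mult_left_mono sum_mono e_le) auto
  also have "(\<Sum>t=1..T. k) = sqrt (real T) * (sp_DX p * \<kappa>X + sp_DY p * \<kappa>Y)"
    using T by (simp add: k_def field_simps)
  finally show ?thesis
    by (simp add: c_def)
qed

text \<open>With \<open>q = 1 / \<gamma>\<close> the rate is
  \<open>q * (b + \<sigma>\<^sup>2)\<close>, so each of the four terms has to be a multiple of
  \<open>b + \<sigma>\<^sup>2\<close> up to the factor \<open>q\<close>. For the drift and for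
  \<open>T * \<gamma>\<^sup>2 = b\<close> this is immediate; the initial gap \<open>a\<close> and
  the error term \<open>k * sqrt b\<close> use the lower bound \<open>c\<close>.\<close>

lemma frank_wolfe_rate:
  assumes b: "0 < b" "0 < T" and reg: "0 < c" "c \<le> b + \<sigma>\<^sup>2" and W: "2 * W \<le> b"
    and nn: "0 \<le> a" "0 \<le> k" "0 \<le> C"
  defines "\<gamma> \<equiv> sqrt (b / T)"
  shows "(a + \<gamma> * (sqrt T * k) + T * (\<gamma>\<^sup>2 * C) + 2 * W) / \<gamma> \<le>
    (a / c + k / sqrt c + C + 1) * (sqrt (T * b) * (1 + \<sigma>\<^sup>2 / b))"
proof -
  define q where "q = sqrt T / sqrt b"
  have q: "0 < q"
    using b by (simp add: q_def)
  have R: "sqrt (T * b) * (1 + \<sigma>\<^sup>2 / b) = q * (b + \<sigma>\<^sup>2)"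
  proof -
    have "q * (b + \<sigma>\<^sup>2) = q * b * (1 + \<sigma>\<^sup>2 / b)"
      using b by (simp add: field_simps)
    also have "q * b = sqrt (T * b)"
      using b by (simp add: q_def real_sqrt_mult field_simps)
    finally show ?thesis ..
  qed
  have "1 / \<gamma> = q" "\<gamma> \<noteq> 0"
    using b by (simp_all add: \<gamma>_def q_def real_sqrt_divide)
  moreover have "T * \<gamma>\<^sup>2 = b"
    using b by (simp add: \<gamma>_def)
  ultimately have \<gamma>: "1 / \<gamma> = q" "T * \<gamma>\<^sup>2 = b" "\<gamma> \<noteq> 0"
    by blast+
  \<comment> \<open>Both \<open>b\<close> and \<open>c\<close> are at most
    \<open>b + \<sigma>\<^sup>2\<close>, hence so is their geometric mean.\<close>
  have "sqrt b * sqrt c \<le> sqrt ((b + \<sigma>\<^sup>2)\<^sup>2)"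
    unfolding real_sqrt_mult[symmetric] power2_eq_square[of "b + _"] using b reg by (intro real_sqrt_le_mono mult_mono) auto
  then have bc: "sqrt b \<le> (b + \<sigma>\<^sup>2) / sqrt c"
    using b reg by (simp add: pos_le_divide_eq)
  have sT: "sqrt T = q * sqrt b"
    using b by (simp add: q_def)
  \<comment> \<open>The last bracket is 0, as \<open>sqrt T = q * sqrt b\<close>.\<close>
  have "(a + \<gamma> * (sqrt T * k) + T * (\<gamma>\<^sup>2 * C) + 2 * W) / \<gamma> = q * (a + k * sqrt b + b * C + 2 * W) + (sqrt T * k - q * (k * sqrt b))"
  proof -
    have "(a + \<gamma> * (sqrt T * k) + T * (\<gamma>\<^sup>2 * C) + 2 * W) / \<gamma> = 1 / \<gamma> * (a + T * \<gamma>\<^sup>2 * C + 2 * W) + sqrt T * k"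
      using \<gamma>(3) by (simp add: add_divide_distrib mult.assoc)
    then show ?thesis
      unfolding \<gamma>(1,2) by (simp add: algebra_simps)
  qed
  also have "\<dots> = q * (a + k * sqrt b + b * C + 2 * W)"
    by (simp add: sT)
  also have "\<dots> \<le> q * (a / c * (b + \<sigma>\<^sup>2) + k * ((b + \<sigma>\<^sup>2) / sqrt c) + (b + \<sigma>\<^sup>2) * C + (b + \<sigma>\<^sup>2))"
  proof -
    have "a \<le> a / c * (b + \<sigma>\<^sup>2)"
      using mult_left_mono[OF reg(2) nn(1)] reg(1) by (simp add: pos_le_divide_eq)
    moreover have "b * C \<le> (b + \<sigma>\<^sup>2) * C"
      using nn by (intro mult_right_mono) auto
    moreover have "2 * W \<le> b + \<sigma>\<^sup>2"
      using W by (simp add: add_increasing2)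
    ultimately show ?thesis
      using q by (intro mult_left_mono add_mono mult_left_mono[OF bc nn(2)]) auto
  qed
  also have "\<dots> = (a / c + k / sqrt c + C + 1) * (q * (b + \<sigma>\<^sup>2))"
    by (simp add: algebra_simps add_divide_distrib)
  finally show ?thesis
    unfolding R .
qed

text \<open>The batch size cancels the dimension in the second moment, as
  \<open>3 * real d / (real d + 5) \<le> 4\<close>, where 4 is chosen for its root. The smoothing
  radius cancels the third moment, as \<open>real d ^ 3 \<le> (real d + 3) ^ 3\<close>.\<close>

lemma gaussian_smoothing_rate:
  assumes T: "1 \<le> T" and B: "0 \<le> B" and LG: "0 \<le> LG"
  shows "sqrt (3 * real d * B\<^sup>2 / real (T * (d + 5))) + LG * (1 / sqrt (real T * (real d + 3) ^ 3)) * (real d * sqrt (real d))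
    \<le> (2 * B + LG) / sqrt (real T)"
proof -
  have "3 * real d * B\<^sup>2 / real (T * (d + 5)) \<le> (2 * B)\<^sup>2 / real T"
  proof -
    have "3 * real d * B\<^sup>2 / real (T * (d + 5)) = B\<^sup>2 / real T * (3 * real d / (real d + 5))"
      by (simp add: field_simps)
    also have "\<dots> \<le> B\<^sup>2 / real T * 4"
      by (intro mult_left_mono) (auto simp: pos_divide_le_eq)
    finally show ?thesis
      by (simp add: power_mult_distrib mult.commute)
  qed
  then have "sqrt (3 * real d * B\<^sup>2 / real (T * (d + 5))) \<le> sqrt ((2 * B)\<^sup>2 / real T)"
    by (rule real_sqrt_le_mono)
  also have "\<dots> = 2 * B / sqrt (real T)"
    unfolding real_sqrt_divide real_sqrt_abs using B by simp
  finally have 1: "sqrt (3 * real d * B\<^sup>2 / real (T * (d + 5))) \<le> 2 * B / sqrt (real T)" .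
  have "real d * sqrt (real d) = sqrt (real d ^ 3)"
    by (simp add: power3_eq_cube real_sqrt_mult)
  also have "\<dots> \<le> sqrt ((real d + 3) ^ 3)"
    by (intro real_sqrt_le_mono power_mono) auto
  finally have "LG * (1 / sqrt (real T * (real d + 3) ^ 3)) * (real d * sqrt (real d)) \<le>
      LG * (1 / sqrt (real T * (real d + 3) ^ 3)) * sqrt ((real d + 3) ^ 3)"
    using LG by (intro mult_left_mono) auto
  also have "\<dots> = LG / sqrt (real T)"
    by (simp add: real_sqrt_mult)
  finally show ?thesis
    using 1 unfolding add_divide_distrib by linarith
qed

text \<open>The order of quantifiers is the meaning of the O-notation: \<open>K\<close> may depend
  on the problem constants and on the threshold \<open>c\<close>, but it is fixed before the
  dimensions, the horizon, \<open>V\<close>, \<open>W\<close> and \<open>\<sigma>\<close>.\<close>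

theorem theorem4p2:
  fixes \<mu> L LGX LGY LXY LYX DX DY C0 c :: real
  assumes "0 < C0" and "C0 \<le> 1" and "0 < c"
  shows "\<exists>K>0. \<forall>(p :: 'k sp_problem) V W \<sigma> (M :: 'w measure) x1 y1 x y.
    min (sp_muX p) (sp_muY p) = \<mu> \<and> max (sp_LX p) (sp_LY p) = L \<and>
    sp_LGX p = LGX \<and> sp_LGY p = LGY \<and> sp_LXY p = LXY \<and> sp_LYX p = LYX \<and>
    sp_DX p = DX \<and> sp_DY p = DY \<and> sp_C0 p = C0 \<and>
    in_uncertainty_M p V \<and> in_uncertainty_D p W \<and> stochastic_oracle p \<sigma> \<and>
    bound_regime c (sp_T p) V W \<sigma> \<and> x1 \<in> sp_X p \<and> y1 \<in> sp_Y p \<longrightarrow>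
      (let T = sp_T p;
           \<gamma> = (\<lambda>_. sqrt (max (2 * W) V / real T));
           mX = (\<lambda>_. T * (sp_dX p + 5));
           mY = (\<lambda>_. T * (sp_dY p + 5));
           \<nu>X = 1 / sqrt (real T * (real (sp_dX p) + 3) ^ 3);
           \<nu>Y = 1 / sqrt (real T * (real (sp_dY p) + 3) ^ 3)
       in (sp_assumptions p (Rn (sp_dX p)) (Rn (sp_dY p)) \<longrightarrow>
             (\<forall>NX NY. zo_frank_wolfe p M \<gamma> mX mY \<nu>X \<nu>Y x1 y1 NX NY x y \<longrightarrow>
                regret_DSPM p M x y \<le> K * regret_rate T V W \<sigma>) \<and>
             real (zo_calls T mX mY) \<le> K * ((real (sp_dX p) + real (sp_dY p)) * (real T)\<^sup>2)) \<and>
          (sp_assumptions p (sp_X p) (sp_Y p) \<longrightarrow>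
             (\<forall>N. fo_frank_wolfe p M \<gamma> (\<lambda>_. T) x1 y1 N x y \<longrightarrow>
                regret_DSPM p M x y \<le> K * regret_rate T V W \<sigma>)))"
proof -
  define a where "a = L * (DX + DY)"
  \<comment> \<open>The constant \<open>2 * B + LG\<close> of
    \<open>gaussian_smoothing_rate\<close>, with \<open>L\<close> in place of \<open>sp_LX\<close>
    in \<open>B\<close>. It also majorizes the first-order constant \<open>B\<close>.\<close>
  define \<kappa>X where "\<kappa>X = 2 * (L + LGX * DX) + LGX"
  define \<kappa>Y where "\<kappa>Y = 2 * (L + LGY * DY) + LGY"
  define C where "C = (LGX / 2 + LXY * LYX / \<mu>) * DX\<^sup>2 + (LGY / 2 + LXY * LYX / \<mu>) * DY\<^sup>2"
  define k where "k = DX * \<kappa>X + DY * \<kappa>Y"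
  define small where "small M e \<kappa> \<longleftrightarrow> e \<in> borel_measurable M \<and> (\<integral>\<^sup>+\<omega>. ennreal (e \<omega>) \<partial>M) \<le> ennreal \<kappa>"
    for M :: "'w measure" and e \<kappa>
  \<comment> \<open>The 12 is for the oracle calls:
    \<open>2 * (dX + dY) + 20 \<le> 12 * (dX + dY)\<close> for dimensions at least 1.\<close>
  define K where "K = max 12 (4 * L\<^sup>2 / (\<mu> * C0) * (a / c + k / sqrt c + C + 1))"
  \<comment> \<open>Common to both oracles: arbitrary estimators \<open>GX\<close>,
    \<open>GY\<close> with errors of order \<open>1 / sqrt T\<close>. The error bounds may
    presuppose feasible iterates, since feasibility follows from the path and the step size
    alone.\<close>
  have main: "regret_DSPM p M x y \<le> K * regret_rate (sp_T p) V W \<sigma>"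
    if ss: "stochastic_saddle p A B \<sigma>" and M: "prob_space M" and x1: "x1 \<in> sp_X p" "y1 \<in> sp_Y p"
      and par: "min (sp_muX p) (sp_muY p) = \<mu>" "max (sp_LX p) (sp_LY p) = L" "sp_LGX p = LGX" "sp_LGY p = LGY"
        "sp_LXY p = LXY" "sp_LYX p = LYX" "sp_DX p = DX" "sp_DY p = DY" "sp_C0 p = C0"
      and W: "in_uncertainty_D p W" and regime: "bound_regime c (sp_T p) V W \<sigma>"
      and path: "\<And>\<omega>. \<omega> \<in> space M \<Longrightarrow> fw_path p (\<lambda>_. sqrt (max (2 * W) V / real (sp_T p))) x1 y1
        (\<lambda>t. GX t \<omega>) (\<lambda>t. GY t \<omega>) (\<lambda>t. x t \<omega>) (\<lambda>t. y t \<omega>)"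
      and err: "\<And>t. t \<in> {1..sp_T p} \<Longrightarrow> (\<And>\<omega>. \<omega> \<in> space M \<Longrightarrow> x t \<omega> \<in> sp_X p \<and> y t \<omega> \<in> sp_Y p) \<Longrightarrow>
        small M (\<lambda>\<omega>. enorm (sp_dX p) (GX t \<omega> - mean_gradX p t (x t \<omega>) (y t \<omega>))) (\<kappa>X / sqrt (real (sp_T p))) \<and>
        small M (\<lambda>\<omega>. enorm (sp_dY p) (GY t \<omega> - mean_gradY p t (x t \<omega>) (y t \<omega>))) (\<kappa>Y / sqrt (real (sp_T p)))"
    for p :: "'k sp_problem" and A B V W \<sigma> and M :: "'w measure" and x1 y1 x y GX GY
  proof -
    interpret stochastic_saddle p A B \<sigma>
      by fact
    define b where "b = max (2 * W) V"
    define \<gamma> where "\<gamma> = sqrt (b / real T)"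
    have b: "0 < b" "b \<le> real T" "2 * W \<le> b" "c \<le> b + \<sigma>\<^sup>2"
      using regime by (auto simp: bound_regime_def b_def)
    have T: "0 < real T"
      using feasible(1) by simp
    have \<gamma>: "0 < \<gamma>" "\<gamma> \<le> 1"
      using b T by (simp_all add: \<gamma>_def)
    have \<mu>: "0 < \<mu>"
      using feasible(10,11) par(1) by auto
    have L: "0 \<le> L"
      using constants_nonneg(1) par(2) by auto
    note nn = constants_nonneg(3-8)[unfolded par]
    have \<kappa>: "0 \<le> \<kappa>X" "0 \<le> \<kappa>Y"
      using L nn by (simp_all add: \<kappa>X_def \<kappa>Y_def)
    have pos: "0 \<le> a" "0 \<le> k" "0 \<le> C"
      using L nn \<kappa> \<mu> by (simp_all add: a_def k_def C_def)
    note path' = path[folded b_def, folded \<gamma>_def]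
    have dom: "x t \<omega> \<in> X \<and> y t \<omega> \<in> Y" if "t \<in> {1..T}" "\<omega> \<in> space M" for t \<omega>
      using path_in_domain[OF path'[OF that(2)] _ \<gamma>(2) x1, of t] \<gamma>(1) that(1) by simp
    have "regret_DSPM p M x y \<le> 4 * L\<^sup>2 / (\<mu> * (\<gamma> * C0)) *
        (a + \<gamma> * (sqrt (real T) * k) + real T * (\<gamma>\<^sup>2 * C) + 2 * W)"
      using expected_regret_le[OF M \<gamma> x1 path' _ W \<kappa>, unfolded par] err[OF _ dom] assms(1)
      unfolding a_def k_def C_def small_def by simp
    also have "\<dots> = 4 * L\<^sup>2 / (\<mu> * C0) * ((a + \<gamma> * (sqrt (real T) * k) + real T * (\<gamma>\<^sup>2 * C) + 2 * W) / \<gamma>)"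
      by (simp add: mult_ac)
    also have "\<dots> \<le> 4 * L\<^sup>2 / (\<mu> * C0) * ((a / c + k / sqrt c + C + 1) * (sqrt (real T * b) * (1 + \<sigma>\<^sup>2 / b)))"
      unfolding \<gamma>_def using \<mu> assms(1)
      by (intro mult_left_mono frank_wolfe_rate b T assms(3) pos) auto
    also have "\<dots> = 4 * L\<^sup>2 / (\<mu> * C0) * (a / c + k / sqrt c + C + 1) * regret_rate T V W \<sigma>"
      by (simp add: regret_rate_def b_def)
    also have "\<dots> \<le> K * regret_rate T V W \<sigma>"
      using b T by (intro mult_right_mono) (auto simp: K_def regret_rate_def b_def[symmetric])
    finally show ?thesis .
  qed
  show ?thesis
  proof (intro exI[of _ K] conjI allI impI)
    show "0 < K"
      by (simp add: K_def)
    fix p :: "'k sp_problem" and V W \<sigma> and M :: "'w measure" and x1 y1 x y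
    assume H: "min (sp_muX p) (sp_muY p) = \<mu> \<and> max (sp_LX p) (sp_LY p) = L \<and>
      sp_LGX p = LGX \<and> sp_LGY p = LGY \<and> sp_LXY p = LXY \<and> sp_LYX p = LYX \<and>
      sp_DX p = DX \<and> sp_DY p = DY \<and> sp_C0 p = C0 \<and>
      in_uncertainty_M p V \<and> in_uncertainty_D p W \<and> stochastic_oracle p \<sigma> \<and>
      bound_regime c (sp_T p) V W \<sigma> \<and> x1 \<in> sp_X p \<and> y1 \<in> sp_Y p"
    let ?T = "sp_T p"
    let ?\<nu> = "\<lambda>d. 1 / sqrt (real ?T * (real d + 3) ^ 3)"
    have zo: "regret_DSPM p M x y \<le> K * regret_rate ?T V W \<sigma>"
      if asm: "sp_assumptions p (Rn (sp_dX p)) (Rn (sp_dY p))"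
        and fw: "zo_frank_wolfe p M (\<lambda>_. sqrt (max (2 * W) V / real ?T)) (\<lambda>_. ?T * (sp_dX p + 5)) (\<lambda>_. ?T * (sp_dY p + 5))
          (?\<nu> (sp_dX p)) (?\<nu> (sp_dY p)) x1 y1 NX NY x y" for NX NY
    proof -
      have "sp_X p \<subseteq> Rn (sp_dX p)" "sp_Y p \<subseteq> Rn (sp_dY p)"
        using asm compactin_subset_topspace by (auto simp: sp_assumptions_def sp_feasible_sets_def)
      then have ss: "stochastic_saddle p (Rn (sp_dX p)) (Rn (sp_dY p)) \<sigma>"
        using asm H by unfold_locales (auto simp: convex_set_Rn)
      interpret stochastic_saddle p "Rn (sp_dX p)" "Rn (sp_dY p)" \<sigma>
        by (rule ss)
      have M: "prob_space M"
        using fw by (simp add: zo_frank_wolfe_def)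
      have \<nu>: "0 < ?\<nu> d" for d
        using feasible(1) by simp
      have m: "1 \<le> ?T * (d + 5)" for d
        using feasible(1) by simp
      have LL: "sp_LX p \<le> L" "sp_LY p \<le> L"
        using H by auto
      let ?GX = "\<lambda>t \<omega>. zo_estimator (?T * (sp_dX p + 5)) (?\<nu> (sp_dX p)) (\<lambda>a. sp_F p t a (y t \<omega>)) (x t \<omega>) (NX t \<omega>)"
      let ?GY = "\<lambda>t \<omega>. zo_estimator (?T * (sp_dY p + 5)) (?\<nu> (sp_dY p)) (\<lambda>b. sp_F p t (x t \<omega>) b) (y t \<omega>) (NY t \<omega>)"
      show ?thesis
      proof (rule main[OF ss M, where GX = ?GX and GY = ?GY])
        fix t assume t: "t \<in> {1..?T}" and dom: "\<And>\<omega>. \<omega> \<in> space M \<Longrightarrow> x t \<omega> \<in> sp_X p \<and> y t \<omega> \<in> sp_Y p"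
        have fresh: "fresh_noise M (\<lambda>\<omega>. (x t \<omega>, y t \<omega>))
          (PiM {1..?T * (sp_dX p + 5)} (\<lambda>_. sp_noise p t \<Otimes>\<^sub>M std_gauss (sp_dX p)) \<Otimes>\<^sub>M
           PiM {1..?T * (sp_dY p + 5)} (\<lambda>_. sp_noise p t \<Otimes>\<^sub>M std_gauss (sp_dY p))) (\<lambda>\<omega>. (NX t \<omega>, NY t \<omega>))"
          using fw t by (simp add: zo_frank_wolfe_def)
        have rate: "sqrt (3 * real d * B\<^sup>2 / real (?T * (d + 5))) + LG * ?\<nu> d * (real d * sqrt (real d)) \<le> \<kappa> / sqrt (real ?T)"
          if "0 \<le> B" "0 \<le> LG" "2 * B + LG \<le> \<kappa>" for B LG \<kappa> d
          using order_trans[OF gaussian_smoothing_rate[OF feasible(1) that(1,2)] divide_right_mono[OF that(3)]] by simp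
        have "sqrt (3 * real (sp_dX p) * (sp_LX p + sp_LGX p * sp_DX p)\<^sup>2 / real (?T * (sp_dX p + 5))) +
            sp_LGX p * ?\<nu> (sp_dX p) * (real (sp_dX p) * sqrt (real (sp_dX p))) \<le> \<kappa>X / sqrt (real ?T)"
          using constants_nonneg LL(1) H by (intro rate) (auto simp: \<kappa>X_def)
        moreover have "sqrt (3 * real (sp_dY p) * (sp_LY p + sp_LGY p * sp_DY p)\<^sup>2 / real (?T * (sp_dY p + 5))) +
            sp_LGY p * ?\<nu> (sp_dY p) * (real (sp_dY p) * sqrt (real (sp_dY p))) \<le> \<kappa>Y / sqrt (real ?T)"
          using constants_nonneg LL(2) H by (intro rate) (auto simp: \<kappa>Y_def)
        ultimately show "small M (\<lambda>\<omega>. enorm (sp_dX p) (?GX t \<omega> - mean_gradX p t (x t \<omega>) (y t \<omega>))) (\<kappa>X / sqrt (real ?T)) \<and>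
            small M (\<lambda>\<omega>. enorm (sp_dY p) (?GY t \<omega> - mean_gradY p t (x t \<omega>) (y t \<omega>))) (\<kappa>Y / sqrt (real ?T))"
          unfolding small_def using zo_errors[OF M t m m \<nu> \<nu> refl refl fresh dom] by (meson ennreal_leI order_trans)
      next
        fix \<omega> assume "\<omega> \<in> space M"
        then show "fw_path p (\<lambda>_. sqrt (max (2 * W) V / real ?T)) x1 y1
            (\<lambda>t. ?GX t \<omega>) (\<lambda>t. ?GY t \<omega>)
            (\<lambda>t. x t \<omega>) (\<lambda>t. y t \<omega>)"
          using fw by (simp add: zo_frank_wolfe_def)
      qed (use H in auto)
    qed
    have calls: "real (zo_calls ?T (\<lambda>_. ?T * (sp_dX p + 5)) (\<lambda>_. ?T * (sp_dY p + 5))) \<le>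
        K * ((real (sp_dX p) + real (sp_dY p)) * (real ?T)\<^sup>2)"
      if asm: "sp_assumptions p (Rn (sp_dX p)) (Rn (sp_dY p))"
    proof -
      have d: "1 \<le> real (sp_dX p)" "1 \<le> real (sp_dY p)"
        using asm by (auto simp: sp_assumptions_def sp_feasible_sets_def)
      have "real (zo_calls ?T (\<lambda>_. ?T * (sp_dX p + 5)) (\<lambda>_. ?T * (sp_dY p + 5))) =
          (2 * (real (sp_dX p) + real (sp_dY p)) + 20) * (real ?T)\<^sup>2"
        by (simp add: zo_calls_def algebra_simps power2_eq_square)
      also have "\<dots> \<le> (12 * (real (sp_dX p) + real (sp_dY p))) * (real ?T)\<^sup>2"
        using d by (intro mult_right_mono) auto
      also have "\<dots> \<le> (K * (real (sp_dX p) + real (sp_dY p))) * (real ?T)\<^sup>2"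
        by (intro mult_right_mono) (auto simp: K_def)
      finally show ?thesis
        by (simp add: mult.assoc)
    qed
    have fo: "regret_DSPM p M x y \<le> K * regret_rate ?T V W \<sigma>"
      if asm: "sp_assumptions p (sp_X p) (sp_Y p)"
        and fw: "fo_frank_wolfe p M (\<lambda>_. sqrt (max (2 * W) V / real ?T)) (\<lambda>_. ?T) x1 y1 N x y" for N
    proof -
      have "sp_X p \<subseteq> Rn (sp_dX p)" "sp_Y p \<subseteq> Rn (sp_dY p)"
        using asm compactin_subset_topspace by (auto simp: sp_assumptions_def sp_feasible_sets_def)
      then have ss: "stochastic_saddle p (sp_X p) (sp_Y p) \<sigma>"
        using asm H by unfold_locales (auto simp: sp_assumptions_def sp_feasible_sets_def)
      interpret stochastic_saddle p "sp_X p" "sp_Y p" \<sigma>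
        by (rule ss)
      have M: "prob_space M"
        using fw by (simp add: fo_frank_wolfe_def)
      have LL: "sp_LX p \<le> L" "sp_LY p \<le> L"
        using H by auto
      let ?GX = "\<lambda>t \<omega>. fo_estimator ?T (sp_gradX p t (x t \<omega>) (y t \<omega>)) (N t \<omega>)"
      let ?GY = "\<lambda>t \<omega>. fo_estimator ?T (sp_gradY p t (x t \<omega>) (y t \<omega>)) (N t \<omega>)"
      show ?thesis
      proof (rule main[OF ss M, where GX = ?GX and GY = ?GY])
        fix t assume t: "t \<in> {1..?T}" and dom: "\<And>\<omega>. \<omega> \<in> space M \<Longrightarrow> x t \<omega> \<in> sp_X p \<and> y t \<omega> \<in> sp_Y p"
        have fresh: "fresh_noise M (\<lambda>\<omega>. (x t \<omega>, y t \<omega>)) (PiM {1..?T} (\<lambda>_. sp_noise p t)) (N t)"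
          using fw t by (simp add: fo_frank_wolfe_def)
        have "\<kappa>X = 2 * L + 2 * (sp_LGX p * sp_DX p) + sp_LGX p" "\<kappa>Y = 2 * L + 2 * (sp_LGY p * sp_DY p) + sp_LGY p"
          using H by (simp_all add: \<kappa>X_def \<kappa>Y_def)
        moreover have "0 \<le> sp_LGX p * sp_DX p" "0 \<le> sp_LGY p * sp_DY p"
          using constants_nonneg by simp_all
        ultimately have "sp_LX p + sp_LGX p * sp_DX p \<le> \<kappa>X" "sp_LY p + sp_LGY p * sp_DY p \<le> \<kappa>Y"
          using constants_nonneg(1-4) LL by - linarith+
        then have "(sp_LX p + sp_LGX p * sp_DX p) / sqrt (real ?T) \<le> \<kappa>X / sqrt (real ?T)"
          "(sp_LY p + sp_LGY p * sp_DY p) / sqrt (real ?T) \<le> \<kappa>Y / sqrt (real ?T)"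
          by (auto intro!: divide_right_mono)
        then show "small M (\<lambda>\<omega>. enorm (sp_dX p) (?GX t \<omega> - mean_gradX p t (x t \<omega>) (y t \<omega>))) (\<kappa>X / sqrt (real ?T)) \<and>
            small M (\<lambda>\<omega>. enorm (sp_dY p) (?GY t \<omega> - mean_gradY p t (x t \<omega>) (y t \<omega>))) (\<kappa>Y / sqrt (real ?T))"
          unfolding small_def using fo_errors[OF M t feasible(1) fresh dom] by (meson ennreal_leI order_trans)
      next
        fix \<omega> assume "\<omega> \<in> space M"
        then show "fw_path p (\<lambda>_. sqrt (max (2 * W) V / real ?T)) x1 y1
            (\<lambda>t. ?GX t \<omega>) (\<lambda>t. ?GY t \<omega>)
            (\<lambda>t. x t \<omega>) (\<lambda>t. y t \<omega>)"
          using fw by (simp add: fo_frank_wolfe_def)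
      qed (use H in auto)
    qed
    show "let T = sp_T p;
           \<gamma> = (\<lambda>_. sqrt (max (2 * W) V / real T));
           mX = (\<lambda>_. T * (sp_dX p + 5));
           mY = (\<lambda>_. T * (sp_dY p + 5));
           \<nu>X = 1 / sqrt (real T * (real (sp_dX p) + 3) ^ 3);
           \<nu>Y = 1 / sqrt (real T * (real (sp_dY p) + 3) ^ 3)
       in (sp_assumptions p (Rn (sp_dX p)) (Rn (sp_dY p)) \<longrightarrow>
             (\<forall>NX NY. zo_frank_wolfe p M \<gamma> mX mY \<nu>X \<nu>Y x1 y1 NX NY x y \<longrightarrow>
                regret_DSPM p M x y \<le> K * regret_rate T V W \<sigma>) \<and>
             real (zo_calls T mX mY) \<le> K * ((real (sp_dX p) + real (sp_dY p)) * (real T)\<^sup>2)) \<and>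
          (sp_assumptions p (sp_X p) (sp_Y p) \<longrightarrow>
             (\<forall>N. fo_frank_wolfe p M \<gamma> (\<lambda>_. T) x1 y1 N x y \<longrightarrow>
                regret_DSPM p M x y \<le> K * regret_rate T V W \<sigma>))"
      unfolding Let_def using zo calls fo by blast
  qed
qed

end
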